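(* Let $0\le\delta<\rho\le1$ and $\mu_1,\mu_2\in\mathbb{R}$. For $a_\hbar\in\mathcal{A}^{\mu_1,\mu_2}_{\rho,\delta}(\hbar\mathbb{Z}^n\times\hbar\mathbb{Z}^n\times\mathbb{T}^n)$ let the amplitude operator $T$ be given by $$Tf(k)=\sum_{l\in\hbar\mathbb{Z}^n}\int_{\mathbb{T}^n}e^{2\pi\frac{i}{\hbar}(k-l)\cdot\theta}a_\hbar(k,l,\theta)f(l)\,d\theta.$$ Then $T=\mathrm{Op}_\hbar(\sigma_{\hbar,T})$ for some $\sigma_{\hbar,T}\in S^{\mu_1+\mu_2}_{\rho,\delta}(\hbar\mathbb{Z}^n\times\mathbb{T}^n)$. Moreover, $$\sigma_{\hbar,T}(k,\theta)\sim\sum_\alpha\frac1{\alpha!}\Delta^\alpha_{\hbar,l}D^{(\alpha)}_{\hbar,\theta}a_\hbar(k,l,\theta)\Big|_{l=k},$$ that is, for all $N\in\mathbb{N}$, $$\sigma_{\hbar,T}(k,\theta)-\sum_{|\alpha|<N}\frac1{\alpha!}\Delta^\alpha_{\hbar,l}D^{(\alpha)}_{\hbar,\theta}a_\hbar(k,l,\theta)\Big|_{l=k}\in S^{\mu_1+\mu_2-N(\rho-\delta)}_{\rho,\delta}(\hbar\mathbb{Z}^n\times\mathbb{T}^n).$$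
   Context: Fix $n\ge1$ and $\hbar\in(0,1]$. $\hbar\mathbb{Z}^n=\{\hbar\bar k:\bar k\in\mathbb{Z}^n\}\subset\mathbb{R}^n$, $|k|$ is the Euclidean norm, $\mathbb{T}^n=\mathbb{R}^n/\mathbb{Z}^n$ with normalized Haar measure, $k\cdot\theta=\sum_jk_j\theta_j$, $\mathbb{N}_0=\{0,1,2,\dots\}$. Semi-classical Fourier transform: $\widehat f(\theta)=\sum_{k\in\hbar\mathbb{Z}^n}e^{-2\pi\frac{i}{\hbar}k\cdot\theta}f(k)$. $\mathcal{S}(\hbar\mathbb{Z}^n)$ is the space of $\varphi:\hbar\mathbb{Z}^n\to\mathbb{C}$ with $\sup_k(1+|k|)^N|\varphi(k)|<\infty$ for all $N$; operators are considered on $\mathcal{S}(\hbar\mathbb{Z}^n)$. Difference operators: with $v_j$ the $j$-th standard unit vector, $\Delta_{\hbar,j}g(k)=\frac{g(k+\hbar v_j)-g(k)}{\hbar}$ and $\Delta_\hbar^\alpha=\Delta_{\hbar,1}^{\alpha_1}\cdots\Delta_{\hbar,n}^{\alpha_n}$; $\Delta^\alpha_{\hbar,k}$, $\Delta^\alpha_{\hbar,l}$ indicate the variable acted on. Toroidal operators: $D_{\hbar,\theta}^{(\beta)}=\hbar^{|\beta|}\prod_{j=1}^n\prod_{\ell=0}^{\beta_j-1}\big(\frac{1}{2\pi i}\frac{\partial}{\partial\theta_j}-\ell\big)$. Symbol class: $\sigma_\hbar:\hbar\mathbb{Z}^n\times\mathbb{T}^n\to\mathbb{C}$ belongs to $S^\mu_{\rho,\delta}(\hbar\mathbb{Z}^n\times\mathbb{T}^n)$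 if $\sigma_\hbar(k,\cdot)\in C^\infty(\mathbb{T}^n)$ for all $k$ and for all $\alpha,\beta\in\mathbb{N}_0^n$ there is $C_{\alpha,\beta}>0$ with $|D^{(\beta)}_{\hbar,\theta}\Delta^\alpha_{\hbar,k}\sigma_\hbar(k,\theta)|\le C_{\alpha,\beta}(1+|k|)^{\mu-\rho|\alpha|+\delta|\beta|}$ for all $(k,\theta)$. Quantization: $\mathrm{Op}_\hbar(\sigma_\hbar)f(k)=\int_{\mathbb{T}^n}e^{2\pi\frac{i}{\hbar}k\cdot\theta}\sigma_\hbar(k,\theta)\widehat f(\theta)\,d\theta$. Amplitude class: $a_\hbar:\hbar\mathbb{Z}^n\times\hbar\mathbb{Z}^n\times\mathbb{T}^n\to\mathbb{C}$ belongs to $\mathcal{A}^{\mu_1,\mu_2}_{\rho,\delta}(\hbar\mathbb{Z}^n\times\hbar\mathbb{Z}^n\times\mathbb{T}^n)$ if $a_\hbar(k,m,\cdot)\in C^\infty(\mathbb{T}^n)$ for all $k,m$ and for all multi-indices $\alpha,\beta,\gamma\in\mathbb{N}_0^n$ there is $C_{\alpha,\beta,\gamma}>0$ such that for some $Q\in\mathbb{N}_0$ with $Q\le|\gamma|$, $$|D^{(\gamma)}_{\hbar,\theta}\Delta^\alpha_{\hbar,k}\Delta^\beta_{\hbar,m}a_\hbar(k,m,\theta)|\le C_{\alpha,\beta,\gamma}(1+|k|)^{\mu_1-\rho|\alpha|+\delta Q}(1+|m|)^{\mu_2-\rho|\beta|+\delta(|\gamma|-Q)}$$ for all $k,m\in\hbar\mathbb{Z}^n$,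 $\theta\in\mathbb{T}^n$. *)

theory Defs
  imports "HOL-Analysis.Analysis"
begin

text \<open>
  The dimension is the cardinality of the index type \<open>'n\<close>.  Functions on the lattice of mesh
  \<open>h\<close> are functions on all of \<open>real ^ 'n\<close> of which only the values at lattice points are
  ever used; functions on the torus are functions on \<open>real ^ 'n\<close> with period 1 in each
  coordinate.
\<close>

definition hlattice :: "real \<Rightarrow> (real ^ 'n) set" where
  "hlattice h = {h *\<^sub>R x |x. \<forall>j. x $ j \<in> \<int>}"

text \<open>The unit cube carries the normalized Haar measure of the torus.\<close>

abbreviation unit_cube :: "(real ^ 'n) set" where
  "unit_cube \<equiv> cbox 0 1"


subsection \<open>Multi-indices\<close>

type_synonym 'n mindex = "'n \<Rightarrow> nat"

definition mabs :: "'n::finite mindex \<Rightarrow> nat" where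
  "mabs \<alpha> = (\<Sum>j\<in>UNIV. \<alpha> j)"

definition mfact :: "'n::finite mindex \<Rightarrow> nat" where
  "mfact \<alpha> = (\<Prod>j\<in>UNIV. fact (\<alpha> j))"

text \<open>
  A fixed enumeration of the coordinates, used to write products of operators
  \<open>T\<^sub>1 \<cdots> T\<^sub>n\<close>, one for each coordinate.  Difference operators always commute and partial
  derivatives commute on smooth functions, so the choice of enumeration is immaterial.
\<close>

definition coords :: "'n::finite list" where
  "coords = (SOME js. distinct js \<and> set js = UNIV)"

lemma coords_enum: "distinct (coords :: 'n::finite list) \<and> set (coords :: 'n list) = UNIV"
proof -
  have "\<exists>js :: 'n list. distinct js \<and> set js = UNIV"
    using finite_distinct_list[of "UNIV :: 'n set"] by auto
  then show ?thesis
    unfolding coords_def by (rule someI_ex)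
qed

definition coord_prod :: "('n::finite \<Rightarrow> 'a \<Rightarrow> 'a) \<Rightarrow> 'a \<Rightarrow> 'a" where
  "coord_prod T = foldr T coords"


subsection \<open>Difference operators\<close>

definition fdiff :: "real \<Rightarrow> 'n::finite \<Rightarrow> (real ^ 'n \<Rightarrow> complex) \<Rightarrow> real ^ 'n \<Rightarrow> complex" where
  "fdiff h j g k = (g (k + h *\<^sub>R axis j 1) - g k) / of_real h"

definition fdiffs ::
  "real \<Rightarrow> 'n::finite mindex \<Rightarrow> (real ^ 'n \<Rightarrow> complex) \<Rightarrow> real ^ 'n \<Rightarrow> complex" where
  "fdiffs h \<alpha> = coord_prod (\<lambda>j. fdiff h j ^^ \<alpha> j)"


subsection \<open>Smooth functions and differential operators on the torus\<close>

definition partial_deriv :: "'n::finite \<Rightarrow> (real ^ 'n \<Rightarrow> complex) \<Rightarrow> real ^ 'n \<Rightarrow> complex" where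
  "partial_deriv j f \<theta> = vector_derivative (\<lambda>t. f (\<theta> + t *\<^sub>R axis j 1)) (at 0)"

primrec Ck :: "nat \<Rightarrow> (real ^ 'n::finite \<Rightarrow> complex) \<Rightarrow> bool" where
  "Ck 0 f \<longleftrightarrow> continuous_on UNIV f"
| "Ck (Suc m) f \<longleftrightarrow> continuous_on UNIV f \<and>
     (\<forall>j. (\<forall>\<theta>. (\<lambda>t. f (\<theta> + t *\<^sub>R axis j 1)) differentiable (at 0)) \<and> Ck m (partial_deriv j f))"

definition smooth_torus :: "(real ^ 'n::finite \<Rightarrow> complex) set" where
  "smooth_torus = {f. (\<forall>\<theta> j. f (\<theta> + axis j 1) = f \<theta>) \<and> (\<forall>m. Ck m f)}"

text \<open>\<open>falling_deriv j m\<close> is the product of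
  \<open>1/(2\<pi>i) \<partial>/\<partial>\<theta>\<^sub>j - l\<close> over \<open>l < m\<close>.\<close>

primrec falling_deriv ::
  "'n::finite \<Rightarrow> nat \<Rightarrow> (real ^ 'n \<Rightarrow> complex) \<Rightarrow> real ^ 'n \<Rightarrow> complex" where
  "falling_deriv j 0 f = f"
| "falling_deriv j (Suc m) f =
     (\<lambda>\<theta>. 1 / (2 * of_real pi * \<i>) * partial_deriv j (falling_deriv j m f) \<theta>
           - of_nat m * falling_deriv j m f \<theta>)"

definition torD ::
  "real \<Rightarrow> 'n::finite mindex \<Rightarrow> (real ^ 'n \<Rightarrow> complex) \<Rightarrow> real ^ 'n \<Rightarrow> complex" where
  "torD h \<beta> f \<theta> = of_real h ^ mabs \<beta> * coord_prod (\<lambda>j. falling_deriv j (\<beta> j)) f \<theta>"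


subsection \<open>Symbol and amplitude classes\<close>

definition symbol_class ::
  "real \<Rightarrow> real \<Rightarrow> real \<Rightarrow> real \<Rightarrow> (real ^ 'n::finite \<Rightarrow> real ^ 'n \<Rightarrow> complex) set" where
  "symbol_class h \<mu> \<rho> \<delta> = {\<sigma>.
     (\<forall>k\<in>hlattice h. \<sigma> k \<in> smooth_torus) \<and>
     (\<forall>\<alpha> \<beta>. \<exists>C>0. \<forall>k\<in>hlattice h. \<forall>\<theta>.
        norm (torD h \<beta> (\<lambda>\<omega>. fdiffs h \<alpha> (\<lambda>k'. \<sigma> k' \<omega>) k) \<theta>)
          \<le> C * (1 + norm k) powr (\<mu> - \<rho> * real (mabs \<alpha>) + \<delta> * real (mabs \<beta>)))}"

definition amplitude_class ::
  "real \<Rightarrow> real \<Rightarrow> real \<Rightarrow> real \<Rightarrow> real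
     \<Rightarrow> (real ^ 'n::finite \<Rightarrow> real ^ 'n \<Rightarrow> real ^ 'n \<Rightarrow> complex) set" where
  "amplitude_class h \<mu>\<^sub>1 \<mu>\<^sub>2 \<rho> \<delta> = {a.
     (\<forall>k\<in>hlattice h. \<forall>m\<in>hlattice h. a k m \<in> smooth_torus) \<and>
     (\<forall>\<alpha> \<beta> \<gamma>. \<exists>C>0. \<exists>Q\<le>mabs \<gamma>. \<forall>k\<in>hlattice h. \<forall>m\<in>hlattice h. \<forall>\<theta>.
        norm (torD h \<gamma> (\<lambda>\<omega>. fdiffs h \<alpha> (\<lambda>k'. fdiffs h \<beta> (\<lambda>m'. a k' m' \<omega>) m) k) \<theta>)
          \<le> C * (1 + norm k) powr (\<mu>\<^sub>1 - \<rho> * real (mabs \<alpha>) + \<delta> * real Q)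
              * (1 + norm m) powr (\<mu>\<^sub>2 - \<rho> * real (mabs \<beta>) + \<delta> * (real (mabs \<gamma>) - real Q)))}"


subsection \<open>Operators on rapidly decreasing functions\<close>

definition schwartz :: "real \<Rightarrow> (real ^ 'n::finite \<Rightarrow> complex) set" where
  "schwartz h =
     {\<phi>. \<forall>N::nat. bdd_above ((\<lambda>k. (1 + norm k) ^ N * norm (\<phi> k)) ` hlattice h)}"

definition sc_fourier :: "real \<Rightarrow> (real ^ 'n::finite \<Rightarrow> complex) \<Rightarrow> real ^ 'n \<Rightarrow> complex" where
  "sc_fourier h f \<theta> =
     (\<Sum>\<^sub>\<infinity>k\<in>hlattice h. exp (- 2 * of_real pi * (\<i> / of_real h) * of_real (k \<bullet> \<theta>)) * f k)"

definition Op ::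
  "real \<Rightarrow> (real ^ 'n::finite \<Rightarrow> real ^ 'n \<Rightarrow> complex)
     \<Rightarrow> (real ^ 'n \<Rightarrow> complex) \<Rightarrow> real ^ 'n \<Rightarrow> complex" where
  "Op h \<sigma> f k =
     (LINT \<theta>:unit_cube|lborel.
        exp (2 * of_real pi * (\<i> / of_real h) * of_real (k \<bullet> \<theta>)) * \<sigma> k \<theta> * sc_fourier h f \<theta>)"

definition amp_op ::
  "real \<Rightarrow> (real ^ 'n::finite \<Rightarrow> real ^ 'n \<Rightarrow> real ^ 'n \<Rightarrow> complex)
     \<Rightarrow> (real ^ 'n \<Rightarrow> complex) \<Rightarrow> real ^ 'n \<Rightarrow> complex" where
  "amp_op h a f k =
     (\<Sum>\<^sub>\<infinity>l\<in>hlattice h. LINT \<theta>:unit_cube|lborel.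
        exp (2 * of_real pi * (\<i> / of_real h) * of_real ((k - l) \<bullet> \<theta>)) * a k l \<theta> * f l)"

end

theory Submission
  imports Defs
begin

text \<open>
  Let \<open>G k l p\<close> be the Fourier coefficients of \<open>a k l\<close>, with the frequencies
  rescaled to lie in the lattice.  The symbol is the Fourier series in \<open>p\<close> of \<open>G k (k + p) p\<close>;
  expanding \<open>l \<mapsto> G k l p\<close> at \<open>l = k\<close> by the discrete Taylor formula gives the
  terms of the expansion, because \<open>torD\<close> acts on Fourier coefficients as multiplication
  by a falling factorial.  The remainder of order \<open>N\<close> is estimated coefficientwise: where
  \<open>p\<close> is small compared to \<open>k\<close> by the differences of order \<open>N\<close>, and elsewhere by the
  decay of \<open>G\<close> in \<open>p\<close>, which beats every power of \<open>|k|\<close> as \<open>\<delta> < 1\<close>.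
  Summing the coefficients costs a factor \<open>|k|\<close> to the power \<open>2n\<delta>\<close>, which is recovered by
  expanding to a higher order and estimating the additional terms as functions of \<open>\<theta>\<close>.
  Differences in \<open>k\<close> of the remainder are remainders of differenced amplitudes.
\<close>


subsection \<open>Multi-indices and difference operators\<close>

text \<open>The diagonal formula is forced by comparing kernels. Integrating \<open>a k l\<close>
  against the phase gives the amplitude operator the kernel \<open>G k l (l - k)\<close>, while
  \<open>Op h \<sigma>\<close> has as kernel the coefficient of \<open>\<sigma> k\<close> at
  \<open>l - k\<close>; with \<open>p = l - k\<close> the coefficient of \<sigma> at
  \<open>p\<close> must be \<open>G k (k + p) p\<close>. With frequencies in the lattice,
  \<open>p\<close> is at once a frequency and the increment in the Taylor formula. The classes bound
  functions of \<theta>. A coefficient is bounded by the supremum of its series, but the way back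
  requires summability over the lattice, hence 2n extra powers of \<open>|p|\<close>, and each power
  of \<open>|p|\<close> costs \<delta> powers of \<open>|k|\<close>. For the remainder of order N,
  tested with a \<open>torD\<close> of order \<open>|\<beta>|\<close>, the powers needed are N for
  the Taylor factor, \<open>|\<beta>|\<close> for the multiplier and 2n for the summation. The first
  two costs are exactly those in the claimed exponent, -N(\<rho> - \<delta>) + \<delta>|\<beta>|
  above the order of the operator; only the third is a loss, and it does not grow with N. This is
  why raising the order repairs it, since \<delta> < \<rho>.\<close>

definition inc :: "'n::finite \<Rightarrow> 'n mindex \<Rightarrow> 'n mindex" where
  "inc j \<alpha> = \<alpha>(j := Suc (\<alpha> j))"

lemma mabs_zero [simp]: "mabs (\<lambda>_. 0) = 0"
  by (simp add: mabs_def)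

lemma mabs_inc [simp]: "mabs (inc j \<alpha>) = Suc (mabs \<alpha>)"
  by (simp add: mabs_def inc_def sum.remove[of UNIV j])

lemma mabs_eq_0_iff: "mabs \<alpha> = 0 \<longleftrightarrow> \<alpha> = (\<lambda>_. 0)"
  by (auto simp: mabs_def)

lemma component_le_mabs: "\<alpha> j \<le> mabs \<alpha>"
  unfolding mabs_def by (rule member_le_sum) auto

lemma finite_mabs_le: "finite {\<alpha> :: 'n::finite mindex. mabs \<alpha> \<le> N}"
proof (rule finite_subset)
  show "{\<alpha> :: 'n mindex. mabs \<alpha> \<le> N} \<subseteq> Pi\<^sub>E UNIV (\<lambda>_. {..N})"
    using component_le_mabs order_trans by (fastforce simp: PiE_def extensional_def)
qed (auto intro: finite_PiE)

lemma finite_mabs_less: "finite {\<alpha> :: 'n::finite mindex. mabs \<alpha> < N}"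
  by (rule finite_subset[OF _ finite_mabs_le[of N]]) auto

lemma mindex_pos_inc: "\<alpha> j > 0 \<Longrightarrow> \<alpha> = inc j (\<alpha>(j := \<alpha> j - 1))"
  by (simp add: inc_def)

lemma mindex_neqE:
  assumes "\<alpha> \<noteq> (\<lambda>_. 0 :: nat)"
  obtains j where "\<alpha> j > 0"
  using assms by (auto simp: fun_eq_iff)

text \<open>Raising one coordinate at a time reaches every index. Together with
  \<open>fdiffs_inc\<close> this replaces reasoning about the enumeration \<open>coords\<close> by a
  single difference at the front.\<close>

lemma mindex_induct [case_names zero inc]:
  assumes "P (\<lambda>_. 0)" "\<And>j \<alpha>. P \<alpha> \<Longrightarrow> P (inc j \<alpha>)"
  shows "P \<alpha>"
proof (induction "mabs \<alpha>" arbitrary: \<alpha>)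
  case 0
  then have "\<alpha> = (\<lambda>_. 0)" by (simp add: mabs_eq_0_iff)
  then show ?case using assms(1) by simp
next
  case (Suc m)
  then have "\<alpha> \<noteq> (\<lambda>_. 0)" by auto
  then obtain j where "\<alpha> j > 0" by (rule mindex_neqE)
  then obtain \<beta> where \<beta>: "\<alpha> = inc j \<beta>" using mindex_pos_inc by blast
  then have "P \<beta>" using Suc by simp
  then show ?case unfolding \<beta> by (rule assms(2))
qed


section \<open>Commutation and linearity of difference operators\<close>

lemma fdiff_commute: "fdiff h i (fdiff h j g) = fdiff h j (fdiff h i g)"
  by (rule ext) (simp add: fdiff_def add_ac diff_divide_distrib)

lemma fdiff_funpow_commute: "fdiff h j ((fdiff h i ^^ m) g) = (fdiff h i ^^ m) (fdiff h j g)"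
  by (induction m) (simp_all, metis fdiff_commute)

lemma foldr_fdiff_commute:
  "fdiff h j (foldr (\<lambda>i. fdiff h i ^^ \<alpha> i) js g) = foldr (\<lambda>i. fdiff h i ^^ \<alpha> i) js (fdiff h j g)"
  by (induction js) (simp_all add: fdiff_funpow_commute)

lemma fdiffs_zero [simp]: "fdiffs h (\<lambda>_. 0) g = g"
proof -
  have "foldr (\<lambda>_. id) js g = g" for js :: "'a list" by (induction js) auto
  then show ?thesis by (simp add: fdiffs_def coord_prod_def id_def)
qed

text \<open>The enumeration meets \<open>j\<close> exactly once, and the extra
  \<open>fdiff h j\<close> that appears there moves to the front because differences
  commute.\<close>

lemma fdiffs_inc: "fdiffs h (inc j \<alpha>) g = fdiff h j (fdiffs h \<alpha> g)"
proof -
  have "foldr (\<lambda>i. fdiff h i ^^ inc j \<alpha> i) js g =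
      (if j \<in> set js then fdiff h j (foldr (\<lambda>i. fdiff h i ^^ \<alpha> i) js g)
       else foldr (\<lambda>i. fdiff h i ^^ \<alpha> i) js g)" if "distinct js" for js
    using that
  proof (induction js)
    case (Cons i js)
    then show ?case by (auto simp: inc_def fdiff_funpow_commute)
  qed simp
  from this[of coords] show ?thesis
    using coords_enum[where 'n = 'a] by (simp add: fdiffs_def coord_prod_def)
qed

lemma fdiffs_fdiff: "fdiffs h \<alpha> (fdiff h j g) = fdiffs h (inc j \<alpha>) g"
  unfolding fdiffs_inc by (simp add: fdiffs_def coord_prod_def foldr_fdiff_commute)

lemma fdiff_add: "fdiff h j (\<lambda>k. f k + g k) = (\<lambda>k. fdiff h j f k + fdiff h j g k)"
  by (rule ext) (simp add: fdiff_def add_divide_distrib diff_divide_distrib)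

lemma fdiff_diff: "fdiff h j (\<lambda>k. f k - g k) = (\<lambda>k. fdiff h j f k - fdiff h j g k)"
  by (rule ext) (simp add: fdiff_def add_divide_distrib diff_divide_distrib)

lemma fdiff_cmult: "fdiff h j (\<lambda>k. c * f k) = (\<lambda>k. c * fdiff h j f k)"
  by (rule ext) (simp add: fdiff_def right_diff_distrib)

lemma fdiff_multc: "fdiff h j (\<lambda>k. f k * c) = (\<lambda>k. fdiff h j f k * c)"
  by (rule ext) (simp add: fdiff_def left_diff_distrib)

lemma fdiff_sum: "fdiff h j (\<lambda>k. \<Sum>i\<in>I. f i k) = (\<lambda>k. \<Sum>i\<in>I. fdiff h j (f i) k)"
  by (rule ext) (simp add: fdiff_def sum_subtractf[symmetric] sum_divide_distrib)

lemma fdiffs_add: "fdiffs h \<alpha> (\<lambda>k. f k + g k) = (\<lambda>k. fdiffs h \<alpha> f k + fdiffs h \<alpha> g k)"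
  by (induction \<alpha> rule: mindex_induct) (simp_all add: fdiffs_inc fdiff_add)

lemma fdiffs_cmult: "fdiffs h \<alpha> (\<lambda>k. c * f k) = (\<lambda>k. c * fdiffs h \<alpha> f k)"
  by (induction \<alpha> rule: mindex_induct) (simp_all add: fdiffs_inc fdiff_cmult)

lemma fdiff_fdiffs_swap:
  "fdiff h j (\<lambda>k. fdiffs h \<beta> (G k) l) k = fdiffs h \<beta> (\<lambda>l. fdiff h j (\<lambda>k. G k l) k) l"
proof (induction \<beta> arbitrary: k l rule: mindex_induct)
  case (inc i \<beta>)
  have "fdiffs h (inc i \<beta>) (\<lambda>l. fdiff h j (\<lambda>k. G k l) k) l
      = fdiff h i (\<lambda>l. fdiff h j (\<lambda>k. fdiffs h \<beta> (G k) l) k) l"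
    by (simp add: fdiffs_inc inc.IH)
  also have "\<dots> = fdiff h j (\<lambda>k. fdiffs h (inc i \<beta>) (G k) l) k"
    by (simp add: fdiffs_inc fdiff_def diff_divide_distrib)
  finally show ?case by simp
qed simp

definition ddiffs :: "real \<Rightarrow> 'n::finite mindex \<Rightarrow> 'n mindex \<Rightarrow>
    (real ^ 'n \<Rightarrow> real ^ 'n \<Rightarrow> complex) \<Rightarrow> real ^ 'n \<Rightarrow> real ^ 'n \<Rightarrow> complex" where
  "ddiffs h \<alpha> \<beta> G k l = fdiffs h \<alpha> (\<lambda>k'. fdiffs h \<beta> (G k') l) k"

lemma ddiffs_fdiff_left:
  "ddiffs h \<alpha> \<beta> (\<lambda>k l. fdiff h j (\<lambda>k'. G k' l) k) = ddiffs h (inc j \<alpha>) \<beta> G"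
  by (intro ext) (simp add: ddiffs_def fdiffs_fdiff[symmetric] fdiff_fdiffs_swap[symmetric])

lemma ddiffs_fdiff_right: "ddiffs h \<alpha> \<beta> (\<lambda>k. fdiff h j (G k)) = ddiffs h \<alpha> (inc j \<beta>) G"
  by (intro ext) (simp add: ddiffs_def fdiffs_fdiff)

lemma ddiffs_zero_left: "ddiffs h (\<lambda>_. 0) \<beta> G k l = fdiffs h \<beta> (G k) l"
  by (simp add: ddiffs_def)

subsection \<open>The lattice\<close>

lemma hlattice_zero [simp]: "0 \<in> hlattice h"
  unfolding hlattice_def by (auto intro!: exI[of _ 0])

lemma hlatticeI: "(\<And>j. x $ j \<in> \<int>) \<Longrightarrow> h *\<^sub>R x \<in> hlattice h"
  unfolding hlattice_def by blast

lemma hlatticeE: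
  assumes "y \<in> hlattice h"
  obtains x where "y = h *\<^sub>R x" "\<And>j. x $ j \<in> \<int>"
  using assms unfolding hlattice_def by blast

lemma hlattice_add:
  assumes "x \<in> hlattice h" "y \<in> hlattice h"
  shows "x + y \<in> hlattice h"
proof (rule hlatticeE[OF assms(1)], rule hlatticeE[OF assms(2)])
  fix u v assume "x = h *\<^sub>R u" "\<And>j. u $ j \<in> \<int>" "y = h *\<^sub>R v" "\<And>j. v $ j \<in> \<int>"
  then show ?thesis using hlatticeI[of "u + v" h] by (simp add: scaleR_add_right)
qed

lemma hlattice_uminus:
  assumes "x \<in> hlattice h"
  shows "- x \<in> hlattice h"
proof (rule hlatticeE[OF assms])
  fix u assume "x = h *\<^sub>R u" "\<And>j. u $ j \<in> \<int>"
  then show ?thesis using hlatticeI[of "- u" h] by simp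
qed

lemma hlattice_diff: "x \<in> hlattice h \<Longrightarrow> y \<in> hlattice h \<Longrightarrow> x - y \<in> hlattice h"
  using hlattice_add[of x h "- y"] hlattice_uminus by auto

lemma hlattice_axis: "h *\<^sub>R axis j 1 \<in> hlattice h"
  by (rule hlatticeI) (simp add: axis_def)

lemma hlattice_add_axis: "x \<in> hlattice h \<Longrightarrow> x + h *\<^sub>R axis j 1 \<in> hlattice h"
  by (simp add: hlattice_add hlattice_axis)

lemma hlattice_iff: 
  assumes "h > 0"
  shows "x \<in> hlattice h \<longleftrightarrow> (\<forall>j. x $ j / h \<in> \<int>)"
proof
  assume *: "\<forall>j. x $ j / h \<in> \<int>"
  have eq: "h *\<^sub>R (\<chi> j. x $ j / h) = x" using assms by (simp add: vec_eq_iff)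
  have "h *\<^sub>R (\<chi> j. x $ j / h) \<in> hlattice h" using * by (intro hlatticeI) simp
  then show "x \<in> hlattice h" unfolding eq .
qed (use assms in \<open>auto simp: hlattice_def\<close>)

text \<open>The lattice is closed under the steps \<open>h *\<^sub>R axis j 1\<close>, so values off
  the lattice never enter. The classes speak of lattice points only, hence rewriting under a
  difference needs this form of congruence.\<close>

lemma fdiffs_cong:
  assumes "\<And>k. k \<in> hlattice h \<Longrightarrow> f k = g k" "k \<in> hlattice h"
  shows "fdiffs h \<alpha> f k = fdiffs h \<alpha> g k"
  using assms(2)
  by (induction \<alpha> arbitrary: k rule: mindex_induct)
     (simp_all add: assms(1) fdiffs_inc fdiff_def hlattice_add_axis)

section \<open>Coordinatewise domination and a mean value inequality on the lattice\<close>

definition norm1 :: "real ^ 'n::finite \<Rightarrow> real" where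
  "norm1 p = (\<Sum>j\<in>UNIV. \<bar>p $ j\<bar>)"

lemma norm1_nonneg [simp]: "0 \<le> norm1 p"
  by (simp add: norm1_def sum_nonneg)

text \<open>A box rather than a ball: a path that shortens one coordinate at a time never leaves it,
  and both \<open>norm1\<close> and \<open>norm\<close> are monotone on it.\<close>

definition vbox :: "real ^ 'n::finite \<Rightarrow> (real ^ 'n) set" where
  "vbox p = {q. \<forall>j. \<bar>q $ j\<bar> \<le> \<bar>p $ j\<bar>}"

lemma norm1_mono: "q \<in> vbox p \<Longrightarrow> norm1 q \<le> norm1 p"
  unfolding norm1_def vbox_def by (intro sum_mono) auto

lemma norm_mono_vbox: "q \<in> vbox p \<Longrightarrow> norm q \<le> norm p"
  unfolding norm_vec_def vbox_def by (intro L2_set_mono) auto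

lemma norm1_le: "norm1 (p :: real ^ 'n::finite) \<le> CARD('n) * norm p"
proof -
  have "norm1 p \<le> (\<Sum>j\<in>(UNIV::'n set). norm p)"
    unfolding norm1_def by (intro sum_mono component_le_norm_cart)
  then show ?thesis by simp
qed

text \<open>A nonzero coordinate of a lattice point has modulus at least \<open>h\<close>, so a step
  of length \<open>h\<close> towards zero does not overshoot.\<close>

lemma lattice_step_to_zero:
  assumes h: "h > 0" and p: "p \<in> hlattice h" "p $ j \<noteq> 0"
  defines "p' \<equiv> p - (sgn (p $ j) * h) *\<^sub>R axis j 1"
  shows "p' \<in> hlattice h" "p' \<in> vbox p" "norm1 p' = norm1 p - h"
proof -
  obtain m where m: "p $ j = h * of_int m"
  proof (rule hlatticeE[OF p(1)])
    fix u assume u: "p = h *\<^sub>R u" "\<And>j. u $ j \<in> \<int>"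
    then obtain m where "u $ j = of_int m" by (meson Ints_cases)
    with u show ?thesis by (intro that[of m]) simp
  qed
  with p(2) have "m \<noteq> 0" by auto
  then have "\<bar>m\<bar> \<ge> 1" by simp
  then have ge: "\<bar>p $ j\<bar> \<ge> h" using h by (simp add: m abs_mult mult_le_cancel_left1 del: zabs_less_one_iff)
  have comp: "p' $ i = (if i = j then p $ j - sgn (p $ j) * h else p $ i)" for i
    by (auto simp: p'_def axis_def)
  have abs: "\<bar>p' $ j\<bar> = \<bar>p $ j\<bar> - h"
    using ge p(2) unfolding comp by (auto simp: sgn_if abs_if)
  show "p' \<in> hlattice h"
  proof (cases "p $ j > 0")
    case True
    then have "p' = p - h *\<^sub>R axis j 1" by (simp add: p'_def)
    then show ?thesis using p(1) by (simp add: hlattice_diff hlattice_axis)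
  next
    case False
    with p(2) have "p' = p + h *\<^sub>R axis j 1" by (simp add: p'_def sgn_if)
    then show ?thesis using p(1) by (simp add: hlattice_add hlattice_axis)
  qed
  show "p' \<in> vbox p"
    unfolding vbox_def mem_Collect_eq
  proof
    fix i show "\<bar>p' $ i\<bar> \<le> \<bar>p $ i\<bar>"
      using abs h by (cases "i = j") (auto simp: comp)
  qed
  have "norm1 p' = \<bar>p' $ j\<bar> + (\<Sum>i\<in>UNIV - {j}. \<bar>p' $ i\<bar>)"
    by (simp add: norm1_def sum.remove[of UNIV j])
  also have "(\<Sum>i\<in>UNIV - {j}. \<bar>p' $ i\<bar>) = (\<Sum>i\<in>UNIV - {j}. \<bar>p $ i\<bar>)"
    by (rule sum.cong) (auto simp: comp)
  also have "\<bar>p' $ j\<bar> + \<dots> = norm1 p - h"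
    by (simp add: norm1_def sum.remove[of UNIV j] abs)
  finally show "norm1 p' = norm1 p - h" .
qed

lemma vbox_trans: "q \<in> vbox p \<Longrightarrow> r \<in> vbox q \<Longrightarrow> r \<in> vbox p"
  unfolding vbox_def by (auto intro: order_trans)

lemma vbox_refl [simp]: "p \<in> vbox p"
  by (simp add: vbox_def)

text \<open>Walk from \<open>p\<close> to the origin along a path that stays in \<open>vbox p\<close>.\<close>

lemma lattice_mean_value:
  assumes h: "h > 0" and g0: "g 0 = 0" and p: "p \<in> hlattice h"
    and B: "\<And>j q. q \<in> hlattice h \<Longrightarrow> q \<in> vbox p \<Longrightarrow> norm (fdiff h j g q) \<le> B"
  shows "norm (g p) \<le> norm1 p * B"
  using p B
proof (induction "nat \<lceil>norm1 p / h\<rceil>" arbitrary: p rule: less_induct)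
  case less
  show ?case
  proof (cases "\<forall>j. p $ j = 0")
    case True
    then have "p = 0" by (simp add: vec_eq_iff)
    then show ?thesis by (simp add: g0 norm1_def)
  next
    case False
    then obtain j where j: "p $ j \<noteq> 0" by auto
    define p' where "p' = p - (sgn (p $ j) * h) *\<^sub>R axis j 1"
    note p' = lattice_step_to_zero[OF h less.prems(1) j, folded p'_def]
    have "norm1 p' / h = norm1 p / h - 1" using p'(3) h by (simp add: field_simps)
    moreover have "0 \<le> norm1 p' / h" using h by simp
    ultimately have "nat \<lceil>norm1 p' / h\<rceil> < nat \<lceil>norm1 p / h\<rceil>" by linarith
    then have IH: "norm (g p') \<le> norm1 p' * B"
      using less.hyps[of p'] p' less.prems(2) vbox_trans by blast
    \<comment> \<open>\<open>fdiff\<close> looks forward, so the step is a difference based at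
      \<open>p'\<close> if the coordinate is positive and at \<open>p\<close> if it is negative;
      both points lie in the box.\<close>
    have "norm (g p - g p') \<le> h * B"
    proof (cases "p $ j > 0")
      case True
      then have "g p - g p' = of_real h * fdiff h j g p'" using h by (simp add: p'_def fdiff_def)
      then show ?thesis using less.prems(2)[OF p'(1,2), of j] h by (simp add: norm_mult)
    next
      case False
      with j have "g p - g p' = - of_real h * fdiff h j g p" using h by (simp add: p'_def fdiff_def)
      then show ?thesis using less.prems(2)[OF less.prems(1) vbox_refl, of j] h by (simp add: norm_mult)
    qed
    moreover have "norm (g p) \<le> norm (g p - g p') + norm (g p')" by (metis diff_add_cancel norm_triangle_ineq)
    ultimately show ?thesis using IH by (simp add: p'(3) algebra_simps)
  qed
qed

subsection \<open>Falling factorials of mesh size \<open>h\<close> and the discrete Taylor formula\<close>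

text \<open>\<open>ff h m x\<close> is \<open>h ^ m\<close> times the ordinary falling factorial of
  \<open>x / h\<close>; it is the factor by which \<open>torD\<close> multiplies Fourier
  coefficients once frequencies are rescaled.\<close>

definition ff :: "real \<Rightarrow> nat \<Rightarrow> real \<Rightarrow> real" where
  "ff h m x = (\<Prod>i<m. (x - h * real i))"

definition pff :: "real \<Rightarrow> 'n::finite mindex \<Rightarrow> real ^ 'n \<Rightarrow> real" where
  "pff h \<alpha> p = (\<Prod>j\<in>UNIV. ff h (\<alpha> j) (p $ j))"

lemma ff_0 [simp]: "ff h 0 x = 1" and ff_Suc: "ff h (Suc m) x = ff h m x * (x - h * real m)"
  by (simp_all add: ff_def)

lemma ff_Suc_shift: "ff h (Suc m) (x + h) = (x + h) * ff h m x"
  unfolding ff_def by (subst prod.lessThan_Suc_shift) (simp add: algebra_simps)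

lemma prod_inc: "(\<Prod>i\<in>UNIV. F i (inc j \<alpha> i)) = F j (Suc (\<alpha> j)) * (\<Prod>i\<in>UNIV-{j}. F i (\<alpha> i))"
  for F :: "'n::finite \<Rightarrow> nat \<Rightarrow> 'a::comm_monoid_mult"
proof -
  have "(\<Prod>i\<in>UNIV-{j}. F i (inc j \<alpha> i)) = (\<Prod>i\<in>UNIV-{j}. F i (\<alpha> i))"
    by (rule prod.cong) (auto simp: inc_def)
  then show ?thesis
    by (simp add: prod.remove[of UNIV j]) (simp add: inc_def)
qed

lemma pff_zero [simp]: "pff h (\<lambda>_. 0) p = 1"
  by (simp add: pff_def)

lemma pff_inc: "pff h (inc j \<alpha>) p = pff h \<alpha> p * (p $ j - h * real (\<alpha> j))"
  unfolding pff_def prod_inc[where F = "\<lambda>i m. ff h m (p $ i)"]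
  by (simp add: prod.remove[of UNIV j] ff_Suc)

lemma mfact_inc: "mfact (inc j \<alpha>) = Suc (\<alpha> j) * mfact \<alpha>"
  unfolding mfact_def prod_inc[where F = "\<lambda>i m. fact m"]
  by (simp add: prod.remove[of UNIV j] algebra_simps)

lemma mfact_zero [simp]: "mfact (\<lambda>_. 0) = 1"
  by (simp add: mfact_def)

lemma mfact_pos [simp]: "mfact \<alpha> > 0"
  by (simp add: mfact_def)

lemma pff_at_zero: "pff h \<alpha> 0 = (if \<alpha> = (\<lambda>_. 0) then 1 else 0)"
proof (cases "\<alpha> = (\<lambda>_. 0)")
  case False
  then obtain j where "\<alpha> j > 0" by (rule mindex_neqE)
  then have "ff h (\<alpha> j) 0 = 0" by (auto simp: ff_def)
  then have "pff h \<alpha> 0 = 0" unfolding pff_def by (intro prod_zero) auto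
  with False show ?thesis by simp
qed simp

text \<open>Discrete counterpart of differentiating a monomial divided by its factorial: the values
  of \<open>ff h (Suc m)\<close> at \<open>x + h\<close> and at \<open>x\<close> share the factor
  \<open>ff h m x\<close>, and the remaining factors differ by \<open>h * (m + 1)\<close>.\<close>

lemma fdiff_pff_inc:
  assumes h: "h > 0"
  shows "fdiff h j (\<lambda>q. complex_of_real (pff h (inc j \<alpha>) q / mfact (inc j \<alpha>))) q
       = of_real (pff h \<alpha> q / mfact \<alpha>)"
proof -
  define P where "P = (\<Prod>i\<in>UNIV-{j}. ff h (\<alpha> i) (q $ i))"
  have 1: "pff h (inc j \<alpha>) q = ff h (Suc (\<alpha> j)) (q $ j) * P" "pff h \<alpha> q = ff h (\<alpha> j) (q $ j) * P"
    unfolding pff_def prod_inc[where F = "\<lambda>i m. ff h m (q $ i)"]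
    by (simp_all add: prod.remove[of UNIV j] P_def)
  have "(\<Prod>i\<in>UNIV-{j}. ff h (\<alpha> i) ((q + h *\<^sub>R axis j 1) $ i)) = P"
    unfolding P_def by (rule prod.cong) (auto simp: axis_def)
  then have 2: "pff h (inc j \<alpha>) (q + h *\<^sub>R axis j 1) = ff h (Suc (\<alpha> j)) (q $ j + h) * P"
    unfolding pff_def prod_inc[where F = "\<lambda>i m. ff h m ((q + h *\<^sub>R axis j 1) $ i)"]
    by simp
  have "pff h (inc j \<alpha>) (q + h *\<^sub>R axis j 1) - pff h (inc j \<alpha>) q = h * real (Suc (\<alpha> j)) * pff h \<alpha> q"
    unfolding 1 2 ff_Suc_shift unfolding ff_Suc by (simp add: algebra_simps)
  then have "(pff h (inc j \<alpha>) (q + h *\<^sub>R axis j 1) / mfact (inc j \<alpha>) - pff h (inc j \<alpha>) q / mfact (inc j \<alpha>)) / h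
      = pff h \<alpha> q / mfact \<alpha>"
    using h unfolding mfact_inc of_nat_mult diff_divide_distrib[symmetric]
    by (simp del: of_nat_Suc)
  then show ?thesis
    unfolding fdiff_def by (metis of_real_diff of_real_divide)
qed

lemma fdiff_pff_other:
  assumes "\<alpha> j = 0"
  shows "fdiff h j (\<lambda>q. complex_of_real (pff h \<alpha> q / c)) q = 0"
proof -
  have "pff h \<alpha> (q + h *\<^sub>R axis j 1) = pff h \<alpha> q"
    unfolding pff_def by (rule prod.cong) (auto simp: axis_def assms)
  then show ?thesis by (simp add: fdiff_def)
qed

definition taylor_rem :: "real \<Rightarrow> nat \<Rightarrow> (real ^ 'n::finite \<Rightarrow> complex) \<Rightarrow> real ^ 'n \<Rightarrow> real ^ 'n \<Rightarrow> complex" where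
  "taylor_rem h N f k q =
     f (k + q) - (\<Sum>\<alpha> | mabs \<alpha> < N. of_real (pff h \<alpha> q / mfact \<alpha>) * fdiffs h \<alpha> f k)"

text \<open>Differencing in the increment kills the terms with \<open>\<alpha> j = 0\<close> and
  shifts the others down along \<open>inc j\<close>. This is what permits induction on the order of
  the remainder.\<close>

lemma fdiff_taylor_rem:
  assumes h: "h > 0"
  shows "fdiff h j (taylor_rem h (Suc N) f k) q = taylor_rem h N (fdiff h j f) k q"
proof -
  let ?c = "\<lambda>\<alpha> q. complex_of_real (pff h \<alpha> q / mfact \<alpha>)"
  have inj: "inj_on (inc j) A" for A :: "'a mindex set"
    by (rule inj_on_inverseI[where g = "\<lambda>\<alpha>. \<alpha>(j := \<alpha> j - 1)"]) (simp add: inc_def)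
  have "(\<Sum>\<alpha> | mabs \<alpha> < Suc N. fdiff h j (?c \<alpha>) q * fdiffs h \<alpha> f k)
     = (\<Sum>\<alpha>\<in>inc j ` {\<alpha>. mabs \<alpha> < N}. fdiff h j (?c \<alpha>) q * fdiffs h \<alpha> f k)"
  proof (rule sum.mono_neutral_right)
    show "\<forall>\<alpha>\<in>{\<alpha>. mabs \<alpha> < Suc N} - inc j ` {\<alpha>. mabs \<alpha> < N}. fdiff h j (?c \<alpha>) q * fdiffs h \<alpha> f k = 0"
    proof
      fix \<alpha> assume a: "\<alpha> \<in> {\<alpha>. mabs \<alpha> < Suc N} - inc j ` {\<alpha>. mabs \<alpha> < N}"
      have "\<alpha> j = 0"
      proof (rule ccontr)
        assume "\<alpha> j \<noteq> 0"
        then have *: "\<alpha> = inc j (\<alpha>(j := \<alpha> j - 1))" using mindex_pos_inc by blast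
        then have "mabs (\<alpha>(j := \<alpha> j - 1)) < N" using a by (metis DiffE Suc_less_SucD mabs_inc mem_Collect_eq)
        with * a show False by blast
      qed
      then show "fdiff h j (?c \<alpha>) q * fdiffs h \<alpha> f k = 0" by (simp only: fdiff_pff_other mult_zero_left)
    qed
  qed (auto simp: finite_mabs_less)
  also have "\<dots> = (\<Sum>\<alpha> | mabs \<alpha> < N. ?c \<alpha> q * fdiffs h \<alpha> (fdiff h j f) k)"
    by (subst sum.reindex[OF inj]) (simp only: o_def fdiff_pff_inc[OF h] fdiffs_fdiff)
  finally have 1: "(\<Sum>\<alpha> | mabs \<alpha> < Suc N. fdiff h j (?c \<alpha>) q * fdiffs h \<alpha> f k) = \<dots>" .
  have "fdiff h j (taylor_rem h (Suc N) f k) q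
     = fdiff h j (\<lambda>q. f (k + q)) q - (\<Sum>\<alpha> | mabs \<alpha> < Suc N. fdiff h j (?c \<alpha>) q * fdiffs h \<alpha> f k)"
    unfolding taylor_rem_def fdiff_diff fdiff_sum fdiff_multc ..
  also have "fdiff h j (\<lambda>q. f (k + q)) q = fdiff h j f (k + q)"
    by (simp add: fdiff_def add.assoc)
  finally show ?thesis unfolding 1 taylor_rem_def .
qed

lemma taylor_rem_at_zero: "taylor_rem h (Suc N) f k 0 = 0"
proof -
  have "(\<Sum>\<alpha> | mabs \<alpha> < Suc N. of_real (pff h \<alpha> 0 / mfact \<alpha>) * fdiffs h \<alpha> f k)
     = (\<Sum>\<alpha>\<in>{\<lambda>_. 0}. complex_of_real (pff h \<alpha> 0 / mfact \<alpha>) * fdiffs h \<alpha> f k)"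
    by (rule sum.mono_neutral_right) (auto simp: finite_mabs_less pff_at_zero)
  then show ?thesis by (simp add: taylor_rem_def)
qed

text \<open>A remainder of positive order vanishes at increment zero, so the mean value inequality
  applies and lowers the order by one; \<open>N\<close> rounds give the power of
  \<open>norm1 p\<close>. Only points of \<open>vbox p\<close> are visited, so increments of any
  sign are covered.\<close>

lemma taylor_rem_bound:
  assumes h: "h > 0" and p: "p \<in> hlattice h"
    and B: "\<And>\<alpha> q. mabs \<alpha> = N \<Longrightarrow> q \<in> hlattice h \<Longrightarrow> q \<in> vbox p \<Longrightarrow> norm (fdiffs h \<alpha> f (k + q)) \<le> B"
  shows "norm (taylor_rem h N f k p) \<le> norm1 p ^ N * B"
  using p B
proof (induction N arbitrary: f p)
  case 0
  show ?case using "0.prems"(2)[of "\<lambda>_. 0" p] "0.prems"(1) by (simp add: taylor_rem_def)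
next
  case (Suc N)
  have "norm (taylor_rem h (Suc N) f k p) \<le> norm1 p * (norm1 p ^ N * B)"
  proof (rule lattice_mean_value[where g = "taylor_rem h (Suc N) f k", OF h taylor_rem_at_zero Suc.prems(1)])
    fix j q assume q: "q \<in> hlattice h" "q \<in> vbox p"
    \<comment> \<open>Nonnegativity of \<open>B\<close> is read off from one admissible index,
      concentrated at \<open>j\<close>.\<close>
    have B0: "0 \<le> B"
    proof -
      have "norm (fdiffs h (inc j (\<lambda>i. if i = j then N else 0)) f (k + q)) \<le> B"
        by (rule Suc.prems(2)[OF _ q], unfold mabs_inc) (simp add: mabs_def)
      then show ?thesis by (rule order_trans[OF norm_ge_zero])
    qed
    have "norm (taylor_rem h N (fdiff h j f) k q) \<le> norm1 q ^ N * B"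
    proof (rule Suc.IH[OF q(1)])
      fix \<alpha> :: "'a mindex" and r assume "mabs \<alpha> = N" "r \<in> hlattice h" "r \<in> vbox q"
      then show "norm (fdiffs h \<alpha> (fdiff h j f) (k + r)) \<le> B"
        unfolding fdiffs_fdiff by (intro Suc.prems(2)) (auto intro: vbox_trans q)
    qed
    also have "\<dots> \<le> norm1 p ^ N * B"
      using norm1_mono[OF q(2)] B0 by (intro mult_right_mono power_mono) auto
    finally show "norm (fdiff h j (taylor_rem h (Suc N) f k) q) \<le> norm1 p ^ N * B"
      by (simp add: fdiff_taylor_rem[OF h])
  qed
  then show ?case by (simp add: mult.assoc)
qed


subsection \<open>Integrals of periodic functions over the unit cube\<close>

lemma cube_integral_split:
  fixes f :: "real ^ 'n::finite \<Rightarrow> complex"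
  assumes f: "continuous_on UNIV f" and s: "0 \<le> s" "s \<le> 1"
  shows "integral unit_cube f = integral (cbox 0 (\<chi> i. if i = j then s else 1)) f
       + integral (cbox (\<chi> i. if i = j then s else 0) 1) f"
proof -
  have c: "f integrable_on cbox a b" for a b
    by (rule integrable_continuous) (rule continuous_on_subset[OF f subset_UNIV])
  have 1: "unit_cube \<inter> {x. x \<bullet> axis j 1 \<le> s} = cbox 0 ((\<chi> i. if i = j then s else 1) :: real ^ 'n)"
    using s by (auto simp: mem_box_cart inner_axis split: if_splits) (smt (verit))+
  have 2: "unit_cube \<inter> {x. x \<bullet> axis j 1 \<ge> s} = cbox ((\<chi> i. if i = j then s else 0) :: real ^ 'n) 1"
    using s by (auto simp: mem_box_cart inner_axis split: if_splits) (smt (verit))+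
  show ?thesis
    by (rule integral_unique, rule has_integral_split[where k = "axis j 1" and c = s])
       (unfold 1 2, auto intro!: integrable_integral c simp: axis_in_Basis_iff)
qed

lemma cube_integral_shift:
  fixes f :: "real ^ 'n::finite \<Rightarrow> complex"
  assumes f: "continuous_on UNIV f" and per: "\<And>x. f (x + axis j 1) = f x"
    and t: "0 \<le> t" "t \<le> 1"
  shows "integral unit_cube (\<lambda>x. f (x + t *\<^sub>R axis j 1)) = integral unit_cube f"
proof -
  let ?e = "axis j 1 :: real ^ 'n"
  have sh: "integral (cbox a b) (\<lambda>x. f (x + c)) = integral (cbox (a + c) (b + c)) f" for a b c
    using integral_shift_cbox_plus[of a b f c] by (simp add: add.commute o_def)
  \<comment> \<open>The part of the translated cube beyond the face is moved back by one period.\<close>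
  have per': "f (x + t *\<^sub>R ?e) = f (x + (t - 1) *\<^sub>R ?e)" for x
    using per[of "x + (t - 1) *\<^sub>R ?e"] by (simp add: algebra_simps)
  have "integral unit_cube (\<lambda>x. f (x + t *\<^sub>R ?e))
     = integral (cbox 0 (\<chi> i. if i = j then 1 - t else 1)) (\<lambda>x. f (x + t *\<^sub>R ?e))
     + integral (cbox (\<chi> i. if i = j then 1 - t else 0) 1) (\<lambda>x. f (x + (t - 1) *\<^sub>R ?e))"
    unfolding per'[symmetric]
    by (rule cube_integral_split) (use t in \<open>auto intro!: continuous_on_compose2[OF f] continuous_intros\<close>)
  also have "\<dots> = integral (cbox (\<chi> i. if i = j then t else 0) 1) f
       + integral (cbox 0 (\<chi> i. if i = j then t else 1)) f"
    unfolding sh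
    by (intro arg_cong2[where f = "(+)"] arg_cong[where f = "\<lambda>S. integral S f"] arg_cong2[where f = cbox])
       (auto simp: vec_eq_iff axis_def)
  also have "\<dots> = integral unit_cube f"
    using cube_integral_split[OF f t, of j] by (simp only: add.commute)
  finally show ?thesis .
qed

text \<open>Translation along \<open>axis j 1\<close> leaves the integral constant, so
  differentiating under the integral sign gives zero. The derivative is taken within
  \<open>{0..1}\<close> because translation invariance is established for these
  \<open>t\<close>.\<close>

lemma cube_integral_partial:
  fixes f f' :: "real ^ 'n::finite \<Rightarrow> complex"
  assumes f: "continuous_on UNIV f" and f': "continuous_on UNIV f'"
    and per: "\<And>x. f (x + axis j 1) = f x"
    and deriv: "\<And>x. ((\<lambda>t. f (x + t *\<^sub>R axis j 1)) has_vector_derivative f' x) (at 0)"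
  shows "integral unit_cube f' = 0"
proof -
  let ?e = "axis j 1 :: real ^ 'n"
  have d: "((\<lambda>t. f (x + t *\<^sub>R ?e)) has_vector_derivative f' (x + s *\<^sub>R ?e)) (at s)" for x s
  proof -
    have "((\<lambda>t. f ((x + s *\<^sub>R ?e) + t *\<^sub>R ?e)) \<circ> (\<lambda>t. t - s) has_vector_derivative 1 *\<^sub>R f' (x + s *\<^sub>R ?e)) (at s)"
      by (rule vector_diff_chain_at) (use deriv[of "x + s *\<^sub>R ?e"] in \<open>auto intro!: derivative_eq_intros\<close>)
    then show ?thesis by (simp add: o_def algebra_simps)
  qed
  have "((\<lambda>t. integral unit_cube (\<lambda>x. f (x + t *\<^sub>R ?e))) has_vector_derivative
      integral unit_cube (\<lambda>x. f' (x + 0 *\<^sub>R ?e))) (at 0 within {0..1})"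
  proof (rule leibniz_rule_vector_derivative)
    show "continuous_on ({0..1} \<times> unit_cube) (\<lambda>(t, x). f' (x + t *\<^sub>R ?e))"
      unfolding split_beta by (intro continuous_on_compose2[OF f'] continuous_intros) auto
    show "(\<lambda>x. f (x + t *\<^sub>R ?e)) integrable_on unit_cube" for t
      by (intro integrable_continuous continuous_on_compose2[OF f] continuous_intros) auto
  qed (auto intro: has_vector_derivative_at_within d)
  then have "((\<lambda>t. integral unit_cube f) has_vector_derivative integral unit_cube f') (at 0 within {0..1})"
    unfolding scaleR_zero_left add_0_right
    by (rule has_vector_derivative_transform[rotated 2])
       (auto simp: cube_integral_shift[OF f per])
  moreover have "((\<lambda>t::real. integral unit_cube f) has_vector_derivative 0) (at 0 within {0..1})"
    by simp
  ultimately show ?thesis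
    by (rule vector_derivative_unique_within[rotated])
       (auto simp: trivial_limit_within islimpt_Icc)
qed

lemma LINT_cube:
  fixes f :: "real ^ 'n::finite \<Rightarrow> complex"
  assumes "continuous_on UNIV f"
  shows "(LINT x:unit_cube|lborel. f x) = integral unit_cube f"
  by (rule set_borel_integral_eq_integral(2))
     (auto simp: set_integrable_def intro!: borel_integrable_compact continuous_on_subset[OF assms])

lemma cube_integral_norm_le:
  fixes f :: "real ^ 'n::finite \<Rightarrow> complex"
  assumes "continuous_on UNIV f" "\<And>x. x \<in> unit_cube \<Longrightarrow> norm (f x) \<le> B"
  shows "norm (integral unit_cube f) \<le> B"
proof -
  have "0 \<le> B" by (rule order_trans[OF norm_ge_zero assms(2)[of 0]]) (simp add: mem_box_cart)
  then have "norm (integral unit_cube f) \<le> B * measure lborel (unit_cube :: (real ^ 'n) set)"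
    using assms by (intro integrable_bound integrable_continuous continuous_on_subset[OF assms(1)]) auto
  also have "measure lborel (unit_cube :: (real ^ 'n) set) = 1"
    by (subst content_cbox_cart) (auto simp: interval_ne_empty_cart)
  finally show ?thesis by simp
qed

subsection \<open>Characters and Fourier coefficients\<close>

definition chr :: "real \<Rightarrow> real ^ 'n::finite \<Rightarrow> real ^ 'n \<Rightarrow> complex" where
  "chr h p \<theta> = exp (2 * of_real pi * (\<i> / of_real h) * of_real (p \<bullet> \<theta>))"

lemma chr_cis: "chr h p \<theta> = cis (2 * pi / h * (p \<bullet> \<theta>))"
  by (simp add: chr_def cis_conv_exp mult_ac)

lemma norm_chr [simp]: "norm (chr h p \<theta>) = 1"
  by (simp add: chr_cis)

lemma chr_zero [simp]: "chr h 0 \<theta> = 1" "chr h p 0 = 1"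
  by (simp_all add: chr_cis)

lemma chr_add: "chr h (p + q) \<theta> = chr h p \<theta> * chr h q \<theta>"
  by (simp add: chr_cis inner_add_left cis_mult distrib_left)

lemma chr_add_right: "chr h p (\<theta> + \<omega>) = chr h p \<theta> * chr h p \<omega>"
  by (simp add: chr_cis inner_add_right cis_mult distrib_left)

lemma continuous_chr [continuous_intros]: "continuous_on A (chr h p)"
  unfolding chr_def by (intro continuous_intros)

lemma chr_periodic:
  assumes "h > 0" "p \<in> hlattice h"
  shows "chr h p (\<theta> + axis j 1) = chr h p \<theta>"
proof -
  obtain m where "p $ j / h = of_int m" using assms by (auto simp: hlattice_iff elim: Ints_cases)
  then have "chr h p (axis j 1) = cis (2 * pi * of_int m)"
    using assms by (simp add: chr_cis inner_axis field_simps)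
  also have "\<dots> = 1" by (simp add: cis_multiple_2pi)
  finally show ?thesis by (simp add: chr_add_right)
qed


definition freq :: "real \<Rightarrow> real ^ 'n::finite \<Rightarrow> 'n \<Rightarrow> complex" where
  "freq h p j = 2 * of_real pi * \<i> * of_real (p $ j / h)"

lemma chr_axis: "chr h p (t *\<^sub>R axis j 1) = exp (of_real t * freq h p j)"
  by (simp add: chr_def freq_def inner_axis mult_ac)

lemma chr_axis_has_derivative:
  "((\<lambda>t. chr h p (\<theta> + t *\<^sub>R axis j 1)) has_vector_derivative freq h p j * chr h p \<theta>) (at 0)"
proof -
  have "((\<lambda>t. exp (of_real t * freq h p j)) has_vector_derivative freq h p j) (at 0)"
    by (rule has_vector_derivative_real_field) (auto intro!: derivative_eq_intros)
  from has_vector_derivative_mult_right[OF this, of "chr h p \<theta>"]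
  show ?thesis by (simp add: chr_add_right chr_axis mult.commute)
qed

definition fc :: "real \<Rightarrow> (real ^ 'n::finite \<Rightarrow> complex) \<Rightarrow> real ^ 'n \<Rightarrow> complex" where
  "fc h g p = integral unit_cube (\<lambda>\<theta>. chr h (- p) \<theta> * g \<theta>)"

lemma continuous_chr_mult: "continuous_on UNIV g \<Longrightarrow> continuous_on UNIV (\<lambda>\<theta>. chr h p \<theta> * g \<theta>)"
  by (intro continuous_intros)

lemma cube_integrable: "continuous_on UNIV (g :: real ^ 'n::finite \<Rightarrow> complex) \<Longrightarrow> g integrable_on unit_cube"
  by (rule integrable_continuous) (erule continuous_on_subset, simp)

lemma fc_diff:
  assumes "continuous_on UNIV f" "continuous_on UNIV g"
  shows "fc h (\<lambda>\<theta>. f \<theta> - g \<theta>) p = fc h f p - fc h g p"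
  unfolding fc_def right_diff_distrib
  by (intro integral_diff cube_integrable continuous_chr_mult assms)

lemma fc_norm_le:
  assumes "continuous_on UNIV f" "\<And>\<theta>. \<theta> \<in> unit_cube \<Longrightarrow> norm (f \<theta>) \<le> B"
  shows "norm (fc h f p) \<le> B"
  unfolding fc_def
  by (rule cube_integral_norm_le[OF continuous_chr_mult[OF assms(1)]]) (simp add: norm_mult assms(2))

text \<open>Integration by parts: the derivative of the periodic product of \<open>f\<close> with
  the conjugate character integrates to zero.\<close>

lemma fc_partial:
  fixes f f' :: "real ^ 'n::finite \<Rightarrow> complex"
  assumes h: "h > 0" and p: "p \<in> hlattice h"
    and f: "continuous_on UNIV f" and f': "continuous_on UNIV f'"
    and per: "\<And>x. f (x + axis j 1) = f x"
    and deriv: "\<And>x. ((\<lambda>t. f (x + t *\<^sub>R axis j 1)) has_vector_derivative f' x) (at 0)"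
  shows "fc h f' p = freq h p j * fc h f p"
proof -
  have fr: "freq h (- p) j = - freq h p j" by (simp add: freq_def)
  let ?g' = "\<lambda>x. chr h (- p) x * f' x + freq h (- p) j * (chr h (- p) x * f x)"
  have "integral unit_cube ?g' = 0"
  proof (rule cube_integral_partial)
    show "continuous_on UNIV (\<lambda>x. chr h (- p) x * f x)" "continuous_on UNIV ?g'"
      by (intro continuous_intros f f')+
    show "chr h (- p) (x + axis j 1) * f (x + axis j 1) = chr h (- p) x * f x" for x
      using p by (simp add: chr_periodic[OF h hlattice_uminus] per)
    show "((\<lambda>t. chr h (- p) (x + t *\<^sub>R axis j 1) * f (x + t *\<^sub>R axis j 1)) has_vector_derivative ?g' x) (at 0)" for x
      using has_vector_derivative_mult[OF chr_axis_has_derivative[of h "- p" x j] deriv[of x]]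
      by (simp add: algebra_simps)
  qed
  also have "integral unit_cube ?g' = fc h f' p + freq h (- p) j * fc h f p"
    unfolding fc_def
    by (subst integral_add) (auto intro!: cube_integrable continuous_chr_mult continuous_intros f f')
  finally show ?thesis by (simp add: fr)
qed

text \<open>For nonzero \<open>p\<close> the character is, up to the nonzero factor
  \<open>freq h p j\<close>, its own derivative in some direction \<open>j\<close>, so its integral
  vanishes.\<close>

lemma cube_integral_chr:
  assumes h: "h > 0" and p: "p \<in> hlattice h"
  shows "integral unit_cube (chr h p) = (if p = 0 then 1 else 0)"
proof (cases "p = 0")
  case True
  have "integral (unit_cube :: (real ^ 'a) set) (\<lambda>_. 1 :: complex) = 1"
    by (simp add: content_cbox_cart interval_ne_empty_cart)
  moreover have "chr h p = (\<lambda>_. 1)" using True by auto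
  ultimately show ?thesis using True by simp
next
  case False
  then obtain j where j: "p $ j \<noteq> 0" by (auto simp: vec_eq_iff)
  have "integral unit_cube (\<lambda>x. freq h p j * chr h p x) = 0"
    by (rule cube_integral_partial[of "chr h p" _ j])
       (auto intro!: continuous_intros chr_periodic[OF h p] chr_axis_has_derivative)
  moreover have "freq h p j \<noteq> 0" using h j by (simp add: freq_def)
  ultimately show ?thesis using False by simp
qed

subsection \<open>Rapidly decreasing Fourier coefficients\<close>

text \<open>The exponent is twice the dimension so that the weight is dominated by the product over
  \<open>j\<close> of \<open>inverse (1 + (p $ j)\<^sup>2)\<close>, each factor being summable along
  its own axis.\<close>

definition wt :: "real ^ 'n::finite \<Rightarrow> real" where
  "wt p = inverse ((1 + norm p) ^ (2 * CARD('n)))"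

lemma wt_nonneg: "0 \<le> wt p"
  by (simp add: wt_def)

lemma summable_on_ints_inverse_square:
  fixes h :: real
  assumes h: "h > 0"
  shows "(\<lambda>m::int. inverse (1 + (h * of_int m)\<^sup>2)) summable_on UNIV"
proof -
  let ?u = "\<lambda>m::int. inverse (1 + (h * of_int m)\<^sup>2)"
  have "summable (\<lambda>n::nat. inverse (1 + (h * real n)\<^sup>2))"
  proof (rule summable_comparison_test')
    show "summable (\<lambda>n. inverse (h\<^sup>2) * inverse (real n ^ 2))"
      by (intro summable_mult inverse_power_summable) simp
    show "norm (inverse (1 + (h * real n)\<^sup>2)) \<le> inverse (h\<^sup>2) * inverse (real n ^ 2)" if "n \<ge> 1" for n
    proof -
      have "inverse (1 + (h * real n)\<^sup>2) \<le> inverse ((h * real n)\<^sup>2)"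
        using h that by (intro le_imp_inverse_le) auto
      then show ?thesis by (simp add: power_mult_distrib)
    qed
  qed
  then have 1: "(\<lambda>n::nat. inverse (1 + (h * real n)\<^sup>2)) summable_on UNIV"
    by (subst summable_on_UNIV_nonneg_real_iff) auto
  have "?u summable_on range int"
    by (subst summable_on_reindex) (auto simp: inj_on_def o_def 1)
  moreover have "?u summable_on range (\<lambda>n. - int n)"
    by (subst summable_on_reindex) (auto simp: inj_on_def o_def 1)
  ultimately have "?u summable_on (range int \<union> range (\<lambda>n. - int n))" by (rule summable_on_union)
  also have "range int \<union> range (\<lambda>n. - int n) = UNIV"
  proof -
    have "m \<in> range int \<union> range (\<lambda>n. - int n)" for m by (cases m rule: int_cases2) auto
    then show ?thesis by blast
  qed
  finally show ?thesis .
qed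

lemma wt_summable:
  assumes h: "h > 0"
  shows "wt summable_on (hlattice h :: (real ^ 'n::finite) set)"
proof (rule nonneg_bdd_above_summable_on)
  let ?u = "\<lambda>m::int. inverse (1 + (h * of_int m)\<^sup>2)"
  define S where "S = infsum ?u UNIV"
  define \<phi> where "\<phi> p = (\<lambda>j. \<lfloor>p $ j / h\<rfloor>)" for p :: "real ^ 'n"
  have \<phi>: "h * of_int (\<phi> p j) = p $ j" if "p \<in> hlattice h" for p j
    using that h by (auto simp: \<phi>_def hlattice_iff elim!: Ints_cases)
  have wt: "wt p \<le> (\<Prod>j\<in>UNIV. ?u (\<phi> p j))" if "p \<in> hlattice h" for p :: "real ^ 'n"
  proof -
    have "(\<Prod>j\<in>UNIV. 1 + (p $ j)\<^sup>2) \<le> (\<Prod>j\<in>(UNIV::'n set). (1 + norm p)\<^sup>2)"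
    proof (rule prod_mono, safe)
      fix j :: 'n
      have "(p $ j)\<^sup>2 \<le> (norm p)\<^sup>2"
        using component_le_norm_cart[of p j] by (metis abs_le_square_iff abs_norm_cancel)
      then show "1 + (p $ j)\<^sup>2 \<le> (1 + norm p)\<^sup>2" by (simp add: power2_sum add_increasing2)
    qed auto
    also have "\<dots> = (1 + norm p) ^ (2 * CARD('n))" by (simp add: power_mult)
    finally have "wt p \<le> inverse (\<Prod>j\<in>UNIV. 1 + (p $ j)\<^sup>2)"
      unfolding wt_def by (intro le_imp_inverse_le prod_pos) (auto intro: add_pos_nonneg)
    then show ?thesis by (simp add: \<phi>[OF that] prod_inversef[symmetric] o_def)
  qed
  show "bdd_above (sum wt ` {F :: (real ^ 'n) set. F \<subseteq> hlattice h \<and> finite F})"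
  proof (rule bdd_aboveI2, clarify)
    fix F :: "(real ^ 'n) set" assume F: "F \<subseteq> hlattice h" "finite F"
    \<comment> \<open>\<open>J\<close> collects every integer coordinate in use, so
      \<open>\<phi>\<close> embeds \<open>F\<close> into a finite grid, over which the sum of
      products factors.\<close>
    define J where "J = (\<Union>j. (\<lambda>p. \<phi> p j) ` F)"
    have finJ: "finite J" using F by (auto simp: J_def)
    have inj: "inj_on \<phi> F"
    proof (rule inj_onI)
      fix p q assume "p \<in> F" "q \<in> F" "\<phi> p = \<phi> q"
      then have "p $ j = q $ j" for j using \<phi>[of p j] \<phi>[of q j] F by (metis subsetD)
      then show "p = q" by (simp add: vec_eq_iff)
    qed
    have "sum wt F \<le> (\<Sum>p\<in>F. \<Prod>j\<in>UNIV. ?u (\<phi> p j))"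
      using F wt by (intro sum_mono) auto
    also have "\<dots> = (\<Sum>m\<in>\<phi> ` F. \<Prod>j\<in>UNIV. ?u (m j))"
      by (simp add: sum.reindex[OF inj])
    also have "\<dots> \<le> (\<Sum>m\<in>Pi\<^sub>E UNIV (\<lambda>_::'n. J). \<Prod>j\<in>UNIV. ?u (m j))"
      by (intro sum_mono2 finite_PiE finJ prod_nonneg) (auto simp: J_def)
    also have "\<dots> = (\<Prod>j\<in>(UNIV::'n set). \<Sum>m\<in>J. ?u m)"
      by (rule prod_sum_PiE[symmetric]) (auto simp: finJ)
    also have "\<dots> \<le> (\<Prod>j\<in>(UNIV::'n set). S)"
      unfolding S_def by (intro prod_mono conjI finite_sum_le_infsum summable_on_ints_inverse_square h finJ sum_nonneg) auto
    finally show "sum wt F \<le> S ^ CARD('n)" by simp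
  qed
qed (rule wt_nonneg)

text \<open>Qualitative decay, applied at fixed \<open>k\<close> and \<open>l\<close> with constants
  free to depend on them. It licenses termwise operations on series; the uniform estimates are kept
  in \<open>coeff_class\<close>.\<close>

definition rd :: "real \<Rightarrow> (real ^ 'n::finite \<Rightarrow> complex) \<Rightarrow> bool" where
  "rd h c \<longleftrightarrow> (\<forall>M::nat. \<exists>C. \<forall>p\<in>hlattice h. (1 + norm p) ^ M * norm (c p) \<le> C)"

lemma rd_bound:
  assumes "rd h c"
  shows "\<exists>C\<ge>0. \<forall>p\<in>hlattice h. (1 + norm p) ^ M * norm (c p) \<le> C"
proof -
  obtain C where "\<forall>p\<in>hlattice h. (1 + norm p) ^ M * norm (c p) \<le> C"
    using assms unfolding rd_def by blast
  then show ?thesis by (intro exI[of _ "max C 0"]) (auto simp: le_max_iff_disj)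
qed

lemma rd_summable:
  assumes h: "h > 0" and c: "rd h c"
  shows "(\<lambda>p. norm (c p)) summable_on hlattice h"
proof -
  obtain C where C: "C \<ge> 0" "\<And>p. p \<in> hlattice h \<Longrightarrow> (1 + norm p) ^ (2 * CARD('a)) * norm (c p) \<le> C"
    using rd_bound[OF c, of "2 * CARD('a)"] by blast
  have "norm (c p) \<le> C * wt p" if "p \<in> hlattice h" for p
  proof -
    have "0 < (1 + norm p) ^ (2 * CARD('a))" by (intro zero_less_power add_pos_nonneg) auto
    with C(2)[OF that] show ?thesis by (simp add: wt_def divide_inverse[symmetric] pos_le_divide_eq mult.commute)
  qed
  then show ?thesis
    by (intro Infinite_Sum.abs_summable_on_comparison_test'[OF summable_on_cmult_right[OF wt_summable[OF h]], of _ C])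
qed

lemma rd_zero [simp]: "rd h (\<lambda>_. 0)"
  by (auto simp: rd_def)

lemma rd_add:
  assumes "rd h c" "rd h d"
  shows "rd h (\<lambda>p. c p + d p)"
  unfolding rd_def
proof
  fix M
  obtain C where C: "C \<ge> 0" "\<And>p. p \<in> hlattice h \<Longrightarrow> (1 + norm p) ^ M * norm (c p) \<le> C" using rd_bound[OF assms(1), of M] by blast
  obtain D where D: "D \<ge> 0" "\<And>p. p \<in> hlattice h \<Longrightarrow> (1 + norm p) ^ M * norm (d p) \<le> D" using rd_bound[OF assms(2), of M] by blast
  have "(1 + norm p) ^ M * norm (c p + d p) \<le> C + D" if "p \<in> hlattice h" for p
  proof -
    have "(1 + norm p) ^ M * norm (c p + d p) \<le> (1 + norm p) ^ M * (norm (c p) + norm (d p))"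
      by (intro mult_left_mono norm_triangle_ineq) auto
    then show ?thesis using C(2)[OF that] D(2)[OF that] by (simp add: distrib_left)
  qed
  then show "\<exists>C. \<forall>p\<in>hlattice h. (1 + norm p) ^ M * norm (c p + d p) \<le> C" by blast
qed

lemma rd_mult_poly:
  assumes "rd h c" and \<phi>: "\<And>p. p \<in> hlattice h \<Longrightarrow> norm (\<phi> p) \<le> K * (1 + norm p) ^ s"
  shows "rd h (\<lambda>p. \<phi> p * c p)"
  unfolding rd_def
proof
  fix M
  obtain C where C: "C \<ge> 0" "\<And>p. p \<in> hlattice h \<Longrightarrow> (1 + norm p) ^ (M + s) * norm (c p) \<le> C"
    using rd_bound[OF assms(1), of "M + s"] by blast
  have "(1 + norm p) ^ M * norm (\<phi> p * c p) \<le> \<bar>K\<bar> * C" if "p \<in> hlattice h" for p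
  proof -
    have "norm (\<phi> p) \<le> \<bar>K\<bar> * (1 + norm p) ^ s"
      using \<phi>[OF that] by (rule order_trans) (intro mult_right_mono, auto)
    then have "(1 + norm p) ^ M * (norm (\<phi> p) * norm (c p)) \<le> (1 + norm p) ^ M * ((\<bar>K\<bar> * (1 + norm p) ^ s) * norm (c p))"
      by (intro mult_left_mono mult_right_mono) auto
    also have "\<dots> = \<bar>K\<bar> * ((1 + norm p) ^ (M + s) * norm (c p))" by (simp add: power_add)
    also have "\<dots> \<le> \<bar>K\<bar> * C" using C(2)[OF that] by (intro mult_left_mono) auto
    finally show ?thesis by (simp add: norm_mult)
  qed
  then show "\<exists>C. \<forall>p\<in>hlattice h. (1 + norm p) ^ M * norm (\<phi> p * c p) \<le> C" by blast
qed

lemma rd_cmult: "rd h c \<Longrightarrow> rd h (\<lambda>p. a * c p)"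
  by (rule rd_mult_poly[where s = 0 and K = "norm a"]) auto

lemma rd_diff: "rd h c \<Longrightarrow> rd h d \<Longrightarrow> rd h (\<lambda>p. c p - d p)"
  using rd_add[of h c "\<lambda>p. (-1) * d p"] rd_cmult[of h d "-1"] by simp

lemma rd_sum: "(\<And>i. i \<in> I \<Longrightarrow> rd h (c i)) \<Longrightarrow> rd h (\<lambda>p. \<Sum>i\<in>I. c i p)"
  by (induction I rule: infinite_finite_induct) (auto intro: rd_add)


subsection \<open>Fourier series with rapidly decreasing coefficients\<close>

definition fser :: "real \<Rightarrow> (real ^ 'n::finite \<Rightarrow> complex) \<Rightarrow> real ^ 'n \<Rightarrow> complex" where
  "fser h c \<theta> = (\<Sum>\<^sub>\<infinity>p\<in>hlattice h. c p * chr h p \<theta>)"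

lemma fser_summable:
  assumes "(\<lambda>p. norm (c p)) summable_on hlattice h"
  shows "(\<lambda>p. c p * chr h p \<theta>) summable_on hlattice h"
  by (rule abs_summable_summable) (simp add: norm_mult assms)

lemma fser_uniform_limit:
  assumes "(\<lambda>p. norm (c p)) summable_on hlattice h"
  shows "uniform_limit UNIV (\<lambda>X \<theta>. \<Sum>p\<in>X. c p * chr h p \<theta>) (fser h c) (finite_subsets_at_top (hlattice h))"
  unfolding fser_def
  by (rule Weierstrass_m_test_general[OF _ assms]) (simp add: norm_mult)

lemma fser_continuous:
  assumes "(\<lambda>p. norm (c p)) summable_on hlattice h"
  shows "continuous_on UNIV (fser h c)"
  by (rule uniform_limit_theorem[OF _ fser_uniform_limit[OF assms]])
     (auto intro!: always_eventually continuous_intros)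

lemma fser_norm_le:
  assumes "(\<lambda>p. norm (c p)) summable_on hlattice h"
  shows "norm (fser h c \<theta>) \<le> (\<Sum>\<^sub>\<infinity>p\<in>hlattice h. norm (c p))"
  unfolding fser_def
  using norm_infsum_bound[of "\<lambda>p. c p * chr h p \<theta>" "hlattice h"] by (simp add: norm_mult assms)

lemma fser_add:
  assumes "(\<lambda>p. norm (c p)) summable_on hlattice h" "(\<lambda>p. norm (d p)) summable_on hlattice h"
  shows "fser h (\<lambda>p. c p + d p) \<theta> = fser h c \<theta> + fser h d \<theta>"
  unfolding fser_def distrib_right by (intro infsum_add fser_summable assms)

lemma fser_cmult: "fser h (\<lambda>p. a * c p) \<theta> = a * fser h c \<theta>"
  unfolding fser_def mult.assoc by (rule infsum_cmult_right')

lemma fser_diff: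
  assumes "(\<lambda>p. norm (c p)) summable_on hlattice h" "(\<lambda>p. norm (d p)) summable_on hlattice h"
  shows "fser h (\<lambda>p. c p - d p) \<theta> = fser h c \<theta> - fser h d \<theta>"
  using fser_add[of c h "\<lambda>p. (-1) * d p" \<theta>] assms fser_cmult[of h "-1" d \<theta>] by simp

lemma fser_sum:
  assumes "\<And>i. i \<in> I \<Longrightarrow> rd h (c i)" "h > 0"
  shows "fser h (\<lambda>p. \<Sum>i\<in>I. c i p) \<theta> = (\<Sum>i\<in>I. fser h (c i) \<theta>)"
  using assms
proof (induction I rule: infinite_finite_induct)
  case (insert x F)
  then show ?case
    using fser_add[OF rd_summable[of h "c x"] rd_summable[of h "\<lambda>p. \<Sum>i\<in>F. c i p"]]
    by (simp add: rd_sum)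
qed (simp_all add: fser_def)

lemma fser_periodic:
  assumes "h > 0"
  shows "fser h c (\<theta> + axis j 1) = fser h c \<theta>"
  unfolding fser_def by (intro infsum_cong) (simp add: chr_periodic[OF assms])

text \<open>The partial sums over finite sets of frequencies converge uniformly on the compact cube,
  so the integral passes to the limit along this net.\<close>

lemma integral_mult_fser:
  fixes g :: "real ^ 'n::finite \<Rightarrow> complex"
  assumes c: "(\<lambda>p. norm (c p)) summable_on hlattice h" and g: "continuous_on UNIV g"
  shows "integral unit_cube (\<lambda>\<theta>. g \<theta> * fser h c \<theta>)
       = (\<Sum>\<^sub>\<infinity>p\<in>hlattice h. c p * integral unit_cube (\<lambda>\<theta>. g \<theta> * chr h p \<theta>))"
proof -
  let ?F = "finite_subsets_at_top (hlattice h :: (real ^ 'n) set)"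
  have bg: "bounded (g ` unit_cube)"
    by (intro compact_imp_bounded compact_continuous_image continuous_on_subset[OF g]) auto
  have bf: "bounded (fser h c ` unit_cube)"
    by (intro compact_imp_bounded compact_continuous_image continuous_on_subset[OF fser_continuous[OF c]]) auto
  have "uniform_limit unit_cube (\<lambda>X \<theta>. g \<theta> * (\<Sum>p\<in>X. c p * chr h p \<theta>)) (\<lambda>\<theta>. g \<theta> * fser h c \<theta>) ?F"
    by (rule uniform_lim_mult[OF uniform_limit_const uniform_limit_on_subset[OF fser_uniform_limit[OF c]] bg bf]) auto
  moreover have "continuous_on unit_cube (\<lambda>\<theta>. g \<theta> * (\<Sum>p\<in>X. c p * chr h p \<theta>))" for X
    by (intro continuous_intros continuous_on_subset[OF g]) auto
  ultimately obtain I J where IJ: "\<And>X. ((\<lambda>\<theta>. g \<theta> * (\<Sum>p\<in>X. c p * chr h p \<theta>)) has_integral I X) unit_cube"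
    "((\<lambda>\<theta>. g \<theta> * fser h c \<theta>) has_integral J) unit_cube" "(I \<longlongrightarrow> J) ?F"
    by (rule uniform_limit_integral_cbox) auto
  have I: "I X = (\<Sum>p\<in>X. c p * integral unit_cube (\<lambda>\<theta>. g \<theta> * chr h p \<theta>))" for X
  proof -
    have "(\<lambda>\<theta>. g \<theta> * (\<Sum>p\<in>X. c p * chr h p \<theta>)) = (\<lambda>\<theta>. \<Sum>p\<in>X. c p * (g \<theta> * chr h p \<theta>))"
      by (simp add: sum_distrib_left mult_ac)
    moreover have "integral unit_cube \<dots> = (\<Sum>p\<in>X. c p * integral unit_cube (\<lambda>\<theta>. g \<theta> * chr h p \<theta>))"
    proof (cases "finite X")
      case True
      then show ?thesis
        by (subst integral_sum) (auto intro!: cube_integrable continuous_intros g)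
    qed simp
    ultimately show ?thesis using integral_unique[OF IJ(1)[of X]] by simp
  qed
  have "((\<lambda>p. c p * integral unit_cube (\<lambda>\<theta>. g \<theta> * chr h p \<theta>)) has_sum J) (hlattice h)"
    unfolding has_sum_def using IJ(3) unfolding I .
  from infsumI[OF this] integral_unique[OF IJ(2)] show ?thesis by simp
qed

lemma fc_fser:
  assumes h: "h > 0" and c: "(\<lambda>p. norm (c p)) summable_on hlattice h" and p: "p \<in> hlattice h"
  shows "fc h (fser h c) p = c p"
proof -
  have 1: "integral unit_cube (\<lambda>\<theta>. chr h (- p) \<theta> * chr h q \<theta>) = (if q = p then 1 else 0)"
    if "q \<in> hlattice h" for q
  proof -
    have "(\<lambda>\<theta>. chr h (- p) \<theta> * chr h q \<theta>) = chr h (q - p)"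
      using chr_add[of h q "- p"] by (auto simp: fun_eq_iff)
    then show ?thesis using cube_integral_chr[OF h hlattice_diff[OF that p]] by simp
  qed
  have "fc h (fser h c) p = (\<Sum>\<^sub>\<infinity>q\<in>hlattice h. c q * integral unit_cube (\<lambda>\<theta>. chr h (- p) \<theta> * chr h q \<theta>))"
    unfolding fc_def by (intro integral_mult_fser c continuous_chr)
  also have "\<dots> = (\<Sum>\<^sub>\<infinity>q\<in>hlattice h. if q = p then c p else 0)"
    by (intro infsum_cong) (auto simp: 1)
  also have "\<dots> = (\<Sum>\<^sub>\<infinity>q\<in>{p}. c p)"
    by (intro infsum_cong_neutral) (use p in auto)
  finally show ?thesis by simp
qed

text \<open>A coefficient is an average of the series against a unimodular character. This is how
  bounds on functions of \<theta> become bounds on single coefficients.\<close>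

lemma coeff_norm_le:
  assumes "h > 0" "(\<lambda>p. norm (c p)) summable_on hlattice h" "p \<in> hlattice h" "\<And>\<theta>. norm (fser h c \<theta>) \<le> B"
  shows "norm (c p) \<le> B"
  using fc_norm_le[OF fser_continuous[OF assms(2)] assms(4), of h p] fc_fser[OF assms(1-3)] by simp

section \<open>Term-by-term differentiation of Fourier series\<close>

lemma exp_imaginary_taylor: "norm (exp (\<i> * of_real x) - 1 - \<i> * of_real x) \<le> x\<^sup>2"
  using Taylor_exp[of "\<i> * of_real x" 1]
  by (simp add: norm_mult diff_diff_eq power2_eq_square abs_mult_self_eq)

lemma freq_imaginary: "freq h p j = \<i> * of_real (2 * pi * p $ j / h)"
  by (simp add: freq_def)

lemma norm_freq_le: "h > 0 \<Longrightarrow> norm (freq h p j) \<le> (2 * pi / h) * (1 + norm p)"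
  unfolding freq_imaginary norm_mult norm_ii norm_of_real
  using component_le_norm_cart[of p j] by (simp add: abs_mult divide_right_mono)

lemma rd_freq:
  assumes "h > 0" "rd h c"
  shows "rd h (\<lambda>p. freq h p j * c p)"
  by (rule rd_mult_poly[where s = 1 and K = "2 * pi / h", OF assms(2)]) (use norm_freq_le[OF assms(1)] in auto)

text \<open>Each term misses its linearization by at most \<open>t\<^sup>2\<close> times the modulus
  of the coefficient with two factors \<open>freq\<close>. Rapid decay makes these moduli summable,
  so the difference quotient is off by at most \<open>\<bar>t\<bar> * K\<close>.\<close>

lemma fser_has_derivative:
  assumes h: "h > 0" and c: "rd h c"
  shows "((\<lambda>t. fser h c (\<theta> + t *\<^sub>R axis j 1)) has_vector_derivative
      fser h (\<lambda>p. freq h p j * c p) \<theta>) (at 0)"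
proof -
  let ?w = "\<lambda>p. 2 * pi * p $ j / h"
  define K where "K = (\<Sum>\<^sub>\<infinity>p\<in>hlattice h. norm (freq h p j * (freq h p j * c p)))"
  have sK: "(\<lambda>p. norm (freq h p j * (freq h p j * c p))) summable_on hlattice h"
    by (intro rd_summable rd_freq h c)
  have quad: "norm (fser h c (\<theta> + t *\<^sub>R axis j 1) - fser h c \<theta> - t *\<^sub>R fser h (\<lambda>p. freq h p j * c p) \<theta>) \<le> t\<^sup>2 * K" for t
  proof -
    have eq: "fser h c (\<theta> + t *\<^sub>R axis j 1) - fser h c \<theta> - t *\<^sub>R fser h (\<lambda>p. freq h p j * c p) \<theta>
      = fser h (\<lambda>p. (exp (of_real t * freq h p j) * c p - c p) - of_real t * (freq h p j * c p)) \<theta>"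
    proof -
      have r1: "rd h (\<lambda>p. exp (of_real t * freq h p j) * c p)"
        by (rule rd_mult_poly[where s = 0 and K = 1, OF c]) (simp add: freq_imaginary norm_exp_eq_Re)
      have "fser h c (\<theta> + t *\<^sub>R axis j 1) = fser h (\<lambda>p. exp (of_real t * freq h p j) * c p) \<theta>"
        unfolding fser_def chr_add_right chr_axis by (simp add: mult_ac)
      then show ?thesis
        by (subst fser_diff) (auto intro!: rd_summable[OF h] rd_diff r1 c rd_cmult rd_freq h
             simp: fser_diff[OF rd_summable[OF h r1] rd_summable[OF h c]] fser_cmult scaleR_conv_of_real simp del: norm_mult)
    qed
    let ?d = "\<lambda>p. (exp (of_real t * freq h p j) * c p - c p) - of_real t * (freq h p j * c p)"
    have le: "norm (?d p) \<le> t\<^sup>2 * norm (freq h p j * (freq h p j * c p))" for p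
    proof -
      have "?d p = (exp (\<i> * of_real (t * ?w p)) - 1 - \<i> * of_real (t * ?w p)) * c p"
        by (simp add: freq_imaginary algebra_simps)
      then have "norm (?d p) \<le> (t * ?w p)\<^sup>2 * norm (c p)"
        using exp_imaginary_taylor[of "t * ?w p"] by (simp add: norm_mult mult_right_mono)
      also have "\<dots> = t\<^sup>2 * (norm (freq h p j) * (norm (freq h p j) * norm (c p)))"
        unfolding freq_imaginary norm_mult norm_ii norm_of_real by (simp add: power_mult_distrib power2_eq_square)
      finally show ?thesis by (simp add: norm_mult)
    qed
    have sd: "(\<lambda>p. norm (?d p)) summable_on hlattice h"
      by (rule Infinite_Sum.abs_summable_on_comparison_test'[OF summable_on_cmult_right[OF sK] le])
    have "norm (fser h ?d \<theta>) \<le> (\<Sum>\<^sub>\<infinity>p\<in>hlattice h. norm (?d p))" by (rule fser_norm_le[OF sd])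
    also have "\<dots> \<le> (\<Sum>\<^sub>\<infinity>p\<in>hlattice h. t\<^sup>2 * norm (freq h p j * (freq h p j * c p)))"
      by (rule infsum_mono[OF sd summable_on_cmult_right[OF sK] le])
    finally show ?thesis unfolding eq K_def by (simp add: infsum_cmult_right')
  qed
  show ?thesis
    unfolding has_vector_derivative_def
  proof (rule has_derivativeI_sandwich[where e = 1 and H = "\<lambda>t. \<bar>t\<bar> * K"])
    show "((\<lambda>t. \<bar>t\<bar> * K) \<longlongrightarrow> 0) (at 0)" by (auto intro!: tendsto_eq_intros)
    fix t :: real assume t: "t \<noteq> 0"
    show "norm (fser h c (\<theta> + t *\<^sub>R axis j 1) - fser h c (\<theta> + 0 *\<^sub>R axis j 1) -
        (t - 0) *\<^sub>R fser h (\<lambda>p. freq h p j * c p) \<theta>) / norm (t - 0) \<le> \<bar>t\<bar> * K"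
      using quad[of t] t by (simp add: divide_le_eq power2_eq_square abs_mult_self_eq mult_ac)
  qed (auto intro: bounded_linear_scaleR_left)
qed

lemma partial_deriv_fser:
  assumes "h > 0" "rd h c"
  shows "partial_deriv j (fser h c) = fser h (\<lambda>p. freq h p j * c p)"
  unfolding partial_deriv_def by (intro ext vector_derivative_at fser_has_derivative assms)

lemma Ck_fser:
  assumes "h > 0" "rd h c"
  shows "Ck m (fser h c)"
  using assms(2)
proof (induction m arbitrary: c)
  case (Suc m)
  then show ?case
    using differentiableI_vector[OF fser_has_derivative[OF assms(1) Suc.prems]]
    by (auto simp: partial_deriv_fser assms(1) intro!: fser_continuous rd_summable rd_freq Suc.IH)
qed (simp add: fser_continuous rd_summable assms(1))

lemma fser_smooth:
  assumes "h > 0" "rd h c"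
  shows "fser h c \<in> smooth_torus"
  by (simp add: smooth_torus_def fser_periodic Ck_fser assms)

section \<open>Toroidal derivatives as multipliers of Fourier coefficients\<close>

lemma ff_bound:
  assumes "h > 0"
  shows "\<bar>ff h m x\<bar> \<le> (1 + h * real m) ^ m * (1 + \<bar>x\<bar>) ^ m"
proof (induction m)
  case (Suc m)
  have "\<bar>x - h * real m\<bar> \<le> \<bar>x\<bar> + h * real m"
    using assms by (intro order_trans[OF abs_triangle_ineq4]) auto
  also have "\<dots> \<le> (1 + h * real (Suc m)) * (1 + \<bar>x\<bar>)"
    using assms by (simp add: algebra_simps)
  finally have 1: "\<bar>x - h * real m\<bar> \<le> (1 + h * real (Suc m)) * (1 + \<bar>x\<bar>)" .
  have "(1 + h * real m) ^ m \<le> (1 + h * real (Suc m)) ^ m"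
    using assms by (intro power_mono) (auto simp: algebra_simps)
  then have "\<bar>ff h m x\<bar> \<le> (1 + h * real (Suc m)) ^ m * (1 + \<bar>x\<bar>) ^ m"
    using Suc by (elim order_trans) (auto intro: mult_right_mono)
  then have "\<bar>ff h m x\<bar> * \<bar>x - h * real m\<bar> \<le> ((1 + h * real (Suc m)) ^ m * (1 + \<bar>x\<bar>) ^ m) * ((1 + h * real (Suc m)) * (1 + \<bar>x\<bar>))"
    using 1 assms by (intro mult_mono) auto
  then show ?case by (simp add: ff_Suc abs_mult mult_ac)
qed simp

lemma pff_bound:
  assumes "h > 0"
  shows "\<exists>K>0. \<forall>p. \<bar>pff h \<alpha> p\<bar> \<le> K * (1 + norm p) ^ mabs \<alpha>"
proof (intro exI conjI allI)
  let ?K = "\<Prod>j\<in>UNIV. (1 + h * real (\<alpha> j)) ^ \<alpha> j"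
  show "?K > 0" using assms by (intro prod_pos) (auto intro!: zero_less_power add_pos_nonneg)
  fix p
  have "\<bar>pff h \<alpha> p\<bar> \<le> (\<Prod>j\<in>UNIV. (1 + h * real (\<alpha> j)) ^ \<alpha> j * (1 + norm p) ^ \<alpha> j)"
    unfolding pff_def abs_prod
  proof (rule prod_mono, safe)
    fix j
    have "\<bar>ff h (\<alpha> j) (p $ j)\<bar> \<le> (1 + h * real (\<alpha> j)) ^ \<alpha> j * (1 + \<bar>p $ j\<bar>) ^ \<alpha> j" by (rule ff_bound[OF assms])
    also have "\<dots> \<le> (1 + h * real (\<alpha> j)) ^ \<alpha> j * (1 + norm p) ^ \<alpha> j"
      using assms component_le_norm_cart[of p j] by (intro mult_left_mono power_mono) auto
    finally show "\<bar>ff h (\<alpha> j) (p $ j)\<bar> \<le> \<dots>" .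
  qed auto
  also have "\<dots> = ?K * (1 + norm p) ^ mabs \<alpha>"
    by (simp add: prod.distrib mabs_def power_sum)
  finally show "\<bar>pff h \<alpha> p\<bar> \<le> ?K * (1 + norm p) ^ mabs \<alpha>" .
qed

lemma rd_pff:
  assumes "h > 0" "rd h c"
  shows "rd h (\<lambda>p. of_real (pff h \<alpha> p) * c p)"
proof -
  obtain K where "\<forall>p. \<bar>pff h \<alpha> p\<bar> \<le> K * (1 + norm p) ^ mabs \<alpha>" using pff_bound[OF assms(1)] by blast
  then show ?thesis by (intro rd_mult_poly[where s = "mabs \<alpha>" and K = K, OF assms(2)]) auto
qed

lemma rd_ff:
  assumes "h > 0" "rd h c"
  shows "rd h (\<lambda>p. of_real (ff h m (p $ j)) * c p)"
proof -
  have "pff h (\<lambda>i. if i = j then m else 0) p = ff h m (p $ j)" for p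
    unfolding pff_def by (subst prod.remove[of UNIV j]) auto
  then show ?thesis using rd_pff[OF assms, of "\<lambda>i. if i = j then m else 0"] by simp
qed

text \<open>One factor multiplies the coefficient by \<open>p $ j / h - m\<close>, that is, by
  \<open>(p $ j - h * m) / h\<close>. The powers of \<open>h\<close> in the denominator are
  cancelled later by the prefactor in \<open>torD\<close>.\<close>

lemma falling_deriv_fser:
  assumes h: "h > 0" and c: "rd h c"
  shows "falling_deriv j m (fser h c) = fser h (\<lambda>p. of_real (ff h m (p $ j)) / of_real h ^ m * c p)"
proof (induction m)
  case (Suc m)
  let ?d = "\<lambda>p. of_real (ff h m (p $ j)) / of_real h ^ m * c p"
  have d: "rd h ?d"
    using rd_cmult[OF rd_ff[OF h c, of m j], of "1 / of_real h ^ m"] by simp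
  define d where "d = ?d"
  then have d': "rd h d" using d by simp
  have "falling_deriv j (Suc m) (fser h c) \<theta>
      = fser h (\<lambda>p. 1 / (2 * of_real pi * \<i>) * (freq h p j * d p) - of_nat m * d p) \<theta>" for \<theta>
  proof -
    have "fser h (\<lambda>p. 1 / (2 * of_real pi * \<i>) * (freq h p j * d p) - of_nat m * d p) \<theta>
       = 1 / (2 * of_real pi * \<i>) * fser h (\<lambda>p. freq h p j * d p) \<theta> - of_nat m * fser h d \<theta>"
      unfolding fser_cmult[symmetric]
      by (intro fser_diff rd_summable[OF h] rd_cmult d' rd_freq h)
    then show ?thesis
      unfolding falling_deriv.simps Suc.IH d_def[symmetric] partial_deriv_fser[OF h d'] by simp
  qed
  moreover have "1 / (2 * of_real pi * \<i>) * (freq h p j * ?d p) - of_nat m * ?d p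
      = of_real (ff h (Suc m) (p $ j)) / of_real h ^ Suc m * c p" for p
    using h by (simp add: freq_def ff_Suc field_simps)
  ultimately show ?case by (simp add: fun_eq_iff d_def)
qed simp

lemma torD_fser:
  assumes h: "h > 0" and c: "rd h c"
  shows "torD h \<beta> (fser h c) = fser h (\<lambda>p. of_real (pff h \<beta> p) * c p)"
proof -
  \<comment> \<open>Rapid decay is carried along in the induction because the next use of
    \<open>falling_deriv_fser\<close> requires it.\<close>
  have "foldr (\<lambda>j. falling_deriv j (\<beta> j)) js (fser h c)
      = fser h (\<lambda>p. (\<Prod>j\<in>set js. of_real (ff h (\<beta> j) (p $ j)) / of_real h ^ \<beta> j) * c p) \<and>
      rd h (\<lambda>p. (\<Prod>j\<in>set js. of_real (ff h (\<beta> j) (p $ j)) / of_real h ^ \<beta> j) * c p)"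
    if "distinct js" for js
    using that
  proof (induction js)
    case (Cons i js)
    let ?d = "\<lambda>p. (\<Prod>j\<in>set js. of_real (ff h (\<beta> j) (p $ j)) / of_real h ^ \<beta> j) * c p"
    have IH: "foldr (\<lambda>j. falling_deriv j (\<beta> j)) js (fser h c) = fser h ?d" "rd h ?d"
      using Cons by auto
    have "rd h (\<lambda>p. of_real (ff h (\<beta> i) (p $ i)) / of_real h ^ \<beta> i * ?d p)"
      using rd_cmult[OF rd_ff[OF h IH(2), of "\<beta> i" i], of "1 / of_real h ^ \<beta> i"] by simp
    then show ?case
      using Cons.prems by (simp add: IH(1) falling_deriv_fser[OF h IH(2)] mult.assoc)
  qed (use c in simp)
  from this[of coords] have 1: "coord_prod (\<lambda>j. falling_deriv j (\<beta> j)) (fser h c)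
      = fser h (\<lambda>p. (\<Prod>j\<in>UNIV. of_real (ff h (\<beta> j) (p $ j)) / of_real h ^ \<beta> j) * c p)"
    using coords_enum[where 'n = 'a] by (simp add: coord_prod_def)
  have 2: "of_real h ^ mabs \<beta> * ((\<Prod>j\<in>UNIV. complex_of_real (ff h (\<beta> j) (p $ j)) / of_real h ^ \<beta> j) * c p)
      = of_real (pff h \<beta> p) * c p" for p
    using h by (simp add: prod_dividef mabs_def power_sum pff_def)
  show ?thesis
    unfolding torD_def[abs_def] 1 by (simp add: fser_cmult[symmetric] 2)
qed


subsection \<open>Smooth functions on the torus\<close>

lemma smooth_torus_continuous: "g \<in> smooth_torus \<Longrightarrow> continuous_on UNIV g"
  unfolding smooth_torus_def by clarsimp (metis Ck.simps(1))

lemma smooth_torus_periodic: "g \<in> smooth_torus \<Longrightarrow> g (\<theta> + axis j 1) = g \<theta>"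
  by (simp add: smooth_torus_def)

lemma smooth_torus_has_derivative:
  assumes "g \<in> smooth_torus"
  shows "((\<lambda>t. g (\<theta> + t *\<^sub>R axis j 1)) has_vector_derivative partial_deriv j g \<theta>) (at 0)"
proof -
  have "Ck (Suc 0) g" using assms unfolding smooth_torus_def by blast
  then show ?thesis
    unfolding partial_deriv_def by (simp add: vector_derivative_works[symmetric])
qed

lemma smooth_torus_partial_deriv:
  assumes "g \<in> smooth_torus"
  shows "partial_deriv j g \<in> smooth_torus"
proof -
  have "Ck m (partial_deriv j g)" for m
  proof -
    have "Ck (Suc m) g" using assms unfolding smooth_torus_def by blast
    then show ?thesis by simp
  qed
  moreover have "partial_deriv j g (\<theta> + axis i 1) = partial_deriv j g \<theta>" for \<theta> i
  proof -
    have "g (\<theta> + axis i 1 + t *\<^sub>R axis j 1) = g (\<theta> + t *\<^sub>R axis j 1)" for t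
      using smooth_torus_periodic[OF assms, of "\<theta> + t *\<^sub>R axis j 1" i] by (simp add: add_ac)
    then show ?thesis unfolding partial_deriv_def by simp
  qed
  ultimately show ?thesis by (simp add: smooth_torus_def)
qed

section \<open>Decay of the Fourier coefficients of smooth functions\<close>

lemma fc_partial_deriv:
  assumes "h > 0" "p \<in> hlattice h" "g \<in> smooth_torus"
  shows "fc h (partial_deriv j g) p = freq h p j * fc h g p"
  by (intro fc_partial assms smooth_torus_continuous smooth_torus_partial_deriv
      smooth_torus_periodic smooth_torus_has_derivative)

text \<open>Every derivative in direction \<open>j\<close> multiplies the coefficient by a nonzero
  constant times \<open>p $ j\<close>, and the coefficients of a continuous function are
  bounded.\<close>

lemma fc_component_decay:
  assumes h: "h > 0" and g: "g \<in> smooth_torus"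
  shows "\<exists>C. \<forall>p\<in>hlattice h. \<bar>p $ j\<bar> ^ M * norm (fc h g p) \<le> C"
  using g
proof (induction M arbitrary: g)
  case 0
  have "bounded (g ` unit_cube)"
    by (intro compact_imp_bounded compact_continuous_image continuous_on_subset[OF smooth_torus_continuous[OF 0]]) auto
  then obtain B where "\<And>x. x \<in> unit_cube \<Longrightarrow> norm (g x) \<le> B" by (auto simp: bounded_iff)
  then have "norm (fc h g p) \<le> B" for p by (intro fc_norm_le smooth_torus_continuous 0)
  then show ?case by auto
next
  case (Suc M)
  from Suc.IH[OF smooth_torus_partial_deriv[OF Suc.prems]] obtain C where
    C: "\<And>p. p \<in> hlattice h \<Longrightarrow> \<bar>p $ j\<bar> ^ M * norm (fc h (partial_deriv j g) p) \<le> C" by blast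
  have "\<bar>p $ j\<bar> ^ Suc M * norm (fc h g p) \<le> C * (h / (2 * pi))" if p: "p \<in> hlattice h" for p
  proof -
    have "norm (freq h p j) = (2 * pi / h) * \<bar>p $ j\<bar>"
      unfolding freq_imaginary norm_mult norm_ii norm_of_real using h by (simp add: abs_mult)
    then have "\<bar>p $ j\<bar> ^ Suc M * norm (fc h g p) = (\<bar>p $ j\<bar> ^ M * norm (fc h (partial_deriv j g) p)) * (h / (2 * pi))"
      using h by (simp add: fc_partial_deriv[OF h p Suc.prems] norm_mult)
    also have "\<dots> \<le> C * (h / (2 * pi))" using C[OF p] h by (intro mult_right_mono) auto
    finally show ?thesis .
  qed
  then show ?case by blast
qed

lemma norm_le_card_component: "\<exists>j. norm p \<le> CARD('n) * \<bar>p $ j\<bar>" for p :: "real ^ 'n::finite"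
proof -
  obtain j where j: "\<And>i. \<bar>p $ i\<bar> \<le> \<bar>p $ j\<bar>"
  proof -
    let ?S = "range (\<lambda>i. \<bar>p $ i\<bar>)"
    have "Max ?S \<in> ?S" by (rule Max_in) auto
    then obtain j where j: "Max ?S = \<bar>p $ j\<bar>" by (rule rangeE)
    have "\<bar>p $ i\<bar> \<le> \<bar>p $ j\<bar>" for i unfolding j[symmetric] by (rule Max_ge) auto
    then show ?thesis by (rule that)
  qed
  have "norm p \<le> (\<Sum>i\<in>UNIV. \<bar>p $ i\<bar>)" by (rule norm_le_l1_cart)
  also have "\<dots> \<le> (\<Sum>i\<in>(UNIV::'n set). \<bar>p $ j\<bar>)" by (intro sum_mono j)
  finally show ?thesis by auto
qed

lemma one_plus_power_le: "(1 + x) ^ M \<le> 2 ^ M * (1 + x ^ M)" if "0 \<le> x" for x :: real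
proof -
  have "(1 + x) ^ M \<le> (2 * max 1 x) ^ M" using that by (intro power_mono) auto
  also have "\<dots> = 2 ^ M * max 1 x ^ M" by (simp add: power_mult_distrib)
  also have "max 1 x ^ M \<le> 1 + x ^ M" using that by (cases "x \<le> 1") auto
  finally show ?thesis by simp
qed

text \<open>The largest coordinate controls the norm, so decay in each coordinate separately is
  enough.\<close>

lemma rd_fc:
  assumes h: "h > 0" and g: "(g :: real ^ 'n::finite \<Rightarrow> complex) \<in> smooth_torus"
  shows "rd h (fc h g)"
  unfolding rd_def
proof
  fix M
  have "\<forall>j. \<exists>C. \<forall>p\<in>hlattice h. \<bar>p $ j\<bar> ^ M * norm (fc h g p) \<le> C" by (intro allI fc_component_decay[OF h g])
  from choice[OF this] obtain C where C: "\<And>j p. p \<in> hlattice h \<Longrightarrow> \<bar>p $ j\<bar> ^ M * norm (fc h g p) \<le> C j" by blast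
  obtain C0 where C0: "\<And>p. p \<in> hlattice h \<Longrightarrow> norm (fc h g p) \<le> C0"
    using fc_component_decay[OF h g, of _ 0] by auto
  let ?n = "real CARD('n)"
  have "(1 + norm p) ^ M * norm (fc h g p) \<le> (1 + ?n) ^ M * 2 ^ M * (C0 + (\<Sum>j\<in>UNIV. \<bar>C j\<bar>))"
    if p: "p \<in> hlattice h" for p
  proof -
    obtain j where j: "norm p \<le> ?n * \<bar>p $ j\<bar>" using norm_le_card_component by blast
    have "1 + norm p \<le> (1 + ?n) * (1 + \<bar>p $ j\<bar>)" using j by (simp add: algebra_simps add_increasing)
    then have "(1 + norm p) ^ M \<le> ((1 + ?n) * (1 + \<bar>p $ j\<bar>)) ^ M" by (intro power_mono) auto
    also have "\<dots> = (1 + ?n) ^ M * (1 + \<bar>p $ j\<bar>) ^ M" by (rule power_mult_distrib)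
    also have "\<dots> \<le> (1 + ?n) ^ M * (2 ^ M * (1 + \<bar>p $ j\<bar> ^ M))"
      by (intro mult_left_mono one_plus_power_le) auto
    finally have "(1 + norm p) ^ M * norm (fc h g p) \<le> (1 + ?n) ^ M * (2 ^ M * (1 + \<bar>p $ j\<bar> ^ M)) * norm (fc h g p)"
      by (intro mult_right_mono) auto
    also have "\<dots> = (1 + ?n) ^ M * 2 ^ M * (norm (fc h g p) + \<bar>p $ j\<bar> ^ M * norm (fc h g p))"
      by (simp add: algebra_simps)
    also have "\<dots> \<le> (1 + ?n) ^ M * 2 ^ M * (C0 + (\<Sum>j\<in>UNIV. \<bar>C j\<bar>))"
    proof (intro mult_left_mono add_mono C0 p)
      have "\<bar>p $ j\<bar> ^ M * norm (fc h g p) \<le> \<bar>C j\<bar>" using C[OF p, of j] by linarith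
      also have "\<dots> \<le> (\<Sum>j\<in>UNIV. \<bar>C j\<bar>)" by (rule member_le_sum) auto
      finally show "\<bar>p $ j\<bar> ^ M * norm (fc h g p) \<le> (\<Sum>j\<in>UNIV. \<bar>C j\<bar>)" .
    qed auto
    finally show ?thesis .
  qed
  then show "\<exists>C. \<forall>p\<in>hlattice h. (1 + norm p) ^ M * norm (fc h g p) \<le> C" by blast
qed

subsection \<open>Uniqueness of Fourier coefficients\<close>

text \<open>This is the mean value inequality at mesh 1 with bound 0, since all unit differences of
  a periodic function vanish.\<close>

lemma periodic_hlattice_1:
  assumes per: "\<And>\<theta> j. g (\<theta> + axis j 1) = g \<theta>" and m: "m \<in> hlattice 1"
  shows "g (\<theta> + m) = (g \<theta> :: complex)"
proof -
  have "norm (g (\<theta> + m) - g \<theta>) \<le> norm1 m * 0"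
  proof (rule lattice_mean_value[where g = "\<lambda>q. g (\<theta> + q) - g \<theta>" and h = 1, OF _ _ m])
    fix j q
    show "norm (fdiff 1 j (\<lambda>q. g (\<theta> + q) - g \<theta>) q) \<le> 0"
      by (simp add: fdiff_def add.assoc[symmetric] per)
  qed auto
  then show ?thesis by simp
qed

section \<open>Trigonometric polynomials and their density\<close>

inductive_set trigpoly :: "real \<Rightarrow> (real ^ 'n::finite \<Rightarrow> complex) set" for h where
  chr: "p \<in> hlattice h \<Longrightarrow> chr h p \<in> trigpoly h"
| add: "s \<in> trigpoly h \<Longrightarrow> t \<in> trigpoly h \<Longrightarrow> (\<lambda>\<theta>. s \<theta> + t \<theta>) \<in> trigpoly h"
| cmult: "s \<in> trigpoly h \<Longrightarrow> (\<lambda>\<theta>. c * s \<theta>) \<in> trigpoly h"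

lemma trigpoly_continuous: "t \<in> trigpoly h \<Longrightarrow> continuous_on UNIV t"
  by (induction rule: trigpoly.induct) (auto intro!: continuous_intros)

lemma trigpoly_mult:
  assumes "s \<in> trigpoly h" "t \<in> trigpoly h"
  shows "(\<lambda>\<theta>. s \<theta> * t \<theta>) \<in> trigpoly h"
  using assms(1)
proof (induction rule: trigpoly.induct)
  case (chr p)
  show ?case
    using assms(2)
  proof (induction rule: trigpoly.induct)
    case (chr q)
    then show ?case
      using trigpoly.chr[OF hlattice_add[OF \<open>p \<in> hlattice h\<close> chr]] by (simp add: chr_add[abs_def])
  next
    case (add s t)
    then show ?case using trigpoly.add[OF add.IH] by (simp add: distrib_left)
  next
    case (cmult s c)
    then show ?case using trigpoly.cmult[OF cmult.IH, of c] by (simp add: mult.left_commute)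
  qed
next
  case (add s t)
  then show ?case using trigpoly.add[OF add.IH] by (simp add: distrib_right)
next
  case (cmult s c)
  then show ?case using trigpoly.cmult[OF cmult.IH, of c] by (simp add: mult.assoc)
qed

lemma trigpoly_const: "(\<lambda>_. c) \<in> trigpoly h"
  using trigpoly.cmult[OF trigpoly.chr[OF hlattice_zero], of c h] by simp

lemma trigpoly_orthogonal:
  assumes g: "continuous_on UNIV g" and z: "\<And>p. p \<in> hlattice h \<Longrightarrow> fc h g p = 0"
    and t: "t \<in> trigpoly h"
  shows "integral unit_cube (\<lambda>\<theta>. g \<theta> * t \<theta>) = 0"
  using t
proof (induction rule: trigpoly.induct)
  case (chr p)
  then show ?case using z[OF hlattice_uminus[OF chr]] by (simp add: fc_def mult.commute)
next
  case (add s t)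
  then show ?case
    unfolding distrib_left
    by (subst integral_add)
       (auto intro!: cube_integrable continuous_intros g trigpoly_continuous[OF add.hyps(1)] trigpoly_continuous[OF add.hyps(2)])
next
  case (cmult s c)
  then show ?case by (simp add: mult.left_commute[of _ c])
qed

text \<open>Trigonometric polynomials do not separate opposite faces of the cube, so
  Stone-Weierstrass is applied on the image of the cube under this map, where such points
  coincide.\<close>

definition torus_emb :: "real ^ 'n::finite \<Rightarrow> complex ^ 'n" where
  "torus_emb \<theta> = (\<chi> j. cis (2 * pi * \<theta> $ j))"

lemma torus_emb_continuous: "continuous_on A torus_emb"
  unfolding torus_emb_def by (intro continuous_intros)

lemma torus_emb_eq_imp:
  assumes "torus_emb \<theta> = torus_emb \<omega>"
  shows "\<theta> - \<omega> \<in> hlattice 1"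
proof -
  have "(\<theta> - \<omega>) $ j \<in> \<int>" for j
  proof -
    have "cis (2 * pi * \<theta> $ j) = cis (2 * pi * \<omega> $ j)"
      using assms by (simp add: torus_emb_def vec_eq_iff)
    then have "sin (2 * pi * \<theta> $ j) = sin (2 * pi * \<omega> $ j) \<and> cos (2 * pi * \<theta> $ j) = cos (2 * pi * \<omega> $ j)"
      by (simp add: complex_eq_iff)
    then obtain n :: int where "2 * pi * \<theta> $ j = 2 * pi * \<omega> $ j + 2 * pi * n"
      by (subst (asm) sin_cos_eq_iff) auto
    then have "2 * pi * (\<theta> $ j - \<omega> $ j) = 2 * pi * n" by (simp add: algebra_simps)
    then show ?thesis by simp
  qed
  then show ?thesis by (simp add: hlattice_iff)
qed

text \<open>Coordinate \<open>j\<close> of the embedding is the character of frequency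
  \<open>h *\<^sub>R axis j 1\<close>, and its conjugate is the character of the opposite
  frequency.\<close>

lemma torus_emb_Re_Im_trigpoly:
  assumes h: "h > 0"
  shows "(\<lambda>\<theta>. complex_of_real (Re (torus_emb \<theta> $ j))) \<in> trigpoly h"
    "(\<lambda>\<theta>. complex_of_real (Im (torus_emb \<theta> $ j))) \<in> trigpoly h"
proof -
  let ?p = "h *\<^sub>R axis j 1"
  have c: "chr h ?p \<theta> = torus_emb \<theta> $ j" "chr h (- ?p) \<theta> = cnj (torus_emb \<theta> $ j)" for \<theta>
    using h by (simp_all add: chr_cis torus_emb_def inner_axis' cis_cnj mult.assoc)
  have "(\<lambda>\<theta>. 1/2 * chr h ?p \<theta> + 1/2 * chr h (- ?p) \<theta>) \<in> trigpoly h"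
    by (intro trigpoly.intros hlattice_uminus hlattice_axis)
  moreover have "1/2 * z + 1/2 * cnj z = complex_of_real (Re z)" for z :: complex
    by (simp add: complex_eq_iff)
  ultimately show "(\<lambda>\<theta>. complex_of_real (Re (torus_emb \<theta> $ j))) \<in> trigpoly h"
    unfolding c by simp
  have "(\<lambda>\<theta>. 1/(2*\<i>) * chr h ?p \<theta> + (- 1/(2*\<i>)) * chr h (- ?p) \<theta>) \<in> trigpoly h"
    by (intro trigpoly.intros hlattice_uminus hlattice_axis)
  moreover have "1/(2*\<i>) * z + (- 1/(2*\<i>)) * cnj z = complex_of_real (Im z)" for z
    by (simp add: complex_eq_iff)
  ultimately show "(\<lambda>\<theta>. complex_of_real (Im (torus_emb \<theta> $ j))) \<in> trigpoly h"
    unfolding c by simp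
qed

text \<open>Stone-Weierstrass is used for real functions: the algebra \<open>R\<close> consists of
  real functions on the embedded torus whose pullback, read as complex-valued, is a trigonometric
  polynomial. Real and imaginary parts of the coordinates separate points.\<close>

lemma real_trigpoly_approx:
  fixes G :: "complex ^ 'n::finite \<Rightarrow> real"
  assumes h: "h > 0" and G: "continuous_on (torus_emb ` unit_cube) G" and e: "e > 0"
  obtains t where "t \<in> trigpoly h" "\<And>\<theta>. \<theta> \<in> unit_cube \<Longrightarrow> norm (of_real (G (torus_emb \<theta>)) - t \<theta>) < e"
proof -
  let ?S = "torus_emb ` unit_cube :: (complex ^ 'n) set"
  define R where "R = {\<phi>. continuous_on ?S \<phi> \<and> (\<lambda>\<theta>. complex_of_real (\<phi> (torus_emb \<theta>))) \<in> trigpoly h}"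
  have ReIm: "(\<lambda>z. Re (z $ j)) \<in> R" "(\<lambda>z. Im (z $ j)) \<in> R" for j
    unfolding R_def mem_Collect_eq
    by (intro conjI torus_emb_Re_Im_trigpoly[OF h] continuous_intros)+
  interpret function_ring_on R ?S
  proof
    show "compact ?S" by (intro compact_continuous_image torus_emb_continuous) auto
    show "continuous_on ?S f" if "f \<in> R" for f using that by (simp add: R_def)
    show "(\<lambda>_. c) \<in> R" for c by (simp add: R_def trigpoly_const)
    show "(\<lambda>x. f x + g x) \<in> R" "(\<lambda>x. f x * g x) \<in> R" if "f \<in> R" "g \<in> R" for f g
      using that by (simp_all add: R_def continuous_on_add continuous_on_mult trigpoly.add trigpoly_mult)
    fix x y :: "complex ^ 'n" assume "x \<noteq> y"
    then obtain j where "x $ j \<noteq> y $ j" unfolding vec_eq_iff by blast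
    then have "Re (x $ j) \<noteq> Re (y $ j) \<or> Im (x $ j) \<noteq> Im (y $ j)" by (simp add: complex_eq_iff)
    then show "\<exists>f\<in>R. f x \<noteq> f y"
    proof
      assume "Re (x $ j) \<noteq> Re (y $ j)"
      then show ?thesis by (intro bexI[OF _ ReIm(1)[of j]])
    next
      assume "Im (x $ j) \<noteq> Im (y $ j)"
      then show ?thesis by (intro bexI[OF _ ReIm(2)[of j]])
    qed
  qed
  from Stone_Weierstrass_basic[OF G e] obtain \<phi> where \<phi>: "\<phi> \<in> R" "\<forall>z\<in>?S. \<bar>G z - \<phi> z\<bar> < e" ..
  show ?thesis
  proof
    show "(\<lambda>\<theta>. complex_of_real (\<phi> (torus_emb \<theta>))) \<in> trigpoly h" using \<phi>(1) by (simp add: R_def)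
    show "norm (of_real (G (torus_emb \<theta>)) - complex_of_real (\<phi> (torus_emb \<theta>))) < e"
      if "\<theta> \<in> unit_cube" for \<theta>
    proof -
      have "\<bar>G (torus_emb \<theta>) - \<phi> (torus_emb \<theta>)\<bar> < e" using \<phi>(2) that by blast
      then show ?thesis unfolding of_real_diff[symmetric] norm_of_real .
    qed
  qed
qed

text \<open>The image of the cube carries the quotient topology: the preimage under \<open>g\<close>
  of a closed set meets the cube in a compact set, whose image is compact again. Periodicity makes
  the choice in \<open>G\<close> harmless.\<close>

lemma periodic_factors_through_torus:
  fixes g :: "real ^ 'n::finite \<Rightarrow> complex"
  assumes g: "continuous_on UNIV g" and per: "\<And>\<theta> j. g (\<theta> + axis j 1) = g \<theta>"
  obtains G where "continuous_on (torus_emb ` unit_cube) G" "\<And>\<theta>. \<theta> \<in> unit_cube \<Longrightarrow> G (torus_emb \<theta>) = g \<theta>"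
proof -
  let ?S = "torus_emb ` unit_cube :: (complex ^ 'n) set"
  define G where "G z = g (SOME \<theta>. \<theta> \<in> unit_cube \<and> torus_emb \<theta> = z)" for z
  have G: "G (torus_emb \<theta>) = g \<theta>" if "\<theta> \<in> unit_cube" for \<theta>
  proof -
    define \<omega> where "\<omega> = (SOME \<omega>. \<omega> \<in> unit_cube \<and> torus_emb \<omega> = torus_emb \<theta>)"
    have "torus_emb \<omega> = torus_emb \<theta>"
      unfolding \<omega>_def by (rule someI2[of _ \<theta>]) (use that in auto)
    then have "\<omega> - \<theta> \<in> hlattice 1" by (rule torus_emb_eq_imp)
    from periodic_hlattice_1[of g, OF per this, of \<theta>] show ?thesis by (simp add: G_def \<omega>_def)
  qed
  have "closed ?S"
    by (intro compact_imp_closed compact_continuous_image torus_emb_continuous) auto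
  moreover have "closed (G -` B \<inter> ?S)" if "closed B" for B
  proof -
    have "G -` B \<inter> ?S = torus_emb ` (unit_cube \<inter> g -` B)" using G by auto
    moreover have "compact (unit_cube \<inter> g -` B)"
    proof -
      have "closed (g -` B)" using g that by (auto simp: continuous_on_closed_vimage[OF closed_UNIV])
      then show ?thesis by (intro compact_Int_closed) auto
    qed
    ultimately show ?thesis
      by (auto intro!: compact_imp_closed compact_continuous_image torus_emb_continuous)
  qed
  ultimately have "continuous_on ?S G" by (simp add: continuous_on_closed_vimage)
  then show ?thesis using G by (rule that)
qed

text \<open>Orthogonality to trigonometric polynomials, among them uniform approximations
  \<open>u\<close> of \<open>cnj g\<close>, makes the integral of \<open>|g|\<close> squared
  arbitrarily small. A continuous nonnegative function with integral zero vanishes on the cube, and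
  periodicity does the rest.\<close>

lemma fourier_unique:
  fixes g :: "real ^ 'n::finite \<Rightarrow> complex"
  assumes h: "h > 0" and g: "continuous_on UNIV g" and per: "\<And>\<theta> j. g (\<theta> + axis j 1) = g \<theta>"
    and z: "\<And>p. p \<in> hlattice h \<Longrightarrow> fc h g p = 0"
  shows "g \<theta> = 0"
proof -
  obtain G where G: "continuous_on (torus_emb ` unit_cube) G" "\<And>\<theta>. \<theta> \<in> unit_cube \<Longrightarrow> G (torus_emb \<theta>) = g \<theta>"
    using periodic_factors_through_torus[OF g per] by blast
  have "bounded (g ` unit_cube)"
    by (intro compact_imp_bounded compact_continuous_image continuous_on_subset[OF g]) auto
  then obtain K where K: "\<And>x. x \<in> unit_cube \<Longrightarrow> norm (g x) \<le> K" "K > 0" by (auto simp: bounded_pos)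
  have cc: "continuous_on UNIV (\<lambda>\<theta>. g \<theta> * cnj (g \<theta>))" by (intro continuous_intros g)
  have small: "norm (integral unit_cube (\<lambda>\<theta>. g \<theta> * cnj (g \<theta>))) \<le> K * (2 * e)" if e: "e > 0" for e
  proof -
    obtain s where s: "s \<in> trigpoly h" "\<And>\<theta>. \<theta> \<in> unit_cube \<Longrightarrow> norm (of_real (Re (G (torus_emb \<theta>))) - s \<theta>) < e"
      using real_trigpoly_approx[OF h _ e, of "\<lambda>z. Re (G z)"] G(1) by (metis continuous_on_Re)
    obtain t where t: "t \<in> trigpoly h" "\<And>\<theta>. \<theta> \<in> unit_cube \<Longrightarrow> norm (of_real (Im (G (torus_emb \<theta>))) - t \<theta>) < e"
      using real_trigpoly_approx[OF h _ e, of "\<lambda>z. Im (G z)"] G(1) by (metis continuous_on_Im)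
    define u where "u = (\<lambda>\<theta>. s \<theta> + (- \<i>) * t \<theta>)"
    have u: "u \<in> trigpoly h" unfolding u_def by (intro trigpoly.add trigpoly.cmult s t)
    have close: "norm (cnj (g \<theta>) - u \<theta>) \<le> 2 * e" if "\<theta> \<in> unit_cube" for \<theta>
    proof -
      have "cnj (g \<theta>) - u \<theta> = (of_real (Re (g \<theta>)) - s \<theta>) - \<i> * (of_real (Im (g \<theta>)) - t \<theta>)"
        by (simp add: u_def complex_eq_iff)
      also have "norm \<dots> \<le> norm (of_real (Re (g \<theta>)) - s \<theta>) + norm (\<i> * (of_real (Im (g \<theta>)) - t \<theta>))"
        by (rule norm_triangle_ineq4)
      also have "\<dots> \<le> 2 * e" using s(2)[OF that] t(2)[OF that] by (simp add: norm_mult G(2)[OF that])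
      finally show ?thesis .
    qed
    have "integral unit_cube (\<lambda>\<theta>. g \<theta> * cnj (g \<theta>)) = integral unit_cube (\<lambda>\<theta>. g \<theta> * (cnj (g \<theta>) - u \<theta>))"
      unfolding right_diff_distrib
      by (subst integral_diff)
         (auto intro!: cube_integrable continuous_intros g trigpoly_continuous[OF u] simp: trigpoly_orthogonal[OF g z u])
    also have "norm \<dots> \<le> K * (2 * e)"
    proof (rule cube_integral_norm_le)
      show "continuous_on UNIV (\<lambda>\<theta>. g \<theta> * (cnj (g \<theta>) - u \<theta>))"
        by (intro continuous_intros g trigpoly_continuous[OF u])
      show "norm (g x * (cnj (g x) - u x)) \<le> K * (2 * e)" if "x \<in> unit_cube" for x
        unfolding norm_mult using K close[OF that] that by (intro mult_mono) auto
    qed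
    finally show ?thesis .
  qed
  have "norm (integral unit_cube (\<lambda>\<theta>. g \<theta> * cnj (g \<theta>))) \<le> 0"
  proof (rule field_le_epsilon)
    fix e :: real assume "e > 0"
    then show "norm (integral unit_cube (\<lambda>\<theta>. g \<theta> * cnj (g \<theta>))) \<le> 0 + e"
      using small[of "e / (2 * K)"] K(2) by (simp add: field_simps)
  qed
  then have "((\<lambda>\<theta>. g \<theta> * cnj (g \<theta>)) has_integral 0) unit_cube"
    using integrable_integral[OF cube_integrable[OF cc]] by simp
  from has_integral_linear[OF this bounded_linear_Re]
  have hi: "((\<lambda>\<theta>. Re (g \<theta> * cnj (g \<theta>))) has_integral 0) unit_cube" by (simp add: o_def)
  have zero: "g x = 0" if "x \<in> unit_cube" for x
  proof -
    have "Re (g x * cnj (g x)) = 0"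
    proof (rule has_integral_0_cbox_imp_0[OF _ _ hi _ that])
      show "continuous_on unit_cube (\<lambda>\<theta>. Re (g \<theta> * cnj (g \<theta>)))"
        by (intro continuous_intros continuous_on_subset[OF g]) auto
      show "box 0 (1 :: real ^ 'n) \<noteq> {}" by (simp add: interval_ne_empty_cart)
    qed (simp add: complex_mult_cnj)
    then show ?thesis by (simp add: complex_mult_cnj complex_eq_iff sum_power2_eq_zero_iff)
  qed
  define \<omega> where "\<omega> = (\<chi> j. frac (\<theta> $ j))"
  have "\<omega> \<in> unit_cube" by (simp add: \<omega>_def mem_box_cart frac_ge_0 frac_lt_1 less_imp_le)
  moreover have "\<theta> - \<omega> \<in> hlattice 1" by (simp add: hlattice_iff \<omega>_def frac_def)
  ultimately show ?thesis using periodic_hlattice_1[of g "\<theta> - \<omega>" \<omega>, OF per] zero[of \<omega>] by simp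
qed

lemma fourier_inversion:
  assumes h: "h > 0" and g: "g \<in> smooth_torus"
  shows "g = fser h (fc h g)"
proof
  fix \<theta>
  note s = rd_summable[OF h rd_fc[OF h g]]
  have "g \<theta> - fser h (fc h g) \<theta> = 0"
  proof (rule fourier_unique[OF h])
    show "continuous_on UNIV (\<lambda>\<theta>. g \<theta> - fser h (fc h g) \<theta>)"
      by (intro continuous_intros smooth_torus_continuous g fser_continuous s)
    show "g (\<theta> + axis j 1) - fser h (fc h g) (\<theta> + axis j 1) = g \<theta> - fser h (fc h g) \<theta>" for \<theta> j
      by (simp add: smooth_torus_periodic[OF g] fser_periodic[OF h])
    show "fc h (\<lambda>\<theta>. g \<theta> - fser h (fc h g) \<theta>) p = 0" if "p \<in> hlattice h" for p
      using fc_diff[OF smooth_torus_continuous[OF g] fser_continuous[OF s]] fc_fser[OF h s that] by simp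
  qed
  then show "g \<theta> = fser h (fc h g) \<theta>" by simp
qed


subsection \<open>Differences of Fourier series\<close>

lemma rd_fdiffs:
  assumes h: "h > 0" and c: "\<And>k. k \<in> hlattice h \<Longrightarrow> rd h (c k)" and k: "k \<in> hlattice h"
  shows "rd h (\<lambda>p. fdiffs h \<alpha> (\<lambda>k. c k p) k)"
  using k
proof (induction \<alpha> arbitrary: k rule: mindex_induct)
  case (inc j \<alpha>)
  have "rd h (\<lambda>p. inverse (of_real h) * (fdiffs h \<alpha> (\<lambda>k. c k p) (k + h *\<^sub>R axis j 1) - fdiffs h \<alpha> (\<lambda>k. c k p) k))"
    by (intro rd_cmult rd_diff inc.IH inc.prems hlattice_add_axis)
  then show ?case by (simp add: fdiffs_inc fdiff_def divide_inverse mult.commute)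
qed (simp add: c)

lemma fdiffs_fser:
  assumes h: "h > 0" and c: "\<And>k. k \<in> hlattice h \<Longrightarrow> rd h (c k)" and k: "k \<in> hlattice h"
  shows "fdiffs h \<alpha> (\<lambda>k. fser h (c k) \<theta>) k = fser h (\<lambda>p. fdiffs h \<alpha> (\<lambda>k. c k p) k) \<theta>"
  using k
proof (induction \<alpha> arbitrary: k rule: mindex_induct)
  case (inc j \<alpha>)
  have r: "rd h (\<lambda>p. fdiffs h \<alpha> (\<lambda>k. c k p) k)" if "k \<in> hlattice h" for k
    by (rule rd_fdiffs[OF h c that])
  have "fser h (\<lambda>p. inverse (of_real h) * (fdiffs h \<alpha> (\<lambda>k. c k p) (k + h *\<^sub>R axis j 1) - fdiffs h \<alpha> (\<lambda>k. c k p) k)) \<theta>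
      = inverse (of_real h) * (fser h (\<lambda>p. fdiffs h \<alpha> (\<lambda>k. c k p) (k + h *\<^sub>R axis j 1)) \<theta>
                      - fser h (\<lambda>p. fdiffs h \<alpha> (\<lambda>k. c k p) k) \<theta>)"
    unfolding fser_cmult
    by (subst fser_diff[OF rd_summable[OF h r] rd_summable[OF h r]]) (auto intro: inc.prems hlattice_add_axis)
  then show ?case
    using inc.IH[OF inc.prems] inc.IH[OF hlattice_add_axis[OF inc.prems], of j]
    by (simp add: fdiffs_inc fdiff_def divide_inverse mult.commute)
qed simp

lemma torD_smooth:
  assumes "h > 0" "g \<in> smooth_torus"
  shows "torD h \<gamma> g = fser h (\<lambda>p. of_real (pff h \<gamma> p) * fc h g p)"
  using torD_fser[OF assms(1) rd_fc[OF assms], of \<gamma>] fourier_inversion[OF assms] by simp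

text \<open>The frequency is frozen while both lattice slots are differenced; the coupling
  \<open>l = k + p\<close> is imposed only afterwards.\<close>

definition cdiffs :: "real \<Rightarrow> 'n::finite mindex \<Rightarrow> 'n mindex \<Rightarrow>
    (real ^ 'n \<Rightarrow> real ^ 'n \<Rightarrow> real ^ 'n \<Rightarrow> complex) \<Rightarrow> real ^ 'n \<Rightarrow> real ^ 'n \<Rightarrow> real ^ 'n \<Rightarrow> complex" where
  "cdiffs h \<alpha> \<beta> G k l p = ddiffs h \<alpha> \<beta> (\<lambda>k l. G k l p) k l"

lemma cdiffs_fdiff_left:
  "cdiffs h \<alpha> \<beta> (\<lambda>k l p. fdiff h j (\<lambda>k'. G k' l p) k) = cdiffs h (inc j \<alpha>) \<beta> G"
  by (intro ext) (simp add: cdiffs_def ddiffs_fdiff_left)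

lemma cdiffs_fdiff_right:
  "cdiffs h \<alpha> \<beta> (\<lambda>k l p. fdiff h j (\<lambda>l'. G k l' p) l) = cdiffs h \<alpha> (inc j \<beta>) G"
  using ddiffs_fdiff_right[of h \<alpha> \<beta> j] by (intro ext) (simp add: cdiffs_def)

lemma cdiffs_zero_left: "cdiffs h (\<lambda>_. 0) \<beta> G k l p = fdiffs h \<beta> (\<lambda>l. G k l p) l"
  by (simp add: cdiffs_def ddiffs_zero_left)

lemma cdiffs_zero: "cdiffs h (\<lambda>_. 0) (\<lambda>_. 0) G = G"
  by (intro ext) (simp add: cdiffs_zero_left)

lemma rd_cdiffs:
  assumes h: "h > 0" and c: "\<And>k l. k \<in> hlattice h \<Longrightarrow> l \<in> hlattice h \<Longrightarrow> rd h (G k l)"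
    and "k \<in> hlattice h" "l \<in> hlattice h"
  shows "rd h (cdiffs h \<alpha> \<beta> G k l)"
  unfolding cdiffs_def[abs_def] ddiffs_def
  using assms by (intro rd_fdiffs) auto

subsection \<open>Weights\<close>

definition br :: "'a::real_normed_vector \<Rightarrow> real" where
  "br k = 1 + norm k"

lemma br_ge_1 [simp]: "1 \<le> br k" and br_pos [simp]: "0 < br k" and br_nonneg [simp]: "0 \<le> br k"
  by (simp_all add: br_def add_pos_nonneg)

lemma br_nonzero [simp]: "br k \<noteq> 0"
  using br_pos[of k] by linarith

lemma wt_powr: "wt (p :: real ^ 'n::finite) = br p powr (- real (2 * CARD('n)))"
  unfolding wt_def br_def[symmetric] powr_minus by (subst powr_realpow) auto

lemma powr_le_powr_abs: "1 \<le> x \<Longrightarrow> x powr s \<le> x powr \<bar>s\<bar>" for x s :: real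
  by (rule powr_mono) auto

text \<open>Passing to the absolute value of the exponent makes the power monotone in its base
  whatever the sign of \<open>s\<close>. The loss is affordable where arbitrary decay in
  \<open>p\<close> is at hand.\<close>

lemma powr_le_mult_powr_abs:
  fixes x y A s :: real
  assumes "1 \<le> x" "x \<le> A * y" "0 \<le> A" "1 \<le> y"
  shows "x powr s \<le> A powr \<bar>s\<bar> * y powr \<bar>s\<bar>"
proof -
  have "x powr s \<le> x powr \<bar>s\<bar>" by (rule powr_le_powr_abs[OF assms(1)])
  also have "\<dots> \<le> (A * y) powr \<bar>s\<bar>" using assms by (intro powr_mono2) auto
  also have "\<dots> = A powr \<bar>s\<bar> * y powr \<bar>s\<bar>" using assms by (simp add: powr_mult)
  finally show ?thesis .
qed

text \<open>Between \<open>y / 2\<close> and \<open>2 * y\<close> a power of either sign changes by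
  a constant at most. It serves where the increment is small against \<open>k\<close> and no part of
  the exponent may be given away.\<close>

lemma powr_comparable:
  fixes x y s :: real
  assumes "0 < y" "y / 2 \<le> x" "x \<le> 2 * y"
  shows "x powr s \<le> 2 powr \<bar>s\<bar> * y powr s"
proof (cases "s \<ge> 0")
  case True
  have "x powr s \<le> (2 * y) powr s" using assms True by (intro powr_mono2) auto
  then show ?thesis using assms True by (simp add: powr_mult)
next
  case False
  have "x powr s \<le> (y / 2) powr s" using assms False by (intro powr_mono2') auto
  also have "\<dots> = 2 powr \<bar>s\<bar> * y powr s" using assms False
    by (simp add: powr_divide powr_minus_divide[of 2 s])
  finally show ?thesis .
qed

subsection \<open>Classes of coefficient functions\<close>

text \<open>\<open>G k l p\<close> stands for the Fourier coefficient of index \<open>p\<close> of an amplitude at \<open>(k, l)\<close>.  The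
  weight \<open>1 + |k| + |l|\<close> absorbs the exponent \<open>Q\<close> of the amplitude class.\<close>

locale amplitude_params =
  fixes h \<rho> \<delta> :: real
  assumes h: "0 < h" and \<delta>: "0 \<le> \<delta>" "\<delta> < \<rho>" and \<rho>: "\<rho> \<le> 1"
begin

abbreviation lat :: "(real ^ 'n::finite) set" where
  "lat \<equiv> hlattice h"

definition coeff_class ::
  "real \<Rightarrow> real \<Rightarrow> (real ^ 'n::finite \<Rightarrow> real ^ 'n \<Rightarrow> real ^ 'n \<Rightarrow> complex) set" where
  "coeff_class \<mu>\<^sub>1 \<mu>\<^sub>2 = {G.
     (\<forall>k\<in>lat. \<forall>l\<in>lat. rd h (G k l)) \<and>
     (\<forall>\<alpha> \<beta> \<gamma>. \<exists>C. \<forall>k\<in>lat. \<forall>l\<in>lat. \<forall>\<theta>.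
        norm (fser h (\<lambda>p. of_real (pff h \<gamma> p) * cdiffs h \<alpha> \<beta> G k l p) \<theta>)
          \<le> C * br k powr (\<mu>\<^sub>1 - \<rho> * real (mabs \<alpha>)) * br l powr (\<mu>\<^sub>2 - \<rho> * real (mabs \<beta>))
              * (1 + norm k + norm l) powr (\<delta> * real (mabs \<gamma>)))}"

lemma coeff_class_rd: "G \<in> coeff_class \<mu>\<^sub>1 \<mu>\<^sub>2 \<Longrightarrow> k \<in> lat \<Longrightarrow> l \<in> lat \<Longrightarrow> rd h (G k l)"
  by (simp add: coeff_class_def)

lemma coeff_class_bound:
  fixes G :: "real ^ 'n::finite \<Rightarrow> real ^ 'n \<Rightarrow> real ^ 'n \<Rightarrow> complex"
  assumes "G \<in> coeff_class \<mu>\<^sub>1 \<mu>\<^sub>2"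
  shows "\<exists>C>0. \<forall>k\<in>lat. \<forall>l\<in>lat. \<forall>\<theta>.
        norm (fser h (\<lambda>p. of_real (pff h \<gamma> p) * cdiffs h \<alpha> \<beta> G k l p) \<theta>)
          \<le> C * br k powr (\<mu>\<^sub>1 - \<rho> * real (mabs \<alpha>)) * br l powr (\<mu>\<^sub>2 - \<rho> * real (mabs \<beta>))
              * (1 + norm k + norm l) powr (\<delta> * real (mabs \<gamma>))"
proof -
  obtain C where C: "\<forall>k\<in>lat. \<forall>l\<in>lat. \<forall>\<theta>.
        norm (fser h (\<lambda>p. of_real (pff h \<gamma> p) * cdiffs h \<alpha> \<beta> G k l p) \<theta>)
          \<le> C * br k powr (\<mu>\<^sub>1 - \<rho> * real (mabs \<alpha>)) * br l powr (\<mu>\<^sub>2 - \<rho> * real (mabs \<beta>))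
              * (1 + norm k + norm l) powr (\<delta> * real (mabs \<gamma>))"
    using assms unfolding coeff_class_def by blast
  have "C \<le> max C 1" by simp
  then have "C * x * y * z \<le> max C 1 * x * y * z" if "0 \<le> x" "0 \<le> y" "0 \<le> z" for x y z
    using that by (intro mult_right_mono)
  then show ?thesis
    using C by (intro exI[of _ "max C 1"] conjI ballI allI) (auto intro!: order_trans[OF C[rule_format]])
qed

text \<open>The class quantifies over all orders of difference, so one more difference in
  \<open>k\<close> merely shifts \<open>\<alpha>\<close> to \<open>inc j \<alpha>\<close>, and the
  order drops by \<rho>.\<close>

lemma coeff_class_fdiff_left:
  fixes G :: "real ^ 'n::finite \<Rightarrow> real ^ 'n \<Rightarrow> real ^ 'n \<Rightarrow> complex"
  assumes "G \<in> coeff_class \<mu>\<^sub>1 \<mu>\<^sub>2"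
  shows "(\<lambda>k l p. fdiff h j (\<lambda>k'. G k' l p) k) \<in> coeff_class (\<mu>\<^sub>1 - \<rho>) \<mu>\<^sub>2"
  unfolding coeff_class_def mem_Collect_eq cdiffs_fdiff_left
proof (intro conjI ballI allI)
  fix k l :: "real ^ 'n" assume "k \<in> lat" "l \<in> lat"
  then have "rd h (cdiffs h (inc j (\<lambda>_. 0)) (\<lambda>_. 0) G k l)"
    by (intro rd_cdiffs h coeff_class_rd[OF assms])
  then show "rd h (\<lambda>p. fdiff h j (\<lambda>k'. G k' l p) k)"
    by (simp add: cdiffs_def[abs_def] ddiffs_def fdiffs_inc)
next
  fix \<alpha> \<beta> \<gamma> :: "'n mindex"
  have e: "\<mu>\<^sub>1 - \<rho> * real (mabs (inc j \<alpha>)) = \<mu>\<^sub>1 - \<rho> - \<rho> * real (mabs \<alpha>)" by (simp add: algebra_simps)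
  from coeff_class_bound[OF assms, of \<gamma> "inc j \<alpha>" \<beta>]
  show "\<exists>C. \<forall>k\<in>lat. \<forall>l\<in>lat. \<forall>\<theta>. norm (fser h (\<lambda>p. of_real (pff h \<gamma> p) * cdiffs h (inc j \<alpha>) \<beta> G k l p) \<theta>)
     \<le> C * br k powr (\<mu>\<^sub>1 - \<rho> - \<rho> * real (mabs \<alpha>)) * br l powr (\<mu>\<^sub>2 - \<rho> * real (mabs \<beta>))
              * (1 + norm k + norm l) powr (\<delta> * real (mabs \<gamma>))"
    unfolding e by blast
qed

lemma coeff_class_fdiff_right:
  fixes G :: "real ^ 'n::finite \<Rightarrow> real ^ 'n \<Rightarrow> real ^ 'n \<Rightarrow> complex"
  assumes "G \<in> coeff_class \<mu>\<^sub>1 \<mu>\<^sub>2"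
  shows "(\<lambda>k l p. fdiff h j (\<lambda>l'. G k l' p) l) \<in> coeff_class \<mu>\<^sub>1 (\<mu>\<^sub>2 - \<rho>)"
  unfolding coeff_class_def mem_Collect_eq cdiffs_fdiff_right
proof (intro conjI ballI allI)
  fix k l :: "real ^ 'n" assume "k \<in> lat" "l \<in> lat"
  then have "rd h (cdiffs h (\<lambda>_. 0) (inc j (\<lambda>_. 0)) G k l)"
    by (intro rd_cdiffs h coeff_class_rd[OF assms])
  then show "rd h (\<lambda>p. fdiff h j (\<lambda>l'. G k l' p) l)"
    by (simp add: cdiffs_def[abs_def] ddiffs_def fdiffs_inc)
next
  fix \<alpha> \<beta> \<gamma> :: "'n mindex"
  have e: "\<mu>\<^sub>2 - \<rho> * real (mabs (inc j \<beta>)) = \<mu>\<^sub>2 - \<rho> - \<rho> * real (mabs \<beta>)" by (simp add: algebra_simps)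
  from coeff_class_bound[OF assms, of \<gamma> \<alpha> "inc j \<beta>"]
  show "\<exists>C. \<forall>k\<in>lat. \<forall>l\<in>lat. \<forall>\<theta>. norm (fser h (\<lambda>p. of_real (pff h \<gamma> p) * cdiffs h \<alpha> (inc j \<beta>) G k l p) \<theta>)
     \<le> C * br k powr (\<mu>\<^sub>1 - \<rho> * real (mabs \<alpha>)) * br l powr (\<mu>\<^sub>2 - \<rho> - \<rho> * real (mabs \<beta>))
              * (1 + norm k + norm l) powr (\<delta> * real (mabs \<gamma>))"
    unfolding e by blast
qed

lemma amplitude_coeff_class:
  fixes a :: "real ^ 'n::finite \<Rightarrow> real ^ 'n \<Rightarrow> real ^ 'n \<Rightarrow> complex"
  assumes a: "a \<in> amplitude_class h \<mu>\<^sub>1 \<mu>\<^sub>2 \<rho> \<delta>"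
  shows "(\<lambda>k l. fc h (a k l)) \<in> coeff_class \<mu>\<^sub>1 \<mu>\<^sub>2"
  unfolding coeff_class_def mem_Collect_eq
proof (intro conjI ballI allI)
  have sm: "a k l \<in> smooth_torus" if "k \<in> lat" "l \<in> lat" for k l
    using a that by (auto simp: amplitude_class_def)
  let ?G = "\<lambda>k l. fc h (a k l)"
  show rdG: "rd h (?G k l)" if "k \<in> lat" "l \<in> lat" for k l
    by (rule rd_fc[OF h sm[OF that]])
  fix \<alpha> \<beta> \<gamma> :: "'n mindex"
  obtain C Q where C: "C > 0" "Q \<le> mabs \<gamma>" "\<forall>k\<in>lat. \<forall>m\<in>lat. \<forall>\<theta>.
        norm (torD h \<gamma> (\<lambda>\<omega>. fdiffs h \<alpha> (\<lambda>k'. fdiffs h \<beta> (\<lambda>m'. a k' m' \<omega>) m) k) \<theta>)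
          \<le> C * (1 + norm k) powr (\<mu>\<^sub>1 - \<rho> * real (mabs \<alpha>) + \<delta> * real Q)
              * (1 + norm m) powr (\<mu>\<^sub>2 - \<rho> * real (mabs \<beta>) + \<delta> * (real (mabs \<gamma>) - real Q))"
    using a unfolding amplitude_class_def mem_Collect_eq by meson
  have "norm (fser h (\<lambda>p. of_real (pff h \<gamma> p) * cdiffs h \<alpha> \<beta> ?G k l p) \<theta>)
          \<le> C * br k powr (\<mu>\<^sub>1 - \<rho> * real (mabs \<alpha>)) * br l powr (\<mu>\<^sub>2 - \<rho> * real (mabs \<beta>))
              * (1 + norm k + norm l) powr (\<delta> * real (mabs \<gamma>))"
    if k: "k \<in> lat" and l: "l \<in> lat" for k l \<theta>
  proof -
    have "fdiffs h \<alpha> (\<lambda>k'. fdiffs h \<beta> (\<lambda>m'. a k' m' \<omega>) l) k = fser h (cdiffs h \<alpha> \<beta> ?G k l) \<omega>" for \<omega>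
    proof -
      have "fdiffs h \<alpha> (\<lambda>k'. fdiffs h \<beta> (\<lambda>m'. a k' m' \<omega>) l) k
          = fdiffs h \<alpha> (\<lambda>k'. fdiffs h \<beta> (\<lambda>m'. fser h (?G k' m') \<omega>) l) k"
        by (intro fdiffs_cong[OF _ k] fdiffs_cong[OF _ l]) (metis fourier_inversion h sm)
      also have "\<dots> = fdiffs h \<alpha> (\<lambda>k'. fser h (\<lambda>p. fdiffs h \<beta> (\<lambda>m'. ?G k' m' p) l) \<omega>) k"
        by (intro fdiffs_cong[OF _ k] fdiffs_fser[OF h _ l] rdG)
      also have "\<dots> = fser h (cdiffs h \<alpha> \<beta> ?G k l) \<omega>"
        unfolding cdiffs_def[abs_def] ddiffs_def by (intro fdiffs_fser[OF h _ k] rd_fdiffs[OF h _ l] rdG)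
      finally show ?thesis .
    qed
    then have "fser h (\<lambda>p. of_real (pff h \<gamma> p) * cdiffs h \<alpha> \<beta> ?G k l p) \<theta>
        = torD h \<gamma> (\<lambda>\<omega>. fdiffs h \<alpha> (\<lambda>k'. fdiffs h \<beta> (\<lambda>m'. a k' m' \<omega>) l) k) \<theta>"
      using torD_fser[OF h, where \<beta> = \<gamma>, OF rd_cdiffs[where \<alpha> = \<alpha> and \<beta> = \<beta>, OF h rdG k l]] by simp
    then have "norm (fser h (\<lambda>p. of_real (pff h \<gamma> p) * cdiffs h \<alpha> \<beta> ?G k l p) \<theta>)
        \<le> C * br k powr (\<mu>\<^sub>1 - \<rho> * real (mabs \<alpha>) + \<delta> * real Q)
              * br l powr (\<mu>\<^sub>2 - \<rho> * real (mabs \<beta>) + \<delta> * (real (mabs \<gamma>) - real Q))"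
      using C(3) k l by (simp add: br_def)
    also have "\<dots> = C * br k powr (\<mu>\<^sub>1 - \<rho> * real (mabs \<alpha>)) * br l powr (\<mu>\<^sub>2 - \<rho> * real (mabs \<beta>))
        * (br k powr (\<delta> * real Q) * br l powr (\<delta> * (real (mabs \<gamma>) - real Q)))"
      by (simp add: powr_add)
    \<comment> \<open>Both exponents are nonnegative because \<open>Q \<le> mabs \<gamma>\<close>,
      so either base may be enlarged to \<open>1 + norm k + norm l\<close>.\<close>
    also have "\<dots> \<le> C * br k powr (\<mu>\<^sub>1 - \<rho> * real (mabs \<alpha>)) * br l powr (\<mu>\<^sub>2 - \<rho> * real (mabs \<beta>))
              * ((1 + norm k + norm l) powr (\<delta> * real Q) * (1 + norm k + norm l) powr (\<delta> * (real (mabs \<gamma>) - real Q)))"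
      using C(1,2) \<delta> by (intro mult_left_mono mult_mono powr_mono2) (auto simp: br_def)
    also have "(1 + norm k + norm l) powr (\<delta> * real Q) * (1 + norm k + norm l) powr (\<delta> * (real (mabs \<gamma>) - real Q))
        = (1 + norm k + norm l) powr (\<delta> * real (mabs \<gamma>))"
      by (simp add: powr_add[symmetric] algebra_simps)
    finally show ?thesis .
  qed
  then show "\<exists>C. \<forall>k\<in>lat. \<forall>l\<in>lat. \<forall>\<theta>. norm (fser h (\<lambda>p. of_real (pff h \<gamma> p) * cdiffs h \<alpha> \<beta> ?G k l p) \<theta>)
          \<le> C * br k powr (\<mu>\<^sub>1 - \<rho> * real (mabs \<alpha>)) * br l powr (\<mu>\<^sub>2 - \<rho> * real (mabs \<beta>))
              * (1 + norm k + norm l) powr (\<delta> * real (mabs \<gamma>))" by blast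
qed

text \<open>Reverse comparison to \<open>ff_bound\<close>. Falling factorials vanish at some small
  lattice points, whence the summand 1, but away from these they grow like powers; the largest
  coordinate of \<open>p\<close> is enough.\<close>

lemma br_power_le_ff:
  "\<exists>K>0. \<forall>p :: real ^ 'n::finite. br p ^ M \<le> K * (1 + (\<Sum>j\<in>UNIV. \<bar>ff h M (p $ j)\<bar>))"
proof (intro exI conjI allI)
  let ?n = "real CARD('n)" and ?A = "4 + 2 * h * real M"
  let ?K = "(1 + ?n) ^ M * ?A ^ M"
  have A: "?A > 0" using h by (intro add_pos_nonneg) auto
  then show "?K > 0" by (intro mult_pos_pos zero_less_power) auto
  fix p :: "real ^ 'n"
  obtain j where j: "norm p \<le> ?n * \<bar>p $ j\<bar>" using norm_le_card_component by blast
  have "br p \<le> (1 + ?n) * (1 + \<bar>p $ j\<bar>)" using j by (simp add: br_def algebra_simps add_increasing)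
  then have 1: "br p ^ M \<le> (1 + ?n) ^ M * (1 + \<bar>p $ j\<bar>) ^ M"
    by (subst power_mult_distrib[symmetric]) (intro power_mono, auto)
  have 2: "(1 + \<bar>p $ j\<bar>) ^ M \<le> ?A ^ M * (1 + \<bar>ff h M (p $ j)\<bar>)"
  \<comment> \<open>Past this threshold every shift \<open>h * i\<close> with \<open>i < M\<close>
    is below half of \<open>\<bar>p $ j\<bar>\<close>, so each factor of the falling factorial is at
    least \<open>\<bar>p $ j\<bar> / 2\<close>.\<close>
  proof (cases "\<bar>p $ j\<bar> \<le> 1 + 2 * h * real M")
    case True
    then have "(1 + \<bar>p $ j\<bar>) ^ M \<le> ?A ^ M" by (intro power_mono) auto
    also have "\<dots> \<le> ?A ^ M * (1 + \<bar>ff h M (p $ j)\<bar>)" using A by (simp add: algebra_simps)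
    finally show ?thesis .
  next
    case False
    have "(\<bar>p $ j\<bar> / 2) ^ M = (\<Prod>i<M. \<bar>p $ j\<bar> / 2)" by simp
    also have "\<dots> \<le> (\<Prod>i<M. \<bar>p $ j - h * real i\<bar>)"
    proof (rule prod_mono)
      fix i assume "i \<in> {..<M}"
      then have "h * real i \<le> h * real M" "0 \<le> h * real i" using h by auto
      then have "\<bar>p $ j\<bar> / 2 \<le> \<bar>p $ j - h * real i\<bar>" using False by (auto simp: abs_if split: if_splits)
      then show "0 \<le> \<bar>p $ j\<bar> / 2 \<and> \<bar>p $ j\<bar> / 2 \<le> \<bar>p $ j - h * real i\<bar>" by simp
    qed
    also have "\<dots> = \<bar>ff h M (p $ j)\<bar>" by (simp add: ff_def abs_prod)
    finally have "(\<bar>p $ j\<bar> / 2) ^ M \<le> \<bar>ff h M (p $ j)\<bar>" .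
    have ge: "0 \<le> 2 * h * real M" using h by simp
    have "(1 + \<bar>p $ j\<bar>) ^ M \<le> (?A * (\<bar>p $ j\<bar> / 2)) ^ M"
    proof (intro power_mono)
      have "4 * (\<bar>p $ j\<bar> / 2) \<le> ?A * (\<bar>p $ j\<bar> / 2)" using ge by (intro mult_right_mono) auto
      then show "1 + \<bar>p $ j\<bar> \<le> ?A * (\<bar>p $ j\<bar> / 2)" using False ge by linarith
    qed auto
    also have "\<dots> = ?A ^ M * (\<bar>p $ j\<bar> / 2) ^ M" by (rule power_mult_distrib)
    also have "\<dots> \<le> ?A ^ M * (1 + \<bar>ff h M (p $ j)\<bar>)"
      using \<open>(\<bar>p $ j\<bar> / 2) ^ M \<le> \<bar>ff h M (p $ j)\<bar>\<close> A by (intro mult_left_mono) auto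
    finally show ?thesis .
  qed
  have 3: "\<bar>ff h M (p $ j)\<bar> \<le> (\<Sum>j\<in>UNIV. \<bar>ff h M (p $ j)\<bar>)" by (rule member_le_sum) auto
  have "br p ^ M \<le> (1 + ?n) ^ M * (?A ^ M * (1 + \<bar>ff h M (p $ j)\<bar>))"
    using 1 2 by (elim order_trans) (intro mult_left_mono, auto)
  also have "\<dots> \<le> (1 + ?n) ^ M * (?A ^ M * (1 + (\<Sum>j\<in>UNIV. \<bar>ff h M (p $ j)\<bar>)))"
    using 3 A by (intro mult_left_mono) auto
  finally show "br p ^ M \<le> ?K * (1 + (\<Sum>j\<in>UNIV. \<bar>ff h M (p $ j)\<bar>))" by (simp add: mult.assoc)
qed

text \<open>The multipliers \<open>pff h (s j)\<close>, of order \<open>M\<close> in the single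
  coordinate \<open>j\<close>, bound \<open>ff h M (p $ j)\<close> times the coefficient; summed
  over \<open>j\<close> these bounds control \<open>br p ^ M\<close>. Each power of decay in
  \<open>p\<close> costs \<delta> powers of the joint weight.\<close>

lemma coeff_decay:
  fixes G :: "real ^ 'n::finite \<Rightarrow> real ^ 'n \<Rightarrow> real ^ 'n \<Rightarrow> complex"
  assumes G: "G \<in> coeff_class \<mu>\<^sub>1 \<mu>\<^sub>2"
  shows "\<exists>C>0. \<forall>k\<in>lat. \<forall>l\<in>lat. \<forall>p\<in>lat.
        norm (cdiffs h \<alpha> \<beta> G k l p)
          \<le> C * br p powr (- real M) * br k powr (\<mu>\<^sub>1 - \<rho> * real (mabs \<alpha>)) * br l powr (\<mu>\<^sub>2 - \<rho> * real (mabs \<beta>))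
              * (1 + norm k + norm l) powr (\<delta> * real M)"
proof -
  let ?W = "\<lambda>m k l. br k powr (\<mu>\<^sub>1 - \<rho> * real (mabs \<alpha>)) * br l powr (\<mu>\<^sub>2 - \<rho> * real (mabs \<beta>))
              * (1 + norm k + norm l) powr (\<delta> * real m)"
  define s where "s j = (\<lambda>i. if i = j then M else 0)" for j :: 'n
  have ms: "mabs (s j) = M" for j by (simp add: s_def mabs_def)
  have ps: "pff h (s j) p = ff h M (p $ j)" for j p
    unfolding pff_def s_def by (subst prod.remove[of UNIV j]) auto
  have bd: "\<exists>C>0. \<forall>k\<in>lat. \<forall>l\<in>lat. \<forall>p\<in>lat. \<bar>pff h \<gamma> p\<bar> * norm (cdiffs h \<alpha> \<beta> G k l p) \<le> C * ?W (mabs \<gamma>) k l" for \<gamma>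
  proof -
    obtain C where C: "C > 0" "\<forall>k\<in>lat. \<forall>l\<in>lat. \<forall>\<theta>.
        norm (fser h (\<lambda>p. of_real (pff h \<gamma> p) * cdiffs h \<alpha> \<beta> G k l p) \<theta>) \<le> C * ?W (mabs \<gamma>) k l"
      using coeff_class_bound[OF G, of \<gamma> \<alpha> \<beta>] by (auto simp: mult.assoc)
    have "\<bar>pff h \<gamma> p\<bar> * norm (cdiffs h \<alpha> \<beta> G k l p) \<le> C * ?W (mabs \<gamma>) k l" if "k \<in> lat" "l \<in> lat" "p \<in> lat" for k l p
    proof -
      have r: "rd h (\<lambda>p. of_real (pff h \<gamma> p) * cdiffs h \<alpha> \<beta> G k l p)"
        using that by (intro rd_pff h rd_cdiffs coeff_class_rd[OF G])
      have "norm (of_real (pff h \<gamma> p) * cdiffs h \<alpha> \<beta> G k l p) \<le> C * ?W (mabs \<gamma>) k l"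
        by (rule coeff_norm_le[OF h rd_summable[OF h r] that(3)]) (use C that in blast)
      then show ?thesis by (simp add: norm_mult)
    qed
    with C(1) show ?thesis by blast
  qed
  obtain C0 where C0: "C0 > 0" "\<And>k l p. k \<in> lat \<Longrightarrow> l \<in> lat \<Longrightarrow> p \<in> lat \<Longrightarrow> norm (cdiffs h \<alpha> \<beta> G k l p) \<le> C0 * ?W 0 k l"
    using bd[of "\<lambda>_. 0"] by auto
  have "\<forall>j. \<exists>C. C > 0 \<and> (\<forall>k\<in>lat. \<forall>l\<in>lat. \<forall>p\<in>lat. \<bar>ff h M (p $ j)\<bar> * norm (cdiffs h \<alpha> \<beta> G k l p) \<le> C * ?W M k l)"
    using bd[of "s _"] unfolding ms ps by blast
  from choice[OF this] obtain C where C: "\<And>j. C j > 0" "\<And>j k l p. k \<in> lat \<Longrightarrow> l \<in> lat \<Longrightarrow> p \<in> lat \<Longrightarrow>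
      \<bar>ff h M (p $ j)\<bar> * norm (cdiffs h \<alpha> \<beta> G k l p) \<le> C j * ?W M k l" by blast
  obtain K where K: "K > 0" "\<And>p :: real ^ 'n. br p ^ M \<le> K * (1 + (\<Sum>j\<in>UNIV. \<bar>ff h M (p $ j)\<bar>))"
    using br_power_le_ff[of M] by blast
  let ?C = "K * (C0 + sum C UNIV)"
  have "norm (cdiffs h \<alpha> \<beta> G k l p) \<le> ?C * br p powr (- real M) * ?W M k l"
    if kl: "k \<in> lat" "l \<in> lat" "p \<in> lat" for k l p
  proof -
    have W0: "?W 0 k l \<le> ?W M k l"
      using \<delta> by (intro mult_left_mono[OF powr_mono]) auto
    have "br p ^ M * norm (cdiffs h \<alpha> \<beta> G k l p) \<le> K * (1 + (\<Sum>j\<in>UNIV. \<bar>ff h M (p $ j)\<bar>)) * norm (cdiffs h \<alpha> \<beta> G k l p)"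
      using K(2) by (intro mult_right_mono) auto
    also have "\<dots> = K * (norm (cdiffs h \<alpha> \<beta> G k l p) + (\<Sum>j\<in>UNIV. \<bar>ff h M (p $ j)\<bar> * norm (cdiffs h \<alpha> \<beta> G k l p)))"
      by (simp add: distrib_right sum_distrib_right mult.assoc)
    also have "\<dots> \<le> K * (C0 * ?W M k l + (\<Sum>j\<in>UNIV. C j * ?W M k l))"
    proof (intro mult_left_mono add_mono sum_mono C(2) kl)
      show "norm (cdiffs h \<alpha> \<beta> G k l p) \<le> C0 * ?W M k l"
        using C0(2)[OF kl] mult_left_mono[OF W0, of C0] C0(1) by linarith
    qed (use K(1) in simp)
    also have "\<dots> = ?C * ?W M k l" by (simp only: distrib_right sum_distrib_right mult.assoc distrib_left)
    finally have *: "br p ^ M * norm (cdiffs h \<alpha> \<beta> G k l p) \<le> ?C * ?W M k l" .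
    have "norm (cdiffs h \<alpha> \<beta> G k l p) = br p powr (- real M) * (br p ^ M * norm (cdiffs h \<alpha> \<beta> G k l p))"
      by (simp add: powr_minus powr_realpow field_simps)
    also have "\<dots> \<le> br p powr (- real M) * (?C * ?W M k l)"
      using * by (intro mult_left_mono) auto
    finally show ?thesis by (simp only: mult_ac)
  qed
  moreover have "?C > 0" using K(1) C0(1) C(1) by (intro mult_pos_pos add_pos_nonneg sum_nonneg) (auto intro: less_imp_le)
  ultimately show ?thesis by (intro exI[of _ ?C]) (auto simp: mult.assoc)
qed

end


subsection \<open>Estimates for the Taylor remainder\<close>

context amplitude_params
begin

text \<open>Where \<open>br p\<close> dominates \<open>br k\<close>, and hence \<open>br l\<close>,
  all weights turn into powers of \<open>br p\<close>. Decay of order \<open>M\<close> then leaves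
  the exponent \<open>- (1 - \<delta>) * M\<close> plus a constant, which is as negative as
  desired.\<close>

lemma far_decay:
  fixes G :: "real ^ 'n::finite \<Rightarrow> real ^ 'n \<Rightarrow> real ^ 'n \<Rightarrow> complex"
  assumes G: "G \<in> coeff_class \<mu>\<^sub>1 \<mu>\<^sub>2" and A: "0 \<le> A"
  shows "\<exists>C>0. \<forall>k\<in>lat. \<forall>l\<in>lat. \<forall>p\<in>lat. br k \<le> A * br p \<longrightarrow> norm l \<le> norm k + norm p \<longrightarrow>
           norm (cdiffs h \<alpha> \<beta> G k l p) \<le> C * br p powr (- X)"
proof -
  define s where "s = \<mu>\<^sub>1 - \<rho> * real (mabs \<alpha>)"
  define t where "t = \<mu>\<^sub>2 - \<rho> * real (mabs \<beta>)"
  have d1: "0 < 1 - \<delta>" using \<delta> \<rho> by simp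
  define M where "M = nat \<lceil>(X + \<bar>s\<bar> + \<bar>t\<bar>) / (1 - \<delta>)\<rceil>"
  have "(X + \<bar>s\<bar> + \<bar>t\<bar>) / (1 - \<delta>) \<le> real M" unfolding M_def by linarith
  then have M: "X + \<bar>s\<bar> + \<bar>t\<bar> \<le> real M * (1 - \<delta>)" using d1 by (simp add: pos_divide_le_eq)
  obtain C where C: "C > 0" "\<And>k l p. k \<in> lat \<Longrightarrow> l \<in> lat \<Longrightarrow> p \<in> lat \<Longrightarrow>
        norm (cdiffs h \<alpha> \<beta> G k l p) \<le> C * br p powr (- real M) * br k powr s * br l powr t
              * (1 + norm k + norm l) powr (\<delta> * real M)"
    using coeff_decay[OF G, of \<alpha> \<beta> M] unfolding s_def t_def by blast
  define K where "K = A powr \<bar>s\<bar> * (A + 1) powr \<bar>t\<bar> * (2 * A + 1) powr \<bar>\<delta> * real M\<bar>"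
  have K: "K \<ge> 0" unfolding K_def by simp
  \<comment> \<open>\<open>A = 0\<close> is allowed and makes \<open>K\<close> vanish; adding 1
    keeps the constant positive.\<close>
  have "norm (cdiffs h \<alpha> \<beta> G k l p) \<le> (C * (K + 1)) * br p powr (- X)"
    if kl: "k \<in> lat" "l \<in> lat" "p \<in> lat" and far: "br k \<le> A * br p" and l: "norm l \<le> norm k + norm p" for k l p
  proof -
    have 1: "br k powr s \<le> A powr \<bar>s\<bar> * br p powr \<bar>s\<bar>"
      using far A by (intro powr_le_mult_powr_abs) auto
    have 2: "br l powr t \<le> (A + 1) powr \<bar>t\<bar> * br p powr \<bar>t\<bar>"
      using far A l by (intro powr_le_mult_powr_abs) (auto simp: distrib_right, auto simp: br_def)
    have 3: "(1 + norm k + norm l) powr (\<delta> * real M) \<le> (2 * A + 1) powr \<bar>\<delta> * real M\<bar> * br p powr \<bar>\<delta> * real M\<bar>"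
    proof (rule powr_le_mult_powr_abs)
      have "1 + norm k + norm l \<le> br k + br k + br p" using l by (simp add: br_def)
      then show "1 + norm k + norm l \<le> (2 * A + 1) * br p" using far by (simp add: distrib_right)
    qed (use A in auto)
    have "norm (cdiffs h \<alpha> \<beta> G k l p) \<le> C * br p powr (- real M) * br k powr s * br l powr t
              * (1 + norm k + norm l) powr (\<delta> * real M)" by (rule C(2)[OF kl])
    also have "\<dots> \<le> C * br p powr (- real M) * (A powr \<bar>s\<bar> * br p powr \<bar>s\<bar>) * ((A + 1) powr \<bar>t\<bar> * br p powr \<bar>t\<bar>)
              * ((2 * A + 1) powr \<bar>\<delta> * real M\<bar> * br p powr \<bar>\<delta> * real M\<bar>)"
      using C(1) by (intro mult_mono mult_nonneg_nonneg mult_left_mono 1 2 3) auto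
    also have "\<dots> = C * K * (br p powr (- real M) * br p powr \<bar>s\<bar> * br p powr \<bar>t\<bar> * br p powr \<bar>\<delta> * real M\<bar>)"
      unfolding K_def by (simp only: mult_ac)
    also have "br p powr (- real M) * br p powr \<bar>s\<bar> * br p powr \<bar>t\<bar> * br p powr \<bar>\<delta> * real M\<bar>
        = br p powr (- real M + \<bar>s\<bar> + \<bar>t\<bar> + \<delta> * real M)"
      unfolding powr_add[symmetric] using \<delta> by simp
    also have "C * K * \<dots> \<le> C * (K + 1) * br p powr (- X)"
      using C(1) K M by (intro mult_mono powr_mono) (auto simp: algebra_simps)
    finally show ?thesis .
  qed
  moreover have "C * (K + 1) > 0" using C(1) K by (intro mult_pos_pos) auto
  ultimately show ?thesis by blast
qed

text \<open>The coefficient at \<open>p\<close> of the remainder: the Taylor increment in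
  \<open>l\<close> is the frequency itself.\<close>

definition trem :: "nat \<Rightarrow> (real ^ 'n::finite \<Rightarrow> real ^ 'n \<Rightarrow> real ^ 'n \<Rightarrow> complex) \<Rightarrow> real ^ 'n \<Rightarrow> real ^ 'n \<Rightarrow> complex"
  where "trem N G k p = taylor_rem h N (\<lambda>l. G k l p) k p"

lemma trem_eq: "trem N G k p = G k (k + p) p
    - (\<Sum>\<alpha> | mabs \<alpha> < N. of_real (pff h \<alpha> p / mfact \<alpha>) * cdiffs h (\<lambda>_. 0) \<alpha> G k k p)"
  by (simp add: trem_def taylor_rem_def cdiffs_zero_left)

text \<open>At fixed \<open>k\<close> the choice \<open>A = br k\<close> makes every
  \<open>p\<close> count as far, since \<open>br p\<close> is at least 1.\<close>

lemma rd_diag: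
  assumes G: "G \<in> coeff_class \<mu>\<^sub>1 \<mu>\<^sub>2" and k: "k \<in> lat"
  shows "rd h (\<lambda>p. G k (k + p) p)"
  unfolding rd_def
proof
  fix M
  obtain C where C: "C > 0" "\<forall>k'\<in>lat. \<forall>l\<in>lat. \<forall>p\<in>lat. br k' \<le> br k * br p \<longrightarrow> norm l \<le> norm k' + norm p \<longrightarrow>
           norm (G k' l p) \<le> C * br p powr (- real M)"
    using far_decay[OF G br_nonneg[of k], where \<alpha> = "\<lambda>_. 0" and \<beta> = "\<lambda>_. 0" and X = "real M"]
    unfolding cdiffs_zero by blast
  have "(1 + norm p) ^ M * norm (G k (k + p) p) \<le> C" if p: "p \<in> lat" for p
  proof -
    have "br k * 1 \<le> br k * br p" by (intro mult_left_mono) auto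
    then have "norm (G k (k + p) p) \<le> C * br p powr (- real M)"
      using C(2) k p hlattice_add[OF k p] norm_triangle_ineq[of k p] by simp
    then have "br p ^ M * norm (G k (k + p) p) \<le> br p ^ M * (C * br p powr (- real M))"
      by (intro mult_left_mono) auto
    also have "\<dots> = C" by (simp add: powr_minus powr_realpow)
    finally show ?thesis by (simp add: br_def)
  qed
  then show "\<exists>C. \<forall>p\<in>lat. (1 + norm p) ^ M * norm (G k (k + p) p) \<le> C" by blast
qed

lemma rd_taylor_term:
  assumes G: "G \<in> coeff_class \<mu>\<^sub>1 \<mu>\<^sub>2" and k: "k \<in> lat"
  shows "rd h (\<lambda>p. of_real (pff h \<alpha> p / mfact \<alpha>) * cdiffs h (\<lambda>_. 0) \<alpha> G k k p)"
proof -
  have "rd h (\<lambda>p. of_real (1 / mfact \<alpha>) * (of_real (pff h \<alpha> p) * cdiffs h (\<lambda>_. 0) \<alpha> G k k p))"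
    by (intro rd_cmult rd_pff h rd_cdiffs coeff_class_rd[OF G] k)
  moreover have "(\<lambda>p. of_real (1 / mfact \<alpha>) * (of_real (pff h \<alpha> p) * cdiffs h (\<lambda>_. 0) \<alpha> G k k p))
      = (\<lambda>p. of_real (pff h \<alpha> p / mfact \<alpha>) * cdiffs h (\<lambda>_. 0) \<alpha> G k k p)"
    by (simp add: fun_eq_iff)
  ultimately show ?thesis by (simp only:)
qed

lemma rd_trem:
  assumes "G \<in> coeff_class \<mu>\<^sub>1 \<mu>\<^sub>2" and "k \<in> lat"
  shows "rd h (trem N G k)"
  unfolding trem_eq[abs_def] by (intro rd_diff rd_sum rd_diag[OF assms] rd_taylor_term[OF assms])

text \<open>Each intermediate point \<open>k + q\<close> has \<open>|q| \<le> |p|\<close>, at most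
  half of \<open>br k\<close>, so the weights there are comparable to those at \<open>k\<close> and
  the differences of order \<open>N\<close> gain \<open>\<rho> * N\<close>. The factor
  \<open>norm1 p ^ N\<close> raises the exponent of \<open>br p\<close> from \<open>- M\<close> to
  \<open>N - M\<close>.\<close>

lemma trem_near:
  fixes G :: "real ^ 'n::finite \<Rightarrow> real ^ 'n \<Rightarrow> real ^ 'n \<Rightarrow> complex"
  assumes G: "G \<in> coeff_class \<mu>\<^sub>1 \<mu>\<^sub>2"
  shows "\<exists>C>0. \<forall>k\<in>lat. \<forall>p\<in>lat. 2 * norm p \<le> br k \<longrightarrow>
      norm (trem N G k p) \<le> C * br p powr (real N - real M) * br k powr (\<mu>\<^sub>1 + \<mu>\<^sub>2 - \<rho> * real N + \<delta> * real M)"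
proof -
  define t where "t = \<mu>\<^sub>2 - \<rho> * real N"
  let ?S = "{\<alpha> :: 'n mindex. mabs \<alpha> = N}"
  have finS: "finite ?S" by (rule finite_subset[OF _ finite_mabs_le[of N]]) auto
  have "\<forall>\<alpha>. \<exists>C>0. mabs \<alpha> = N \<longrightarrow> (\<forall>k\<in>lat. \<forall>l\<in>lat. \<forall>p\<in>lat.
        norm (cdiffs h (\<lambda>_. 0) \<alpha> G k l p) \<le> C * br p powr (- real M) * br k powr \<mu>\<^sub>1 * br l powr t
              * (1 + norm k + norm l) powr (\<delta> * real M))"
  proof
    fix \<alpha> :: "'n mindex"
    show "\<exists>C>0. mabs \<alpha> = N \<longrightarrow> (\<forall>k\<in>lat. \<forall>l\<in>lat. \<forall>p\<in>lat.
        norm (cdiffs h (\<lambda>_. 0) \<alpha> G k l p) \<le> C * br p powr (- real M) * br k powr \<mu>\<^sub>1 * br l powr t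
              * (1 + norm k + norm l) powr (\<delta> * real M))"
      \<comment> \<open>For indices of any other order the constant 1 is a default that makes the
        choice function total and positive.\<close>
      using coeff_decay[OF G, of "\<lambda>_. 0" \<alpha> M] by (cases "mabs \<alpha> = N") (auto simp: t_def intro: exI[of _ 1])
  qed
  from choice[OF this] obtain C where C: "\<And>\<alpha>. C \<alpha> > 0" "\<And>\<alpha> k l p. mabs \<alpha> = N \<Longrightarrow> k \<in> lat \<Longrightarrow> l \<in> lat \<Longrightarrow> p \<in> lat \<Longrightarrow>
        norm (cdiffs h (\<lambda>_. 0) \<alpha> G k l p) \<le> C \<alpha> * br p powr (- real M) * br k powr \<mu>\<^sub>1 * br l powr t
              * (1 + norm k + norm l) powr (\<delta> * real M)" by blast
  define D where "D = sum C ?S"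
  have D: "C \<alpha> \<le> D" if "mabs \<alpha> = N" for \<alpha>
    unfolding D_def using that C(1) finS by (intro member_le_sum) (auto intro: less_imp_le)
  have D0: "D \<ge> 0" unfolding D_def using C(1) by (intro sum_nonneg) (auto intro: less_imp_le)
  define K where "K = 2 powr \<bar>t\<bar> * 3 powr (\<delta> * real M)"
  let ?n = "real CARD('n)"
  have "norm (trem N G k p) \<le> (?n ^ N * D * K + 1) * br p powr (real N - real M) * br k powr (\<mu>\<^sub>1 + \<mu>\<^sub>2 - \<rho> * real N + \<delta> * real M)"
    if k: "k \<in> lat" and p: "p \<in> lat" and near: "2 * norm p \<le> br k" for k p
  proof -
    define B where "B = D * K * br p powr (- real M) * br k powr (\<mu>\<^sub>1 + \<mu>\<^sub>2 - \<rho> * real N + \<delta> * real M)"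
    have B0: "0 \<le> B" unfolding B_def K_def using D0 by auto
    have "norm (trem N G k p) \<le> norm1 p ^ N * B"
      unfolding trem_def
    proof (rule taylor_rem_bound[OF h p])
      fix \<alpha> :: "'n mindex" and q :: "real ^ 'n"
      assume \<alpha>: "mabs \<alpha> = N" and q: "q \<in> lat" "q \<in> vbox p"
      have nq: "norm q \<le> norm p" by (rule norm_mono_vbox[OF q(2)])
      have "norm k \<le> norm (k + q) + norm q" "norm (k + q) \<le> norm k + norm q"
        using norm_triangle_ineq4[of "k + q" q] norm_triangle_ineq[of k q] by auto
      then have lo: "br k / 2 \<le> br (k + q)" and hi: "br (k + q) \<le> 2 * br k"
        using near nq by (auto simp: br_def)
      have 2: "br (k + q) powr t \<le> 2 powr \<bar>t\<bar> * br k powr t"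
        by (rule powr_comparable[OF br_pos lo hi])
      have "(1 + norm k + norm (k + q)) powr (\<delta> * real M) \<le> (3 * br k) powr (\<delta> * real M)"
        using hi \<delta> by (intro powr_mono2) (auto simp: br_def)
      then have 3: "(1 + norm k + norm (k + q)) powr (\<delta> * real M) \<le> 3 powr (\<delta> * real M) * br k powr (\<delta> * real M)"
        by (simp add: powr_mult)
      have "norm (fdiffs h \<alpha> (\<lambda>l. G k l p) (k + q)) \<le> C \<alpha> * br p powr (- real M) * br k powr \<mu>\<^sub>1 * br (k + q) powr t
              * (1 + norm k + norm (k + q)) powr (\<delta> * real M)"
        using C(2)[OF \<alpha> k hlattice_add[OF k q(1)] p] by (simp add: cdiffs_zero_left)
      also have "\<dots> \<le> D * br p powr (- real M) * br k powr \<mu>\<^sub>1 * (2 powr \<bar>t\<bar> * br k powr t)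
              * (3 powr (\<delta> * real M) * br k powr (\<delta> * real M))"
        using D0 by (intro mult_mono mult_nonneg_nonneg D 2 3 \<alpha>) auto
      also have "\<dots> = D * K * br p powr (- real M) * (br k powr \<mu>\<^sub>1 * br k powr t * br k powr (\<delta> * real M))"
        unfolding K_def by (simp only: mult_ac)
      also have "\<dots> = B"
        unfolding B_def t_def by (simp add: powr_add[symmetric] algebra_simps)
      finally show "norm (fdiffs h \<alpha> (\<lambda>l. G k l p) (k + q)) \<le> B" .
    qed
    also have "norm1 p \<le> ?n * br p"
      using norm1_le[of p] by (rule order_trans) (auto simp: br_def intro: mult_left_mono)
    then have "norm1 p ^ N * B \<le> (?n * br p) ^ N * B" by (intro mult_right_mono power_mono B0) auto
    also have "\<dots> = ?n ^ N * D * K * (br p powr real N * br p powr (- real M)) * br k powr (\<mu>\<^sub>1 + \<mu>\<^sub>2 - \<rho> * real N + \<delta> * real M)"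
      unfolding B_def by (simp add: power_mult_distrib powr_realpow)
    also have "\<dots> = ?n ^ N * D * K * br p powr (real N - real M) * br k powr (\<mu>\<^sub>1 + \<mu>\<^sub>2 - \<rho> * real N + \<delta> * real M)"
      by (simp add: powr_add[symmetric])
    also have "\<dots> \<le> (?n ^ N * D * K + 1) * br p powr (real N - real M) * br k powr (\<mu>\<^sub>1 + \<mu>\<^sub>2 - \<rho> * real N + \<delta> * real M)"
      by (intro mult_right_mono) auto
    finally show ?thesis .
  qed
  moreover have "?n ^ N * D * K + 1 > 0" using D0 unfolding K_def by (intro add_nonneg_pos mult_nonneg_nonneg) auto
  ultimately show ?thesis by blast
qed

text \<open>No cancellation is used: the diagonal value and each Taylor term are bounded separately.
  The falling factorials have order below \<open>N\<close>, which weakens the decay from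
  \<open>X\<close> to \<open>X - N\<close>.\<close>

lemma trem_far:
  fixes G :: "real ^ 'n::finite \<Rightarrow> real ^ 'n \<Rightarrow> real ^ 'n \<Rightarrow> complex"
  assumes G: "G \<in> coeff_class \<mu>\<^sub>1 \<mu>\<^sub>2"
  shows "\<exists>C>0. \<forall>k\<in>lat. \<forall>p\<in>lat. br k \<le> 2 * br p \<longrightarrow> norm (trem N G k p) \<le> C * br p powr (real N - X)"
proof -
  have "\<forall>\<alpha>. \<exists>C>0. \<forall>k\<in>lat. \<forall>p\<in>lat. br k \<le> 2 * br p \<longrightarrow> mabs \<alpha> < N \<longrightarrow>
      norm (of_real (pff h \<alpha> p / mfact \<alpha>) * cdiffs h (\<lambda>_. 0) \<alpha> G k k p) \<le> C * br p powr (real N - X)"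
  proof
    fix \<alpha> :: "'n mindex"
    obtain C where C: "C > 0" "\<forall>k\<in>lat. \<forall>l\<in>lat. \<forall>p\<in>lat. br k \<le> 2 * br p \<longrightarrow> norm l \<le> norm k + norm p \<longrightarrow>
           norm (cdiffs h (\<lambda>_. 0) \<alpha> G k l p) \<le> C * br p powr (- X)"
      using far_decay[OF G, of 2 "\<lambda>_. 0" \<alpha> X] by auto
    obtain K where K: "K > 0" "\<And>p. \<bar>pff h \<alpha> p\<bar> \<le> K * br p ^ mabs \<alpha>" using pff_bound[OF h, of \<alpha>] unfolding br_def by blast
    have "norm (of_real (pff h \<alpha> p / mfact \<alpha>) * cdiffs h (\<lambda>_. 0) \<alpha> G k k p) \<le> (K * C) * br p powr (real N - X)"
      if "k \<in> lat" "p \<in> lat" "br k \<le> 2 * br p" "mabs \<alpha> < N" for k p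
    proof -
      have "real (mfact \<alpha>) \<ge> 1" using mfact_pos[of \<alpha>] by linarith
      then have "\<bar>pff h \<alpha> p\<bar> / mfact \<alpha> \<le> \<bar>pff h \<alpha> p\<bar> / 1" by (intro divide_left_mono) auto
      also have "\<dots> \<le> K * br p powr real (mabs \<alpha>)" using K(2) by (simp add: powr_realpow)
      also have "\<dots> \<le> K * br p powr real N" using K(1) that(4) by (intro mult_left_mono powr_mono) auto
      finally have 1: "norm (complex_of_real (pff h \<alpha> p / mfact \<alpha>)) \<le> K * br p powr real N" by (simp add: norm_divide)
      have 2: "norm (cdiffs h (\<lambda>_. 0) \<alpha> G k k p) \<le> C * br p powr (- X)" using C(2) that by simp
      have "norm (of_real (pff h \<alpha> p / mfact \<alpha>) * cdiffs h (\<lambda>_. 0) \<alpha> G k k p) \<le> (K * br p powr real N) * (C * br p powr (- X))"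
        unfolding norm_mult using K(1) by (intro mult_mono 1 2) auto
      also have "\<dots> = (K * C) * (br p powr real N * br p powr (- X))" by (simp only: mult_ac)
      finally show ?thesis by (simp add: powr_add[symmetric])
    qed
    then show "\<exists>C>0. \<forall>k\<in>lat. \<forall>p\<in>lat. br k \<le> 2 * br p \<longrightarrow> mabs \<alpha> < N \<longrightarrow>
      norm (of_real (pff h \<alpha> p / mfact \<alpha>) * cdiffs h (\<lambda>_. 0) \<alpha> G k k p) \<le> C * br p powr (real N - X)"
      using K(1) C(1) by (intro exI[of _ "K * C"]) auto
  qed
  from choice[OF this] obtain C where C: "\<And>\<alpha>. C \<alpha> > 0" "\<And>\<alpha> k p. k \<in> lat \<Longrightarrow> p \<in> lat \<Longrightarrow> br k \<le> 2 * br p \<Longrightarrow> mabs \<alpha> < N \<Longrightarrow>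
      norm (of_real (pff h \<alpha> p / mfact \<alpha>) * cdiffs h (\<lambda>_. 0) \<alpha> G k k p) \<le> C \<alpha> * br p powr (real N - X)" by blast
  obtain C0 where C0: "C0 > 0" "\<forall>k\<in>lat. \<forall>l\<in>lat. \<forall>p\<in>lat. br k \<le> 2 * br p \<longrightarrow> norm l \<le> norm k + norm p \<longrightarrow>
           norm (G k l p) \<le> C0 * br p powr (- X)"
    using far_decay[OF G, of 2 "\<lambda>_. 0" "\<lambda>_. 0" X] by (auto simp: cdiffs_zero)
  let ?C = "C0 + (\<Sum>\<alpha> | mabs \<alpha> < N. C \<alpha>)"
  have "norm (trem N G k p) \<le> ?C * br p powr (real N - X)" if kp: "k \<in> lat" "p \<in> lat" "br k \<le> 2 * br p" for k p
  proof -
    have "norm (G k (k + p) p) \<le> C0 * br p powr (- X)"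
      using C0(2) kp hlattice_add[OF kp(1,2)] norm_triangle_ineq[of k p] by simp
    also have "\<dots> \<le> C0 * br p powr (real N - X)" using C0(1) by (intro mult_left_mono powr_mono) auto
    finally have 1: "norm (G k (k + p) p) \<le> C0 * br p powr (real N - X)" .
    have 2: "norm (\<Sum>\<alpha> | mabs \<alpha> < N. of_real (pff h \<alpha> p / mfact \<alpha>) * cdiffs h (\<lambda>_. 0) \<alpha> G k k p)
       \<le> (\<Sum>\<alpha> | mabs \<alpha> < N. C \<alpha> * br p powr (real N - X))"
      by (rule sum_norm_le) (use C(2) kp in blast)
    have "norm (trem N G k p) \<le> C0 * br p powr (real N - X) + (\<Sum>\<alpha> | mabs \<alpha> < N. C \<alpha> * br p powr (real N - X))"
      unfolding trem_eq by (rule order_trans[OF norm_triangle_ineq4 add_mono[OF 1 2]])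
    then show ?thesis by (simp only: distrib_right sum_distrib_right)
  qed
  moreover have "?C > 0" using C0(1) C(1) by (intro add_pos_nonneg sum_nonneg) (auto intro: less_imp_le)
  ultimately show ?thesis by blast
qed

lemma trem_weighted:
  fixes G :: "real ^ 'n::finite \<Rightarrow> real ^ 'n \<Rightarrow> real ^ 'n \<Rightarrow> complex"
  assumes G: "G \<in> coeff_class \<mu>\<^sub>1 \<mu>\<^sub>2"
  shows "\<exists>C>0. \<forall>k\<in>lat. \<forall>p\<in>lat. norm (of_real (pff h \<beta> p) * trem N G k p) \<le>
      C * wt p * br k powr (\<mu>\<^sub>1 + \<mu>\<^sub>2 - \<rho> * real N + \<delta> * (real N + real (mabs \<beta>) + 2 * real CARD('n)))"
proof -
  define m where "m = mabs \<beta>"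
  \<comment> \<open>\<open>N\<close> powers pay for the Taylor factor, \<open>m\<close> for the
    multiplier \<open>pff h \<beta>\<close>, and twice the dimension for
    \<open>wt p\<close>.\<close>
  define M where "M = N + m + 2 * CARD('n)"
  define t where "t = \<mu>\<^sub>1 + \<mu>\<^sub>2 - \<rho> * real N + \<delta> * real M"
  \<comment> \<open>In the far region the surplus \<open>\<bar>t\<bar>\<close> is traded for
    \<open>br k powr t\<close>, whatever the sign of \<open>t\<close>.\<close>
  define X where "X = real M + \<bar>t\<bar>"
  obtain K where K: "K > 0" "\<And>p. \<bar>pff h \<beta> p\<bar> \<le> K * br p ^ m" using pff_bound[OF h, of \<beta>] unfolding br_def m_def by blast
  obtain C1 where C1: "C1 > 0" "\<And>k p. k \<in> lat \<Longrightarrow> p \<in> lat \<Longrightarrow> 2 * norm p \<le> br k \<Longrightarrow>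
      norm (trem N G k p) \<le> C1 * br p powr (real N - real M) * br k powr t"
    using trem_near[OF G, of N M] unfolding t_def by blast
  obtain C2 where C2: "C2 > 0" "\<And>k p. k \<in> lat \<Longrightarrow> p \<in> lat \<Longrightarrow> br k \<le> 2 * br p \<Longrightarrow>
      norm (trem N G k p) \<le> C2 * br p powr (real N - X)"
    using trem_far[OF G, of N X] by blast
  define C where "C = C1 + C2 * 2 powr \<bar>t\<bar>"
  have "C > 0" unfolding C_def using C1(1) C2(1) by (intro add_pos_pos mult_pos_pos) auto
  have main: "norm (trem N G k p) \<le> C * br p powr (real N - real M) * br k powr t" if kp: "k \<in> lat" "p \<in> lat" for k p
  proof (cases "2 * norm p \<le> br k")
    case True
    have "C1 \<le> C" unfolding C_def using C2(1) by simp
    then show ?thesis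
      by (intro order_trans[OF C1(2)[OF kp True]] mult_right_mono) auto
  next
    case False
    then have far: "br k \<le> 2 * br p" by (simp add: br_def)
    have "norm (trem N G k p) \<le> C2 * br p powr (real N - X)" by (rule C2(2)[OF kp far])
    also have "\<dots> = C2 * br p powr (real N - real M) * br p powr (- \<bar>t\<bar>)"
      by (simp add: X_def mult.assoc powr_add[symmetric] diff_diff_eq)
    also have "br p powr (- \<bar>t\<bar>) \<le> (br k / 2) powr (- \<bar>t\<bar>)"
      using far by (intro powr_mono2') auto
    also have "\<dots> = 2 powr \<bar>t\<bar> * br k powr (- \<bar>t\<bar>)"
      by (simp add: powr_divide powr_minus_divide)
    also have "\<dots> \<le> 2 powr \<bar>t\<bar> * br k powr t" by (intro mult_left_mono powr_mono) auto
    also have "C2 * br p powr (real N - real M) * (2 powr \<bar>t\<bar> * br k powr t)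
        = (C2 * 2 powr \<bar>t\<bar>) * (br p powr (real N - real M) * br k powr t)" by (simp only: mult_ac)
    also have "\<dots> \<le> C * (br p powr (real N - real M) * br k powr t)"
      unfolding C_def using C1(1) by (intro mult_right_mono) auto
    finally show ?thesis using C2(1) by (simp add: mult.assoc mult_left_mono)
  qed
  have "norm (of_real (pff h \<beta> p) * trem N G k p) \<le> (K * C) * wt p * br k powr t" if kp: "k \<in> lat" "p \<in> lat" for k p
  proof -
    have "norm (of_real (pff h \<beta> p) * trem N G k p) \<le> (K * br p powr real m) * (C * br p powr (real N - real M) * br k powr t)"
      unfolding norm_mult using K by (intro mult_mono main kp) (auto simp: powr_realpow)
    also have "\<dots> = (K * C) * (br p powr real m * br p powr (real N - real M)) * br k powr t" by (simp only: mult_ac)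
    also have "br p powr real m * br p powr (real N - real M) = wt p"
      unfolding wt_powr powr_add[symmetric] by (simp add: M_def)
    finally show ?thesis .
  qed
  moreover have "t = \<mu>\<^sub>1 + \<mu>\<^sub>2 - \<rho> * real N + \<delta> * (real N + real (mabs \<beta>) + 2 * real CARD('n))"
    by (simp add: t_def M_def m_def)
  ultimately show ?thesis using K(1) \<open>C > 0\<close> by (intro exI[of _ "K * C"]) auto
qed

end


subsection \<open>Products of falling factorials\<close>

text \<open>\<open>torD\<close> composed with \<open>torD\<close> multiplies coefficients by a product of falling factorials;
  only falling factorials themselves are controlled by the class, so products are expanded in them.\<close>

inductive_set ffspan :: "real \<Rightarrow> nat \<Rightarrow> (real ^ 'n::finite \<Rightarrow> real) set" for h s where
  pff: "mabs \<nu> \<le> s \<Longrightarrow> pff h \<nu> \<in> ffspan h s"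
| add: "\<phi> \<in> ffspan h s \<Longrightarrow> \<psi> \<in> ffspan h s \<Longrightarrow> (\<lambda>p. \<phi> p + \<psi> p) \<in> ffspan h s"
| cmult: "\<phi> \<in> ffspan h s \<Longrightarrow> (\<lambda>p. c * \<phi> p) \<in> ffspan h s"

text \<open>\<open>p $ j - c\<close> is \<open>p $ j - h * \<nu> j\<close> plus a constant: the
  first part raises \<open>pff h \<nu>\<close> to \<open>pff h (inc j \<nu>)\<close>, the second
  leaves it as it is.\<close>

lemma ffspan_mult_linear:
  assumes "\<phi> \<in> ffspan h s"
  shows "(\<lambda>p. \<phi> p * (p $ j - c)) \<in> ffspan h (Suc s)"
  using assms
proof (induction rule: ffspan.induct)
  case (pff \<nu>)
  have "(\<lambda>p. pff h (inc j \<nu>) p + (h * real (\<nu> j) - c) * pff h \<nu> p) \<in> ffspan h (Suc s)"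
    using pff by (intro ffspan.intros) auto
  then show ?case by (simp add: pff_inc algebra_simps)
next
  case (add \<phi> \<psi>)
  then show ?case using ffspan.add[OF add.IH] by (simp add: distrib_right)
next
  case (cmult \<phi> c)
  then show ?case using ffspan.cmult[OF cmult.IH, of c] by (simp add: mult.assoc)
qed

lemma pff_mult_ffspan: "(\<lambda>p. pff h \<beta> p * pff h \<alpha> p) \<in> ffspan h (mabs \<alpha> + mabs \<beta>)"
proof (induction \<alpha> rule: mindex_induct)
  case zero
  then show ?case using ffspan.pff[of \<beta> "mabs \<beta>" h] by simp
next
  case (inc j \<alpha>)
  from ffspan_mult_linear[OF this, of j "h * real (\<alpha> j)"] show ?case
    by (simp add: pff_inc mult.assoc)
qed

lemma rd_ffspan:
  assumes h: "h > 0" and c: "rd h c" and "\<phi> \<in> ffspan h s"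
  shows "rd h (\<lambda>p. of_real (\<phi> p) * c p)"
  using assms(3)
proof (induction rule: ffspan.induct)
  case (pff \<nu>)
  show ?case by (rule rd_pff[OF h c])
next
  case (add \<phi> \<psi>)
  then show ?case using rd_add[OF add.IH] by (simp add: distrib_right)
next
  case (cmult \<phi> c)
  then show ?case using rd_cmult[OF cmult.IH, of "of_real c"] by (simp add: mult.assoc)
qed

subsection \<open>Differences of the Taylor remainder\<close>

text \<open>Discrete product rule: moving both slots at once produces, besides the two single
  differences, a mixed second difference with weight \<open>h\<close>.\<close>

lemma fdiff_diagonal:
  assumes "h > 0"
  shows "fdiff h j (\<lambda>k. H k k) k = fdiff h j (\<lambda>k'. H k' k) k + fdiff h j (H k) k
     + of_real h * fdiff h j (\<lambda>k'. fdiff h j (H k') k) k"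
  using assms by (simp add: fdiff_def field_simps)

text \<open>The coefficients \<open>pff h \<alpha> p / mfact \<alpha>\<close> depend on the
  increment alone, so a difference in the base point passes through to \<open>f\<close>.\<close>

lemma fdiff_taylor_rem_base:
  "fdiff h j (\<lambda>l. taylor_rem h N f l p) l = taylor_rem h N (fdiff h j f) l p"
proof -
  have "fdiff h j (\<lambda>l. f (l + p)) l = fdiff h j f (l + p)" by (simp add: fdiff_def add_ac)
  then show ?thesis
    unfolding taylor_rem_def fdiff_diff fdiff_sum fdiff_cmult fdiffs_inc[symmetric] fdiffs_fdiff by simp
qed

lemma fdiff_taylor_rem_param:
  "fdiff h j (\<lambda>k. taylor_rem h N (H k) l p) k = taylor_rem h N (\<lambda>l. fdiff h j (\<lambda>k. H k l) k) l p"
  unfolding taylor_rem_def fdiff_diff fdiff_sum fdiff_cmult fdiff_fdiffs_swap ..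

context amplitude_params
begin

definition Dl where "Dl j G = (\<lambda>k l p. fdiff h j (\<lambda>l'. G k l' p) l)"
definition Dk where "Dk j G = (\<lambda>k l p. fdiff h j (\<lambda>k'. G k' l p) k)"

text \<open>As \<open>p\<close> stays fixed while \<open>k\<close> moves, the diagonal rule applies
  to \<open>k\<close> as parameter and as base point of the expansion. The order \<open>N\<close> is
  kept, and the three coefficient functions lose \<rho>, \<rho> and 2\<rho> in total order.\<close>

lemma fdiff_trem:
  "fdiff h j (\<lambda>k. trem N G k p) k
     = trem N (Dk j G) k p + trem N (Dl j G) k p + of_real h * trem N (Dk j (Dl j G)) k p"
  unfolding trem_def Dk_def Dl_def
  by (subst fdiff_diagonal[OF h, of j "\<lambda>k l. taylor_rem h N (\<lambda>l. G k l p) l p"])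
     (simp add: fdiff_taylor_rem_base fdiff_taylor_rem_param)

text \<open>Taylor terms live on \<open>l = k\<close>, where the joint weight is at most
  \<open>2 * br k\<close>. The estimate concerns functions of \<theta> throughout and is never
  summed over frequencies, so nothing is lost.\<close>

lemma ffspan_bound:
  fixes G :: "real ^ 'n::finite \<Rightarrow> real ^ 'n \<Rightarrow> real ^ 'n \<Rightarrow> complex"
  assumes G: "G \<in> coeff_class \<mu>\<^sub>1 \<mu>\<^sub>2" and \<phi>: "\<phi> \<in> ffspan h s"
  shows "\<exists>C>0. \<forall>k\<in>lat. \<forall>\<theta>. norm (fser h (\<lambda>p. of_real (\<phi> p) * cdiffs h (\<lambda>_. 0) \<alpha> G k k p) \<theta>)
     \<le> C * br k powr (\<mu>\<^sub>1 + \<mu>\<^sub>2 - \<rho> * real (mabs \<alpha>) + \<delta> * real s)"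
  using \<phi>
proof (induction rule: ffspan.induct)
  case (pff \<nu>)
  obtain C where C: "C > 0" "\<And>k l \<theta>. k \<in> lat \<Longrightarrow> l \<in> lat \<Longrightarrow>
        norm (fser h (\<lambda>p. of_real (pff h \<nu> p) * cdiffs h (\<lambda>_. 0) \<alpha> G k l p) \<theta>)
          \<le> C * br k powr \<mu>\<^sub>1 * br l powr (\<mu>\<^sub>2 - \<rho> * real (mabs \<alpha>))
              * (1 + norm k + norm l) powr (\<delta> * real (mabs \<nu>))"
    using coeff_class_bound[OF G, of \<nu> "\<lambda>_. 0" \<alpha>] by auto
  let ?K = "2 powr (\<delta> * real s)"
  have "norm (fser h (\<lambda>p. of_real (pff h \<nu> p) * cdiffs h (\<lambda>_. 0) \<alpha> G k k p) \<theta>)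
     \<le> (C * ?K) * br k powr (\<mu>\<^sub>1 + \<mu>\<^sub>2 - \<rho> * real (mabs \<alpha>) + \<delta> * real s)" if k: "k \<in> lat" for k \<theta>
  proof -
    have "(1 + norm k + norm k) powr (\<delta> * real (mabs \<nu>)) \<le> (1 + norm k + norm k) powr (\<delta> * real s)"
      using pff \<delta> by (intro powr_mono mult_left_mono) auto
    also have "\<dots> \<le> (2 * br k) powr (\<delta> * real s)" using \<delta> by (intro powr_mono2) (auto simp: br_def)
    also have "\<dots> = ?K * br k powr (\<delta> * real s)" by (simp add: powr_mult)
    finally have 1: "(1 + norm k + norm k) powr (\<delta> * real (mabs \<nu>)) \<le> ?K * br k powr (\<delta> * real s)" .
    have "norm (fser h (\<lambda>p. of_real (pff h \<nu> p) * cdiffs h (\<lambda>_. 0) \<alpha> G k k p) \<theta>)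
        \<le> C * br k powr \<mu>\<^sub>1 * br k powr (\<mu>\<^sub>2 - \<rho> * real (mabs \<alpha>)) * (1 + norm k + norm k) powr (\<delta> * real (mabs \<nu>))"
      by (rule C(2)[OF k k])
    also have "\<dots> \<le> C * br k powr \<mu>\<^sub>1 * br k powr (\<mu>\<^sub>2 - \<rho> * real (mabs \<alpha>)) * (?K * br k powr (\<delta> * real s))"
      using C(1) by (intro mult_left_mono 1) auto
    also have "\<dots> = (C * ?K) * (br k powr \<mu>\<^sub>1 * br k powr (\<mu>\<^sub>2 - \<rho> * real (mabs \<alpha>)) * br k powr (\<delta> * real s))"
      by (simp only: mult_ac)
    also have "br k powr \<mu>\<^sub>1 * br k powr (\<mu>\<^sub>2 - \<rho> * real (mabs \<alpha>)) * br k powr (\<delta> * real s)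
        = br k powr (\<mu>\<^sub>1 + \<mu>\<^sub>2 - \<rho> * real (mabs \<alpha>) + \<delta> * real s)"
      by (simp add: powr_add[symmetric] add_diff_eq)
    finally show ?thesis .
  qed
  then show ?case using C(1) by (intro exI[of _ "C * ?K"]) auto
next
  case (add \<phi> \<psi>)
  let ?t = "\<mu>\<^sub>1 + \<mu>\<^sub>2 - \<rho> * real (mabs \<alpha>) + \<delta> * real s"
  obtain C where C: "C > 0" "\<And>k \<theta>. k \<in> lat \<Longrightarrow> norm (fser h (\<lambda>p. of_real (\<phi> p) * cdiffs h (\<lambda>_. 0) \<alpha> G k k p) \<theta>) \<le> C * br k powr ?t"
    using add.IH(1) by blast
  obtain D where D: "D > 0" "\<And>k \<theta>. k \<in> lat \<Longrightarrow> norm (fser h (\<lambda>p. of_real (\<psi> p) * cdiffs h (\<lambda>_. 0) \<alpha> G k k p) \<theta>) \<le> D * br k powr ?t"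
    using add.IH(2) by blast
  have "norm (fser h (\<lambda>p. of_real (\<phi> p + \<psi> p) * cdiffs h (\<lambda>_. 0) \<alpha> G k k p) \<theta>) \<le> (C + D) * br k powr ?t" if k: "k \<in> lat" for k \<theta>
  proof -
    have r: "rd h (cdiffs h (\<lambda>_. 0) \<alpha> G k k)" using k by (intro rd_cdiffs h coeff_class_rd[OF G])
    have "fser h (\<lambda>p. of_real (\<phi> p + \<psi> p) * cdiffs h (\<lambda>_. 0) \<alpha> G k k p) \<theta>
        = fser h (\<lambda>p. of_real (\<phi> p) * cdiffs h (\<lambda>_. 0) \<alpha> G k k p) \<theta> + fser h (\<lambda>p. of_real (\<psi> p) * cdiffs h (\<lambda>_. 0) \<alpha> G k k p) \<theta>"
      unfolding of_real_add distrib_right by (intro fser_add rd_summable[OF h] rd_ffspan[OF h r add.hyps(1)] rd_ffspan[OF h r add.hyps(2)])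
    then show ?thesis
      using norm_triangle_mono[OF C(2)[OF k] D(2)[OF k]] by (simp add: distrib_right)
  qed
  then show ?case using C(1) D(1) by (intro exI[of _ "C + D"]) auto
next
  case (cmult \<phi> c)
  let ?t = "\<mu>\<^sub>1 + \<mu>\<^sub>2 - \<rho> * real (mabs \<alpha>) + \<delta> * real s"
  obtain C where C: "C > 0" "\<And>k \<theta>. k \<in> lat \<Longrightarrow> norm (fser h (\<lambda>p. of_real (\<phi> p) * cdiffs h (\<lambda>_. 0) \<alpha> G k k p) \<theta>) \<le> C * br k powr ?t"
    using cmult.IH by blast
  \<comment> \<open>\<open>c\<close> may be 0; the summand 1 keeps the constant positive.\<close>
  have "norm (fser h (\<lambda>p. of_real (c * \<phi> p) * cdiffs h (\<lambda>_. 0) \<alpha> G k k p) \<theta>) \<le> (\<bar>c\<bar> * C + 1) * br k powr ?t" if k: "k \<in> lat" for k \<theta>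
  proof -
    have "norm (fser h (\<lambda>p. of_real (c * \<phi> p) * cdiffs h (\<lambda>_. 0) \<alpha> G k k p) \<theta>) = \<bar>c\<bar> * norm (fser h (\<lambda>p. of_real (\<phi> p) * cdiffs h (\<lambda>_. 0) \<alpha> G k k p) \<theta>)"
      unfolding of_real_mult mult.assoc fser_cmult by (simp add: norm_mult)
    also have "\<dots> \<le> \<bar>c\<bar> * (C * br k powr ?t)" by (intro mult_left_mono C(2) k) auto
    also have "\<dots> \<le> (\<bar>c\<bar> * C + 1) * br k powr ?t" by (simp add: algebra_simps)
    finally show ?thesis .
  qed
  moreover have "\<bar>c\<bar> * C + 1 > 0" using C(1) by (intro add_nonneg_pos) auto
  ultimately show ?case by blast
qed

section \<open>Raising the order of the expansion\<close>

lemma trem_split: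
  assumes "N \<le> N'"
  shows "trem N G k p = trem N' G k p
    + (\<Sum>\<alpha> | N \<le> mabs \<alpha> \<and> mabs \<alpha> < N'. of_real (pff h \<alpha> p / mfact \<alpha>) * cdiffs h (\<lambda>_. 0) \<alpha> G k k p)"
proof -
  have "{\<alpha> :: 'a mindex. mabs \<alpha> < N'} = {\<alpha>. mabs \<alpha> < N} \<union> {\<alpha>. N \<le> mabs \<alpha> \<and> mabs \<alpha> < N'}" using assms by auto
  then show ?thesis
    unfolding trem_eq
    by (simp only:, subst sum.union_disjoint)
       (auto intro: finite_subset[OF _ finite_mabs_less[of N']] finite_mabs_less)
qed

text \<open>The product of multipliers has order \<open>mabs \<alpha> + mabs \<beta>\<close>. The
  cost of \<open>pff h \<alpha>\<close>, \<delta> per order, is set against the gain \<rho> per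
  order of the difference, so each order of \<alpha> improves the bound by \<rho> -
  \<delta>.\<close>

lemma taylor_term_bound:
  fixes G :: "real ^ 'n::finite \<Rightarrow> real ^ 'n \<Rightarrow> real ^ 'n \<Rightarrow> complex"
  assumes G: "G \<in> coeff_class \<mu>\<^sub>1 \<mu>\<^sub>2"
  shows "\<exists>C>0. \<forall>k\<in>lat. \<forall>\<theta>. norm (fser h (\<lambda>p. of_real (pff h \<beta> p) * (of_real (pff h \<alpha> p / mfact \<alpha>) * cdiffs h (\<lambda>_. 0) \<alpha> G k k p)) \<theta>)
     \<le> C * br k powr (\<mu>\<^sub>1 + \<mu>\<^sub>2 - real (mabs \<alpha>) * (\<rho> - \<delta>) + \<delta> * real (mabs \<beta>))"
proof -
  have "(\<lambda>p. 1 / mfact \<alpha> * (pff h \<beta> p * pff h \<alpha> p)) \<in> ffspan h (mabs \<alpha> + mabs \<beta>)"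
    by (intro ffspan.cmult pff_mult_ffspan)
  from ffspan_bound[OF G this, of \<alpha>]
  show ?thesis by (simp add: algebra_simps)
qed

lemma trem_fser_bound:
  fixes G :: "real ^ 'n::finite \<Rightarrow> real ^ 'n \<Rightarrow> real ^ 'n \<Rightarrow> complex"
  assumes G: "G \<in> coeff_class \<mu>\<^sub>1 \<mu>\<^sub>2"
  shows "\<exists>C>0. \<forall>k\<in>lat. \<forall>\<theta>. norm (fser h (\<lambda>p. of_real (pff h \<beta> p) * trem N G k p) \<theta>)
     \<le> C * br k powr (\<mu>\<^sub>1 + \<mu>\<^sub>2 - real N * (\<rho> - \<delta>) + \<delta> * real (mabs \<beta>))"
proof -
  let ?n = "real CARD('n)"
  define t where "t = \<mu>\<^sub>1 + \<mu>\<^sub>2 - real N * (\<rho> - \<delta>) + \<delta> * real (mabs \<beta>)"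
  \<comment> \<open>The order at which the gain \<open>(N' - N) (\<rho> - \<delta>)\<close> outweighs the loss in \<open>trem_weighted\<close>.\<close>
  define N' where "N' = N + nat \<lceil>2 * ?n * \<delta> / (\<rho> - \<delta>)\<rceil>"
  have "2 * ?n * \<delta> / (\<rho> - \<delta>) \<le> real N' - real N" unfolding N'_def by linarith
  then have N': "2 * ?n * \<delta> \<le> (real N' - real N) * (\<rho> - \<delta>)" using \<delta> by (simp add: pos_divide_le_eq)
  have NN': "N \<le> N'" by (simp add: N'_def)
  define S where "S = {\<alpha> :: 'n mindex. N \<le> mabs \<alpha> \<and> mabs \<alpha> < N'}"
  let ?T = "\<lambda>\<alpha> k p. of_real (pff h \<beta> p) * (of_real (pff h \<alpha> p / mfact \<alpha>) * cdiffs h (\<lambda>_. 0) \<alpha> G k k p)"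
  obtain C where C: "C > 0" "\<And>k p. k \<in> lat \<Longrightarrow> p \<in> lat \<Longrightarrow> norm (of_real (pff h \<beta> p) * trem N' G k p) \<le>
      C * wt p * br k powr (\<mu>\<^sub>1 + \<mu>\<^sub>2 - \<rho> * real N' + \<delta> * (real N' + real (mabs \<beta>) + 2 * ?n))"
    using trem_weighted[OF G, of \<beta> N'] by blast
  define W where "W = (\<Sum>\<^sub>\<infinity>p\<in>(lat :: (real ^ 'n) set). wt p)"
  have W: "W \<ge> 0" unfolding W_def by (intro infsum_nonneg wt_nonneg)
  have main: "norm (fser h (\<lambda>p. of_real (pff h \<beta> p) * trem N' G k p) \<theta>) \<le> C * W * br k powr t" if k: "k \<in> lat" for k \<theta>
  proof -
    have r: "rd h (\<lambda>p. of_real (pff h \<beta> p) * trem N' G k p)" by (intro rd_pff h rd_trem[OF G k])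
    have le: "norm (of_real (pff h \<beta> p) * trem N' G k p) \<le> (C * br k powr t) * wt p" if p: "p \<in> lat" for p
    proof -
      \<comment> \<open>The exponent on the left is \<open>t\<close> with \<open>N'\<close> in place
        of \<open>N\<close>, raised by \<open>2 * ?n * \<delta>\<close>; the choice of
        \<open>N'\<close> absorbs this increase.\<close>
      have "C * wt p * br k powr (\<mu>\<^sub>1 + \<mu>\<^sub>2 - \<rho> * real N' + \<delta> * (real N' + real (mabs \<beta>) + 2 * ?n)) \<le> C * wt p * br k powr t"
        using C(1) N' by (intro mult_left_mono powr_mono mult_nonneg_nonneg wt_nonneg) (auto simp: t_def algebra_simps)
      then show ?thesis using C(2)[OF k p] by (simp add: mult_ac)
    qed
    have "norm (fser h (\<lambda>p. of_real (pff h \<beta> p) * trem N' G k p) \<theta>) \<le> (\<Sum>\<^sub>\<infinity>p\<in>lat. norm (of_real (pff h \<beta> p) * trem N' G k p))"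
      by (rule fser_norm_le[OF rd_summable[OF h r]])
    also have "\<dots> \<le> (\<Sum>\<^sub>\<infinity>p\<in>(lat :: (real ^ 'n) set). (C * br k powr t) * wt p)"
    proof (rule infsum_mono[OF rd_summable[OF h r]])
      show "(\<lambda>p. (C * br k powr t) * wt p) summable_on (lat :: (real ^ 'n) set)"
        by (rule summable_on_cmult_right[OF wt_summable[OF h]])
    qed (rule le)
    also have "\<dots> = C * W * br k powr t" by (simp add: infsum_cmult_right' W_def)
    finally show ?thesis .
  qed
  have "\<forall>\<alpha>. \<exists>D>0. \<alpha> \<in> S \<longrightarrow> (\<forall>k\<in>lat. \<forall>\<theta>. norm (fser h (?T \<alpha> k) \<theta>) \<le> D * br k powr t)"
  proof
    fix \<alpha> :: "'n mindex"
    obtain D where D: "D > 0" "\<And>k \<theta>. k \<in> lat \<Longrightarrow> norm (fser h (?T \<alpha> k) \<theta>) \<le> D * br k powr (\<mu>\<^sub>1 + \<mu>\<^sub>2 - real (mabs \<alpha>) * (\<rho> - \<delta>) + \<delta> * real (mabs \<beta>))"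
      using taylor_term_bound[OF G, of \<beta> \<alpha>] by blast
    have "norm (fser h (?T \<alpha> k) \<theta>) \<le> D * br k powr t" if "\<alpha> \<in> S" "k \<in> lat" for k \<theta>
    proof -
      have "real N * (\<rho> - \<delta>) \<le> real (mabs \<alpha>) * (\<rho> - \<delta>)" using that(1) \<delta> by (intro mult_right_mono) (auto simp: S_def)
      then have "D * br k powr (\<mu>\<^sub>1 + \<mu>\<^sub>2 - real (mabs \<alpha>) * (\<rho> - \<delta>) + \<delta> * real (mabs \<beta>)) \<le> D * br k powr t"
        using D(1) by (intro mult_left_mono powr_mono) (auto simp: t_def)
      then show ?thesis using D(2)[OF that(2)] by (rule order_trans[rotated])
    qed
    with D(1) show "\<exists>D>0. \<alpha> \<in> S \<longrightarrow> (\<forall>k\<in>lat. \<forall>\<theta>. norm (fser h (?T \<alpha> k) \<theta>) \<le> D * br k powr t)" by blast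
  qed
  from choice[OF this] obtain D where D: "\<And>\<alpha>. D \<alpha> > 0" "\<And>\<alpha> k \<theta>. \<alpha> \<in> S \<Longrightarrow> k \<in> lat \<Longrightarrow> norm (fser h (?T \<alpha> k) \<theta>) \<le> D \<alpha> * br k powr t" by blast
  have "norm (fser h (\<lambda>p. of_real (pff h \<beta> p) * trem N G k p) \<theta>) \<le> (C * W + sum D S + 1) * br k powr t" if k: "k \<in> lat" for k \<theta>
  proof -
    have rT: "rd h (?T \<alpha> k)" for \<alpha> by (intro rd_pff h rd_taylor_term[OF G k])
    have r: "rd h (\<lambda>p. of_real (pff h \<beta> p) * trem N' G k p)" by (intro rd_pff h rd_trem[OF G k])
    have "fser h (\<lambda>p. of_real (pff h \<beta> p) * trem N G k p) \<theta>
        = fser h (\<lambda>p. of_real (pff h \<beta> p) * trem N' G k p + (\<Sum>\<alpha>\<in>S. ?T \<alpha> k p)) \<theta>"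
      unfolding trem_split[OF NN'] by (simp only: distrib_left sum_distrib_left S_def)
    also have "\<dots> = fser h (\<lambda>p. of_real (pff h \<beta> p) * trem N' G k p) \<theta> + (\<Sum>\<alpha>\<in>S. fser h (?T \<alpha> k) \<theta>)"
      by (subst fser_add[OF rd_summable[OF h r] rd_summable[OF h rd_sum[OF rT]]]) (simp only: fser_sum[OF rT h])
    finally have "norm (fser h (\<lambda>p. of_real (pff h \<beta> p) * trem N G k p) \<theta>) \<le> C * W * br k powr t + (\<Sum>\<alpha>\<in>S. D \<alpha> * br k powr t)"
      using norm_triangle_mono[OF main[OF k] sum_norm_le[OF D(2)[OF _ k]]] by simp
    also have "\<dots> \<le> (C * W + sum D S + 1) * br k powr t" by (simp add: distrib_right sum_distrib_right)
    finally show ?thesis .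
  qed
  moreover have "C * W + sum D S + 1 > 0"
    using C(1) W D(1) by (intro add_nonneg_pos add_nonneg_nonneg sum_nonneg) (auto intro: less_imp_le)
  ultimately show ?thesis unfolding t_def by blast
qed

lemma coeff_class_Dk: "G \<in> coeff_class \<mu>\<^sub>1 \<mu>\<^sub>2 \<Longrightarrow> Dk j G \<in> coeff_class (\<mu>\<^sub>1 - \<rho>) \<mu>\<^sub>2"
  unfolding Dk_def by (rule coeff_class_fdiff_left)

lemma coeff_class_Dl: "G \<in> coeff_class \<mu>\<^sub>1 \<mu>\<^sub>2 \<Longrightarrow> Dl j G \<in> coeff_class \<mu>\<^sub>1 (\<mu>\<^sub>2 - \<rho>)"
  unfolding Dl_def by (rule coeff_class_fdiff_right)

text \<open>Generalizing over \<open>G\<close> and both orders lets the induction hypothesis apply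
  to the three differenced coefficient functions given by \<open>fdiff_trem\<close>.\<close>

lemma trem_symbol_bound:
  fixes G :: "real ^ 'n::finite \<Rightarrow> real ^ 'n \<Rightarrow> real ^ 'n \<Rightarrow> complex"
  assumes "G \<in> coeff_class \<mu>\<^sub>1 \<mu>\<^sub>2"
  shows "\<exists>C>0. \<forall>k\<in>lat. \<forall>\<theta>. norm (fser h (\<lambda>p. of_real (pff h \<beta> p) * fdiffs h \<alpha> (\<lambda>k. trem N G k p) k) \<theta>)
     \<le> C * br k powr (\<mu>\<^sub>1 + \<mu>\<^sub>2 - real N * (\<rho> - \<delta>) - \<rho> * real (mabs \<alpha>) + \<delta> * real (mabs \<beta>))"
  using assms
proof (induction \<alpha> arbitrary: G \<mu>\<^sub>1 \<mu>\<^sub>2 rule: mindex_induct)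
  case zero
  then show ?case using trem_fser_bound[of G \<mu>\<^sub>1 \<mu>\<^sub>2 \<beta> N] by simp
next
  case (inc j \<alpha>)
  let ?F = "\<lambda>G k. fser h (\<lambda>p. of_real (pff h \<beta> p) * fdiffs h \<alpha> (\<lambda>k. trem N G k p) k)"
  let ?t = "\<mu>\<^sub>1 + \<mu>\<^sub>2 - real N * (\<rho> - \<delta>) - \<rho> * real (mabs (inc j \<alpha>)) + \<delta> * real (mabs \<beta>)"
  note cls = coeff_class_Dk[OF inc.prems, of j] coeff_class_Dl[OF inc.prems, of j]
    coeff_class_Dk[OF coeff_class_Dl[OF inc.prems, of j], of j]
  \<comment> \<open>Only an inequality between total orders is asked for, because the mixed term
    drops by \<open>2 * \<rho>\<close>, more than required.\<close>
  have bd: "\<exists>C>0. \<forall>k\<in>lat. \<forall>\<theta>. norm (?F G' k \<theta>) \<le> C * br k powr ?t"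
    if cl: "G' \<in> coeff_class \<nu>\<^sub>1 \<nu>\<^sub>2" and le: "\<nu>\<^sub>1 + \<nu>\<^sub>2 \<le> \<mu>\<^sub>1 + \<mu>\<^sub>2 - \<rho>" for G' \<nu>\<^sub>1 \<nu>\<^sub>2
  proof -
    let ?u = "\<nu>\<^sub>1 + \<nu>\<^sub>2 - real N * (\<rho> - \<delta>) - \<rho> * real (mabs \<alpha>) + \<delta> * real (mabs \<beta>)"
    obtain C where C: "C > 0" "\<And>k \<theta>. k \<in> lat \<Longrightarrow> norm (?F G' k \<theta>) \<le> C * br k powr ?u"
      using inc.IH[OF cl] by blast
    have "?u \<le> ?t" using le by (simp add: algebra_simps)
    then have "C * br k powr ?u \<le> C * br k powr ?t" for k :: "real ^ 'n" using C(1) by (intro mult_left_mono powr_mono) auto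
    with C show ?thesis by (meson order_trans)
  qed
  obtain C1 where C1: "C1 > 0" "\<And>k \<theta>. k \<in> lat \<Longrightarrow> norm (?F (Dk j G) k \<theta>) \<le> C1 * br k powr ?t"
    using bd[OF cls(1)] by auto
  obtain C2 where C2: "C2 > 0" "\<And>k \<theta>. k \<in> lat \<Longrightarrow> norm (?F (Dl j G) k \<theta>) \<le> C2 * br k powr ?t"
    using bd[OF cls(2)] by auto
  obtain C3 where C3: "C3 > 0" "\<And>k \<theta>. k \<in> lat \<Longrightarrow> norm (?F (Dk j (Dl j G)) k \<theta>) \<le> C3 * br k powr ?t"
    using bd[OF cls(3)] \<delta> by auto
  have "norm (fser h (\<lambda>p. of_real (pff h \<beta> p) * fdiffs h (inc j \<alpha>) (\<lambda>k. trem N G k p) k) \<theta>) \<le> (C1 + C2 + h * C3) * br k powr ?t"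
    if k: "k \<in> lat" for k \<theta>
  proof -
    have r: "rd h (\<lambda>p. of_real (pff h \<beta> p) * fdiffs h \<alpha> (\<lambda>k. trem N G' k p) k)" if "G' \<in> coeff_class \<nu>\<^sub>1 \<nu>\<^sub>2" for G' \<nu>\<^sub>1 \<nu>\<^sub>2
      by (intro rd_pff[OF h] rd_fdiffs[OF h _ k] rd_trem[OF that])
    note s = rd_summable[OF h r[OF cls(1)]] rd_summable[OF h r[OF cls(2)]]
    have "fdiffs h (inc j \<alpha>) (\<lambda>k. trem N G k p) k = fdiffs h \<alpha> (\<lambda>k. trem N (Dk j G) k p) k
       + fdiffs h \<alpha> (\<lambda>k. trem N (Dl j G) k p) k + of_real h * fdiffs h \<alpha> (\<lambda>k. trem N (Dk j (Dl j G)) k p) k" for p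
    proof -
      have "fdiff h j (\<lambda>k. trem N G k p) = (\<lambda>k. trem N (Dk j G) k p + trem N (Dl j G) k p + of_real h * trem N (Dk j (Dl j G)) k p)"
        by (intro ext fdiff_trem)
      then show ?thesis by (simp only: fdiffs_fdiff[symmetric] fdiffs_add fdiffs_cmult)
    qed
    then have "fser h (\<lambda>p. of_real (pff h \<beta> p) * fdiffs h (inc j \<alpha>) (\<lambda>k. trem N G k p) k) \<theta>
        = fser h (\<lambda>p. of_real (pff h \<beta> p) * fdiffs h \<alpha> (\<lambda>k. trem N (Dk j G) k p) k
            + of_real (pff h \<beta> p) * fdiffs h \<alpha> (\<lambda>k. trem N (Dl j G) k p) k
            + of_real h * (of_real (pff h \<beta> p) * fdiffs h \<alpha> (\<lambda>k. trem N (Dk j (Dl j G)) k p) k)) \<theta>"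
      by (simp only: distrib_left mult.left_commute)
    also have "\<dots> = ?F (Dk j G) k \<theta> + ?F (Dl j G) k \<theta> + of_real h * ?F (Dk j (Dl j G)) k \<theta>"
      unfolding fser_cmult[symmetric]
      by (subst fser_add, (intro rd_summable[OF h] rd_add rd_cmult r[OF cls(1)] r[OF cls(2)] r[OF cls(3)])+)
         (simp only: fser_add[OF s])
    finally have "norm (fser h (\<lambda>p. of_real (pff h \<beta> p) * fdiffs h (inc j \<alpha>) (\<lambda>k. trem N G k p) k) \<theta>)
        \<le> norm (?F (Dk j G) k \<theta>) + norm (?F (Dl j G) k \<theta>) + norm (of_real h * ?F (Dk j (Dl j G)) k \<theta>)"
      by (simp only:) (intro norm_triangle_le add_mono norm_triangle_ineq order_refl)
    also have "\<dots> \<le> C1 * br k powr ?t + C2 * br k powr ?t + h * (C3 * br k powr ?t)"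
      using h by (intro add_mono C1(2) C2(2) k) (simp add: norm_mult C3(2)[OF k] mult_left_mono del: mabs_inc)
    finally show ?thesis by (simp only: distrib_right mult.assoc)
  qed
  moreover have "C1 + C2 + h * C3 > 0" using C1(1) C2(1) C3(1) h by (intro add_pos_pos mult_pos_pos)
  ultimately show ?case by blast
qed

end


subsection \<open>The symbol of an amplitude operator\<close>

context amplitude_params
begin

text \<open>Agreement with the remainder series is demanded on the lattice only, since
  \<open>fdiffs_cong\<close> shows that the class sees nothing else.\<close>

lemma symbol_class_trem:
  fixes G :: "real ^ 'n::finite \<Rightarrow> real ^ 'n \<Rightarrow> real ^ 'n \<Rightarrow> complex"
  assumes G: "G \<in> coeff_class \<mu>\<^sub>1 \<mu>\<^sub>2" and \<tau>: "\<And>k. k \<in> lat \<Longrightarrow> \<tau> k = fser h (trem N G k)"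
  shows "\<tau> \<in> symbol_class h (\<mu>\<^sub>1 + \<mu>\<^sub>2 - real N * (\<rho> - \<delta>)) \<rho> \<delta>"
  unfolding symbol_class_def mem_Collect_eq
proof (intro conjI ballI allI)
  show "\<tau> k \<in> smooth_torus" if "k \<in> lat" for k
    by (simp add: \<tau> that fser_smooth h rd_trem[OF G])
  fix \<alpha> \<beta> :: "'n mindex"
  have "torD h \<beta> (\<lambda>\<omega>. fdiffs h \<alpha> (\<lambda>k'. \<tau> k' \<omega>) k) \<theta>
      = fser h (\<lambda>p. of_real (pff h \<beta> p) * fdiffs h \<alpha> (\<lambda>k. trem N G k p) k) \<theta>" if k: "k \<in> lat" for k \<theta>
  proof -
    have "fdiffs h \<alpha> (\<lambda>k'. \<tau> k' \<omega>) k = fser h (\<lambda>p. fdiffs h \<alpha> (\<lambda>k. trem N G k p) k) \<omega>" for \<omega>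
    proof -
      have "fdiffs h \<alpha> (\<lambda>k'. \<tau> k' \<omega>) k = fdiffs h \<alpha> (\<lambda>k'. fser h (trem N G k') \<omega>) k"
        by (rule fdiffs_cong[OF _ k]) (simp add: \<tau>)
      then show ?thesis by (simp only: fdiffs_fser[OF h rd_trem[OF G] k])
    qed
    then show ?thesis by (simp add: torD_fser[OF h rd_fdiffs[OF h rd_trem[OF G] k]])
  qed
  with trem_symbol_bound[OF G, of \<beta> \<alpha> N]
  show "\<exists>C>0. \<forall>k\<in>lat. \<forall>\<theta>. norm (torD h \<beta> (\<lambda>\<omega>. fdiffs h \<alpha> (\<lambda>k'. \<tau> k' \<omega>) k) \<theta>)
     \<le> C * (1 + norm k) powr (\<mu>\<^sub>1 + \<mu>\<^sub>2 - real N * (\<rho> - \<delta>) - \<rho> * real (mabs \<alpha>) + \<delta> * real (mabs \<beta>))"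
    by (simp add: br_def)
qed

lemma fser_trem:
  assumes G: "G \<in> coeff_class \<mu>\<^sub>1 \<mu>\<^sub>2" and k: "k \<in> lat"
  shows "fser h (trem N G k) \<theta> = fser h (\<lambda>p. G k (k + p) p) \<theta>
     - (\<Sum>\<alpha> | mabs \<alpha> < N. 1 / of_nat (mfact \<alpha>) * fser h (\<lambda>p. of_real (pff h \<alpha> p) * fdiffs h \<alpha> (\<lambda>l. G k l p) k) \<theta>)"
proof -
  note r = rd_taylor_term[OF G k]
  have "fser h (trem N G k) \<theta> = fser h (\<lambda>p. G k (k + p) p) \<theta>
     - fser h (\<lambda>p. \<Sum>\<alpha> | mabs \<alpha> < N. of_real (pff h \<alpha> p / mfact \<alpha>) * cdiffs h (\<lambda>_. 0) \<alpha> G k k p) \<theta>"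
    unfolding trem_eq[abs_def]
    by (intro fser_diff rd_summable[OF h] rd_diag[OF G k] rd_sum r)
  also have "fser h (\<lambda>p. \<Sum>\<alpha> | mabs \<alpha> < N. of_real (pff h \<alpha> p / mfact \<alpha>) * cdiffs h (\<lambda>_. 0) \<alpha> G k k p) \<theta>
     = (\<Sum>\<alpha> | mabs \<alpha> < N. fser h (\<lambda>p. of_real (pff h \<alpha> p / mfact \<alpha>) * cdiffs h (\<lambda>_. 0) \<alpha> G k k p) \<theta>)"
    by (rule fser_sum[OF r h])
  also have "\<dots> = (\<Sum>\<alpha> | mabs \<alpha> < N. 1 / of_nat (mfact \<alpha>) * fser h (\<lambda>p. of_real (pff h \<alpha> p) * fdiffs h \<alpha> (\<lambda>l. G k l p) k) \<theta>)"
    unfolding fser_cmult[symmetric] by (simp add: cdiffs_zero_left)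
  finally show ?thesis .
qed

text \<open>Differences in \<open>l\<close> are finite combinations of values at lattice points, so
  they pass inside the series; there \<open>torD\<close> has become the factor
  \<open>pff h \<alpha> p\<close>, a constant in \<open>l\<close>.\<close>

lemma amplitude_taylor_coeff:
  fixes a :: "real ^ 'n::finite \<Rightarrow> real ^ 'n \<Rightarrow> real ^ 'n \<Rightarrow> complex"
  assumes sm: "\<And>l. l \<in> lat \<Longrightarrow> a k l \<in> smooth_torus" and k: "k \<in> lat"
  shows "fdiffs h \<alpha> (\<lambda>l. torD h \<alpha> (a k l) \<theta>) k
     = fser h (\<lambda>p. of_real (pff h \<alpha> p) * fdiffs h \<alpha> (\<lambda>l. fc h (a k l) p) k) \<theta>"
proof -
  have "fdiffs h \<alpha> (\<lambda>l. torD h \<alpha> (a k l) \<theta>) k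
      = fdiffs h \<alpha> (\<lambda>l. fser h (\<lambda>p. of_real (pff h \<alpha> p) * fc h (a k l) p) \<theta>) k"
    by (rule fdiffs_cong[OF _ k]) (simp add: torD_smooth h sm)
  also have "\<dots> = fser h (\<lambda>p. fdiffs h \<alpha> (\<lambda>l. of_real (pff h \<alpha> p) * fc h (a k l) p) k) \<theta>"
    by (intro fdiffs_fser[OF h _ k] rd_pff h rd_fc sm)
  finally show ?thesis by (simp add: fdiffs_cmult)
qed

section \<open>Both operators as sums against a kernel on the lattice\<close>

lemma schwartz_rd: "f \<in> schwartz h \<Longrightarrow> rd h f"
  unfolding schwartz_def rd_def by (auto simp: bdd_above_def)

lemma sc_fourier_fser: "sc_fourier h f = fser h (\<lambda>p. f (- p))"
proof
  fix \<theta>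
  have "sc_fourier h f \<theta> = (\<Sum>\<^sub>\<infinity>k\<in>lat. chr h (- k) \<theta> * f k)"
    unfolding sc_fourier_def chr_def by simp
  also have "\<dots> = (\<Sum>\<^sub>\<infinity>p\<in>lat. f (- p) * chr h p \<theta>)"
    by (rule infsum_reindex_bij_witness[of _ uminus uminus]) (auto intro: hlattice_uminus simp: mult.commute)
  finally show "sc_fourier h f \<theta> = fser h (\<lambda>p. f (- p)) \<theta>" by (simp add: fser_def)
qed

lemma amp_op_eq:
  fixes a :: "real ^ 'n::finite \<Rightarrow> real ^ 'n \<Rightarrow> real ^ 'n \<Rightarrow> complex"
  assumes sm: "\<And>l. l \<in> lat \<Longrightarrow> a k l \<in> smooth_torus"
  shows "amp_op h a f k = (\<Sum>\<^sub>\<infinity>l\<in>lat. f l * fc h (a k l) (l - k))"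
  unfolding amp_op_def
proof (rule infsum_cong)
  fix l :: "real ^ 'n" assume l: "l \<in> lat"
  have "(LINT \<theta>:unit_cube|lborel. exp (2 * of_real pi * (\<i> / of_real h) * of_real ((k - l) \<bullet> \<theta>)) * a k l \<theta> * f l)
     = (LINT \<theta>:unit_cube|lborel. f l * (chr h (- (l - k)) \<theta> * a k l \<theta>))"
    by (simp add: chr_def mult_ac)
  also have "\<dots> = integral unit_cube (\<lambda>\<theta>. f l * (chr h (- (l - k)) \<theta> * a k l \<theta>))"
    by (intro LINT_cube continuous_intros smooth_torus_continuous sm l)
  finally show "(LINT \<theta>:unit_cube|lborel. exp (2 * of_real pi * (\<i> / of_real h) * of_real ((k - l) \<bullet> \<theta>)) * a k l \<theta> * f l)
     = f l * fc h (a k l) (l - k)" by (simp add: fc_def)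
qed

text \<open>Termwise integration of the transform exhibits the kernel of
  \<open>Op h \<sigma>\<close> at \<open>(k, l)\<close> as the coefficient of
  \<open>\<sigma> k\<close> at \<open>l - k\<close>, the same form in which \<open>amp_op_eq\<close>
  writes the amplitude operator.\<close>

lemma Op_eq:
  fixes \<sigma> :: "real ^ 'n::finite \<Rightarrow> real ^ 'n \<Rightarrow> complex"
  assumes f: "rd h f" and \<sigma>: "continuous_on UNIV (\<sigma> k)"
  shows "Op h \<sigma> f k = (\<Sum>\<^sub>\<infinity>l\<in>lat. f l * fc h (\<sigma> k) (l - k))"
proof -
  have "rd h (\<lambda>p. f (- p))"
    unfolding rd_def
  proof
    fix M
    obtain C where "\<forall>p\<in>lat. (1 + norm p) ^ M * norm (f p) \<le> C" using f unfolding rd_def by blast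
    then have "\<forall>p\<in>lat. (1 + norm p) ^ M * norm (f (- p)) \<le> C"
      by (metis hlattice_uminus norm_minus_cancel)
    then show "\<exists>C. \<forall>p\<in>lat. (1 + norm p) ^ M * norm (f (- p)) \<le> C" by blast
  qed
  note s = rd_summable[OF h this]
  have c: "continuous_on UNIV (\<lambda>\<theta>. chr h k \<theta> * \<sigma> k \<theta>)" by (intro continuous_intros \<sigma>)
  have "Op h \<sigma> f k = (LINT \<theta>:unit_cube|lborel. chr h k \<theta> * \<sigma> k \<theta> * fser h (\<lambda>p. f (- p)) \<theta>)"
    by (simp add: Op_def chr_def sc_fourier_fser)
  also have "\<dots> = integral unit_cube (\<lambda>\<theta>. chr h k \<theta> * \<sigma> k \<theta> * fser h (\<lambda>p. f (- p)) \<theta>)"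
    by (intro LINT_cube continuous_intros \<sigma> fser_continuous s)
  also have "\<dots> = (\<Sum>\<^sub>\<infinity>p\<in>lat. f (- p) * integral unit_cube (\<lambda>\<theta>. chr h k \<theta> * \<sigma> k \<theta> * chr h p \<theta>))"
    by (rule integral_mult_fser[OF s c])
  also have "\<dots> = (\<Sum>\<^sub>\<infinity>l\<in>lat. f l * fc h (\<sigma> k) (l - k))"
  proof (rule infsum_reindex_bij_witness[of _ uminus uminus])
    fix p :: "real ^ 'n"
    have eq: "chr h k \<theta> * \<sigma> k \<theta> * chr h p \<theta> = chr h (- (- p - k)) \<theta> * \<sigma> k \<theta>" for \<theta>
      using chr_add[of h k p \<theta>] by (simp add: mult_ac add.commute)
    show "f (- p) * fc h (\<sigma> k) (- p - k) = f (- p) * integral unit_cube (\<lambda>\<theta>. chr h k \<theta> * \<sigma> k \<theta> * chr h p \<theta>)"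
      unfolding fc_def eq ..
  qed (auto intro: hlattice_uminus)
  finally show ?thesis .
qed

end

theorem theorem3p14:
  fixes h \<rho> \<delta> \<mu>\<^sub>1 \<mu>\<^sub>2 :: real
    and a :: "real ^ 'n::finite \<Rightarrow> real ^ 'n \<Rightarrow> real ^ 'n \<Rightarrow> complex"
  assumes "0 < h" "h \<le> 1"
    and "0 \<le> \<delta>" "\<delta> < \<rho>" "\<rho> \<le> 1"
    and "a \<in> amplitude_class h \<mu>\<^sub>1 \<mu>\<^sub>2 \<rho> \<delta>"
  shows "\<exists>\<sigma> \<in> symbol_class h (\<mu>\<^sub>1 + \<mu>\<^sub>2) \<rho> \<delta>.
     (\<forall>f \<in> schwartz h. \<forall>k \<in> hlattice h. amp_op h a f k = Op h \<sigma> f k) \<and>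
     (\<forall>N::nat.
        (\<lambda>k \<theta>. \<sigma> k \<theta> - (\<Sum>\<alpha> | mabs \<alpha> < N.
            1 / of_nat (mfact \<alpha>) * fdiffs h \<alpha> (\<lambda>l. torD h \<alpha> (a k l) \<theta>) k))
        \<in> symbol_class h (\<mu>\<^sub>1 + \<mu>\<^sub>2 - real N * (\<rho> - \<delta>)) \<rho> \<delta>)"
proof -
  interpret amplitude_params h \<rho> \<delta>
    using assms by unfold_locales auto
  have sm: "a k l \<in> smooth_torus" if "k \<in> hlattice h" "l \<in> hlattice h" for k l
    using assms(6) that by (auto simp: amplitude_class_def)
  define G where "G = (\<lambda>k l. fc h (a k l))"
  have G: "G \<in> coeff_class \<mu>\<^sub>1 \<mu>\<^sub>2"
    unfolding G_def by (rule amplitude_coeff_class[OF assms(6)])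
  define \<sigma> where "\<sigma> k = fser h (\<lambda>p. G k (k + p) p)" for k
  have expansion: "(\<lambda>k \<theta>. \<sigma> k \<theta> - (\<Sum>\<alpha> | mabs \<alpha> < N.
            1 / of_nat (mfact \<alpha>) * fdiffs h \<alpha> (\<lambda>l. torD h \<alpha> (a k l) \<theta>) k))
        \<in> symbol_class h (\<mu>\<^sub>1 + \<mu>\<^sub>2 - real N * (\<rho> - \<delta>)) \<rho> \<delta>" for N
  proof (rule symbol_class_trem[OF G, of _ N], rule ext)
    fix k \<theta> :: "real ^ 'n" assume k: "k \<in> hlattice h"
    have "fdiffs h \<alpha> (\<lambda>l. torD h \<alpha> (a k l) \<theta>) k
        = fser h (\<lambda>p. of_real (pff h \<alpha> p) * fdiffs h \<alpha> (\<lambda>l. G k l p) k) \<theta>" for \<alpha>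
      unfolding G_def by (rule amplitude_taylor_coeff[of a k, OF sm[OF k] k])
    then show "\<sigma> k \<theta> - (\<Sum>\<alpha> | mabs \<alpha> < N. 1 / of_nat (mfact \<alpha>) * fdiffs h \<alpha> (\<lambda>l. torD h \<alpha> (a k l) \<theta>) k)
        = fser h (trem N G k) \<theta>"
      unfolding fser_trem[OF G k] by (simp add: \<sigma>_def)
  qed
  show ?thesis
  proof (intro bexI conjI ballI allI)
    \<comment> \<open>At order 0 the subtracted sum is empty and the exponent is unchanged.\<close>
    show "\<sigma> \<in> symbol_class h (\<mu>\<^sub>1 + \<mu>\<^sub>2) \<rho> \<delta>" using expansion[of 0] by simp
    fix f :: "real ^ 'n \<Rightarrow> complex" and k :: "real ^ 'n" assume f: "f \<in> schwartz h" and k: "k \<in> hlattice h"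
    note s = rd_summable[OF h rd_diag[OF G k]]
    \<comment> \<open>The frequency \<open>p = l - k\<close> picks out \<open>G k l (l - k)\<close>,
      because \<open>k + (l - k) = l\<close>.\<close>
    have "fc h (\<sigma> k) (l - k) = fc h (a k l) (l - k)" if "l \<in> hlattice h" for l
      using fc_fser[OF h s hlattice_diff[OF that k]] by (simp add: \<sigma>_def G_def)
    then show "amp_op h a f k = Op h \<sigma> f k"
      using Op_eq[OF schwartz_rd[OF f], of \<sigma> k] fser_continuous[OF s]
      by (simp add: amp_op_eq sm k \<sigma>_def cong: infsum_cong)
  qed (rule expansion)
qed

end
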